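(* Let $d\ge 1$ and let $\Phi=\{\phi_i\}_{i=1}^\ell$ be a dimensional regular iterated function system of similarities on $\mathbb{R}^d$ with contraction ratios $r_1,\ldots,r_\ell\in(0,1)$, and let $\mathbf{p}=(p_1,\ldots,p_\ell)$ be a probability vector with strictly positive entries. Let $\mu$ be the self-similar measure generated by $\Phi$ and $\mathbf{p}$, and for $q\in\mathbb{R}$ let $T(q)$ be the unique real number satisfying $$\sum_{i=1}^\ell p_i^q\, r_i^{-T(q)}=1.$$ Then the following statements hold. (1) The $L^q$-spectrum $\tau_\mu$ of $\mu$ on $[0,1]$ is given as follows: (a) If $T'(1)\ge d$, then $\tau_\mu(q)=d(q-1)$ for $q\in[0,1]$. (b) If $T'(1)<d$ and $T(0)\ge -d$, then $\tau_\mu(q)=T(q)$ for $q\in[0,1]$. (c) If $T'(1)<d$ and $T(0)<-d$, set $\tilde q=\inf\{q\in(0,1): T'(q)q-T(q)\le d\}$. Then $$\tau_\mu(q)=\begin{cases} T(q) & \text{if } q\in[\tilde q,1],\\ \dfrac{q(d+T(\tilde q))}{\tilde q}-d & \text{if } q\in[0,\tilde q).\end{cases}$$ (2) $\tau_\mu$ is differentiable on $(0,1]$. Moreover, for every $\alpha\in[\tau_\mu'(1),\tau_\mu'(0+)]$, $$\dim_H E_\mu(\alpha)=\tau_\mu^*(\alpha),$$ where $\tau_\mu'(0+)$ denotes the right derivative of $\tau_\mu$ at $0$.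
   Context: A similarity on $\mathbb{R}^d$ is a map $\phi(x)=rUx+a$ with $r>0$, $U$ a $d\times d$ orthogonal matrix and $a\in\mathbb{R}^d$; $r$ is its contraction ratio. An iterated function system (IFS) of similarities is a finite collection $\Phi=\{\phi_i\}_{i=1}^\ell$ of contracting similarities. For a probability vector $\mathbf{p}=(p_1,\ldots,p_\ell)$, the self-similar measure $\mu=\mu_{\Phi,\mathbf{p}}$ is the unique Borel probability measure on $\mathbb{R}^d$ with $\mu=\sum_{i=1}^\ell p_i\,\mu\circ\phi_i^{-1}$. For a finite Borel measure $\eta$ on $\mathbb{R}^d$ with compact support, the $L^q$-spectrum is $$\tau_\eta(q)=\liminf_{r\to0}\frac{\log\Theta_\eta(q,r)}{\log r},\qquad \Theta_\eta(q,r)=\sup\sum_i\eta(B(x_i,r))^q,\qquad q\in\mathbb{R},$$ where the supremum is over all families of disjoint closed balls $\{B(x_i,r)\}_i$ of radius $r$ with centers $x_i\in\mathrm{supp}(\eta)$. Its conjugate is $\tau_\eta^*(\alpha)=\inf\{\alpha q-\tau_\eta(q):q\in\mathbb{R}\}$. The local dimension of $\eta$ at $x$ is $d(\eta,x)=\lim_{r\to0}\frac{\log\eta(B(x,r))}{\log r}$ when the limit exists, and $E_\eta(\alpha)=\{x\in\mathbb{R}^d: d(\eta,x)=\alpha\}$. $\dim_H$ of a set is Hausdorff dimension, with the convention $\dim_H\emptyset=-\infty$. Every self-similar measure $\mu$ is exact dimensional, i.e. $d(\mu,x)$ exists and equals a constant for $\mu$-a.e. $x$ (a known fact); this constant is denoted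 $\dim_H\mu$. The similarity dimension of $\mu=\mu_{\Phi,\mathbf{p}}$ is $\dim_S\mu=\dfrac{\sum_{i=1}^\ell p_i\log p_i}{\sum_{i=1}^\ell p_i\log r_i}$. An IFS $\Phi=\{\phi_i\}_{i=1}^\ell$ of similarities on $\mathbb{R}^d$ is called dimensional regular if for every probability vector $\mathbf{p}=(p_1,\ldots,p_\ell)$ with strictly positive entries, the self-similar measure $\mu=\mu_{\Phi,\mathbf{p}}$ satisfies $\dim_H\mu=\min\{d,\dim_S\mu\}$. *)

theory Defs
  imports "HOL-Probability.Probability"
begin

section \<open>Self-similar measures\<close>

text \<open>
  The maps, ratios and weights of an IFS are indexed by \<open>{1..l}\<close>; values of
  \<open>\<phi>\<close>, \<open>r\<close>, \<open>p\<close> outside this range play no role.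
\<close>

definition similarity :: "real \<Rightarrow> (real ^ 'n \<Rightarrow> real ^ 'n) \<Rightarrow> bool" where
  "similarity r f \<longleftrightarrow>
     r > 0 \<and> (\<exists>U a. orthogonal_matrix (U :: real ^ 'n ^ 'n) \<and> (\<forall>x. f x = r *\<^sub>R (U *v x) + a))"

definition similarity_ifs :: "nat \<Rightarrow> (nat \<Rightarrow> real ^ 'n \<Rightarrow> real ^ 'n) \<Rightarrow> (nat \<Rightarrow> real) \<Rightarrow> bool" where
  "similarity_ifs l \<phi> r \<longleftrightarrow> (\<forall>i\<in>{1..l}. similarity (r i) (\<phi> i) \<and> r i < 1)"

definition positive_prob_vector :: "nat \<Rightarrow> (nat \<Rightarrow> real) \<Rightarrow> bool" where
  "positive_prob_vector l p \<longleftrightarrow> (\<forall>i\<in>{1..l}. p i > 0) \<and> (\<Sum>i=1..l. p i) = 1"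

definition self_similar_measure ::
    "nat \<Rightarrow> (nat \<Rightarrow> real ^ 'n \<Rightarrow> real ^ 'n) \<Rightarrow> (nat \<Rightarrow> real) \<Rightarrow> (real ^ 'n) measure \<Rightarrow> bool" where
  "self_similar_measure l \<phi> p \<mu> \<longleftrightarrow>
     prob_space \<mu> \<and> sets \<mu> = sets borel \<and>
     (\<forall>A\<in>sets borel. measure \<mu> A = (\<Sum>i=1..l. p i * measure \<mu> (\<phi> i -` A)))"

definition similarity_dimension :: "nat \<Rightarrow> (nat \<Rightarrow> real) \<Rightarrow> (nat \<Rightarrow> real) \<Rightarrow> real" where
  "similarity_dimension l r p = (\<Sum>i=1..l. p i * ln (p i)) / (\<Sum>i=1..l. p i * ln (r i))"

definition T_fun :: "nat \<Rightarrow> (nat \<Rightarrow> real) \<Rightarrow> (nat \<Rightarrow> real) \<Rightarrow> real \<Rightarrow> real" where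
  "T_fun l r p q = (THE t. (\<Sum>i=1..l. p i powr q * r i powr (- t)) = 1)"

section \<open>Multifractal quantities\<close>

definition supp :: "'a::metric_space measure \<Rightarrow> 'a set" where
  "supp \<eta> = {x. \<forall>U. open U \<and> x \<in> U \<longrightarrow> emeasure \<eta> U > 0}"

text \<open>
  A disjoint family of closed \<open>\<rho>\<close>-balls is determined by its set \<open>C\<close> of centres, which is
  finite when the support is compact.  For a finite measure with compact support the sums below
  are bounded for every real \<open>q\<close>, so the supremum can be taken in the reals.  The masses of
  the balls are strictly positive, so \<open>powr\<close> is also the intended power for \<open>q \<le> 0\<close>.
\<close>

definition Theta :: "'a::metric_space measure \<Rightarrow> real \<Rightarrow> real \<Rightarrow> real" where
  "Theta \<eta> q \<rho> =
     (SUP C \<in> {C. finite C \<and> C \<subseteq> supp \<eta> \<and> disjoint_family_on (\<lambda>x. cball x \<rho>) C}.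
        \<Sum>x\<in>C. measure \<eta> (cball x \<rho>) powr q)"

definition Lq_spectrum :: "'a::metric_space measure \<Rightarrow> real \<Rightarrow> ereal" where
  "Lq_spectrum \<eta> q = Liminf (at_right 0) (\<lambda>\<rho>. ereal (ln (Theta \<eta> q \<rho>) / ln \<rho>))"

definition conjugate :: "(real \<Rightarrow> ereal) \<Rightarrow> real \<Rightarrow> ereal" where
  "conjugate f \<alpha> = (INF q. ereal (\<alpha> * q) - f q)"

text \<open>
  Derivative of an extended-real-valued function at a point near which it is finite.
\<close>

definition has_ereal_derivative :: "(real \<Rightarrow> ereal) \<Rightarrow> real \<Rightarrow> real \<Rightarrow> real set \<Rightarrow> bool" where
  "has_ereal_derivative f D x S \<longleftrightarrow>
     \<bar>f x\<bar> \<noteq> \<infinity> \<and> (\<forall>\<^sub>F y in at x within S. \<bar>f y\<bar> \<noteq> \<infinity>) \<and>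
     ((\<lambda>y. real_of_ereal (f y)) has_real_derivative D) (at x within S)"

text \<open>
  Off the support the masses of small balls vanish and the local dimension is \<open>\<infinity>\<close>
  (with \<open>log 0 = -\<infinity>\<close>), whereas \<open>ln 0 = 0\<close> in HOL; hence a point with a
  real local dimension is required to lie in the support.
\<close>

definition has_local_dim :: "'a::metric_space measure \<Rightarrow> 'a \<Rightarrow> real \<Rightarrow> bool" where
  "has_local_dim \<eta> x \<alpha> \<longleftrightarrow>
     x \<in> supp \<eta> \<and> ((\<lambda>\<rho>. ln (measure \<eta> (cball x \<rho>)) / ln \<rho>) \<longlongrightarrow> \<alpha>) (at_right 0)"

definition level_set :: "'a::metric_space measure \<Rightarrow> real \<Rightarrow> 'a set" where
  "level_set \<eta> \<alpha> = {x. has_local_dim \<eta> x \<alpha>}"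

text \<open>The relation ``\<open>\<eta>\<close> is exact dimensional with dimension \<open>D\<close>''.\<close>

definition has_measure_dim :: "'a::metric_space measure \<Rightarrow> real \<Rightarrow> bool" where
  "has_measure_dim \<eta> D \<longleftrightarrow> (AE x in \<eta>. has_local_dim \<eta> x D)"

definition dimensional_regular ::
    "nat \<Rightarrow> (nat \<Rightarrow> real ^ 'n \<Rightarrow> real ^ 'n) \<Rightarrow> (nat \<Rightarrow> real) \<Rightarrow> bool" where
  "dimensional_regular l \<phi> r \<longleftrightarrow>
     (\<forall>p \<mu>. positive_prob_vector l p \<and> self_similar_measure l \<phi> p \<mu> \<longrightarrow>
        has_measure_dim \<mu> (min (real CARD('n)) (similarity_dimension l r p)))"

section \<open>Hausdorff dimension\<close>

text \<open>
  The \<open>s\<close>-th power of the diameter, with \<open>0\<close> for the empty set and \<open>0 ^ 0 = 1\<close>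
  for singletons, unlike \<open>0 powr 0 = 0\<close>.
\<close>

definition diam_pow :: "real \<Rightarrow> 'a::metric_space set \<Rightarrow> ennreal" where
  "diam_pow s U = (if U = {} then 0 else if s = 0 then 1 else ennreal (diameter U powr s))"

definition hausdorff_pre :: "real \<Rightarrow> real \<Rightarrow> 'a::metric_space set \<Rightarrow> ennreal" where
  "hausdorff_pre s \<delta> A =
     (INF U \<in> {U :: nat \<Rightarrow> 'a set. A \<subseteq> (\<Union>n. U n) \<and> (\<forall>n. bounded (U n) \<and> diameter (U n) \<le> \<delta>)}.
        \<Sum>n. diam_pow s (U n))"

definition hausdorff_measure :: "real \<Rightarrow> 'a::metric_space set \<Rightarrow> ennreal" where
  "hausdorff_measure s A = (SUP \<delta>\<in>{0<..}. hausdorff_pre s \<delta> A)"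

definition hausdorff_dim :: "'a::metric_space set \<Rightarrow> ereal" where
  "hausdorff_dim A =
     (if A = {} then -\<infinity> else Inf (ereal ` {s. s \<ge> 0 \<and> hausdorff_measure s A = 0}))"

end

theory Submission imports Defs
begin

text \<open>
  For \<open>q \<in> [0,1]\<close> let \<open>\<nu>\<close> be a self-similar measure with the tilted weights
  \<open>p\<^sub>i\<^sup>q r\<^sub>i\<^sup>-\<^sup>T\<^sup>(\<^sup>q\<^sup>)\<close>, whose similarity dimension is \<open>q T'(q) - T(q)\<close>.
  If this number is at most \<open>d\<close>, it is the dimension of \<open>\<nu>\<close> by regularity, and \<open>\<nu>\<close> is carried by
  the level set of \<open>\<alpha> = T'(q)\<close>: the upper bound for the local dimension of \<open>\<mu>\<close> comes from the moments
  \<open>\<integral> \<mu>(B(x,\<rho>))\<^sup>-\<^sup>\<theta> d\<nu>(x)\<close>, which satisfy a scaling recursion, and the lower bound from counting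
  balls with \<open>\<tau> \<ge> T\<close>, which is subadditivity of \<open>t \<mapsto> t\<^sup>q\<close>. The existence of such a \<open>\<nu>\<close> forces
  \<open>\<tau>(q') \<le> q' \<alpha> - (q T'(q) - T(q))\<close> for every real \<open>q'\<close> and bounds the Hausdorff dimension of the
  level set from below. Hence \<open>\<tau>(q) = T(q)\<close>, the conjugate at \<open>\<alpha>\<close> is attained at \<open>q\<close>, and a covering
  argument gives the upper bound for the dimension. When \<open>T'(1) \<ge> d\<close> the measure \<open>\<mu>\<close> itself plays
  the role of \<open>\<nu>\<close> with \<open>\<alpha> = d\<close>; to the left of the transition point, Hoelder's inequality against the
  number of balls gives the matching lower bound for \<open>\<tau>\<close>. The right derivative at \<open>1\<close> comes from a
  submultiplicativity of the packing sums for \<open>q > 1\<close> without multiplicative constant.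
\<close>


text \<open>No separation of the pieces is assumed, so the mass of a ball is not comparable to the
  weight of one cylinder. Keeping a single term of the self-similarity identity bounds masses from
  below only; bounds from above must come from counting disjoint balls. This asymmetry is why
  typical points need two different arguments. Regularity identifies the dimension of a tilted
  measure with q T'(q) - T(q) only while this number is at most d. It decreases for q >= 0, so the
  usable parameters in [0,1] form an interval ending at 1, or none at all. If the interval starts at
  an inner transition point, the tangent of T there passes through (0, -d); hence the linear piece
  is both the chord given by Hoelder and the line forced by the tilted measure, and it joins T
  differentiably. To the right of 1, subadditivity of powers fails and no formula for the spectrum
  is sought: the slope is squeezed between lines through (1, 0), one with slope the dimension of
  \<mu>, the others with any smaller slope.\<close>

declare One_nat_def [simp del] \<comment> \<open>it would turn \<open>{1..l}\<close> into \<open>{Suc 0..l}\<close>\<close>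

section \<open>The function \<open>T\<close>\<close>

locale weight_system =
  fixes l :: nat and r p :: "nat \<Rightarrow> real"
  assumes r_pos: "i \<in> {1..l} \<Longrightarrow> 0 < r i"
    and r_less_1: "i \<in> {1..l} \<Longrightarrow> r i < 1"
    and weights: "positive_prob_vector l p"
begin

lemma p_pos: "i \<in> {1..l} \<Longrightarrow> 0 < p i"
  using weights by (auto simp: positive_prob_vector_def)

lemma p_sum: "(\<Sum>i=1..l. p i) = 1"
  using weights by (auto simp: positive_prob_vector_def)

lemma l_pos: "{1..l} \<noteq> {}"
  using p_sum by force

abbreviation T :: "real \<Rightarrow> real" where "T \<equiv> T_fun l r p"

definition W :: "real \<Rightarrow> nat \<Rightarrow> real" where
  "W q i = p i powr q * r i powr (- T q)"

text \<open>The formula results from formal implicit differentiation of the equation defining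
  \<open>T\<close>. It is studied before \<open>T\<close> is known to be differentiable;
  \<open>has_derivative_T\<close> identifies it as the derivative.\<close>

definition dT :: "real \<Rightarrow> real" where
  "dT q = (\<Sum>i=1..l. W q i * ln (p i)) / (\<Sum>i=1..l. W q i * ln (r i))"

lemma pressure_strict_mono:
  assumes "s < t"
  shows "(\<Sum>i=1..l. p i powr q * r i powr (- s)) < (\<Sum>i=1..l. p i powr q * r i powr (- t))"
proof (rule sum_strict_mono)
  fix i assume i: "i \<in> {1..l}"
  have "r i powr (- s) < r i powr (- t)"
    using r_pos[OF i] r_less_1[OF i] assms by (simp add: powr_def)
  then show "p i powr q * r i powr (- s) < p i powr q * r i powr (- t)"
    using p_pos[OF i] by simp
qed (use l_pos in auto)

text \<open>The sum tends to 0 at minus infinity, and one of its summands alone already tends to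
  infinity at plus infinity.\<close>

lemma pressure_root_exists: "\<exists>t. (\<Sum>i=1..l. p i powr q * r i powr (- t)) = 1"
proof -
  let ?f = "\<lambda>t. \<Sum>i=1..l. p i powr q * r i powr (- t)"
  let ?F = "\<lambda>t. \<Sum>i=1..l. p i powr q * exp (- t * ln (r i))"
  have eq: "?f t = ?F t" for t
    by (intro sum.cong refl) (use r_pos in \<open>force simp: powr_def\<close>)
  have ln_neg: "ln (r i) < 0" if "i \<in> {1..l}" for i
    using r_pos r_less_1 that by simp
  have bot: "(?F \<longlongrightarrow> (\<Sum>i=1..l. p i powr q * 0)) at_bot"
  proof (intro tendsto_intros)
    fix i assume i: "i \<in> {1..l}"
    show "((\<lambda>t. exp (- t * ln (r i))) \<longlongrightarrow> 0) at_bot"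
    proof -
      have "filterlim (\<lambda>t. (- ln (r i)) * t) at_bot at_bot"
        by (rule filterlim_tendsto_pos_mult_at_bot[OF tendsto_const])
           (use ln_neg[OF i] in \<open>auto simp: filterlim_ident\<close>)
      then show ?thesis
        by (intro filterlim_compose[OF exp_at_bot]) (simp add: mult.commute)
    qed
  qed
  then have "\<forall>\<^sub>F t in at_bot. ?F t < 1"
    by (intro order_tendstoD) auto
  then obtain a where a: "?F a < 1"
    by (auto simp: eventually_at_bot_linorder)
  obtain j where j: "j \<in> {1..l}" using l_pos by auto
  have "filterlim (\<lambda>t. p j powr q * exp (- t * ln (r j))) at_top at_top"
  proof (rule filterlim_tendsto_pos_mult_at_top[OF tendsto_const])
    show "0 < p j powr q" using p_pos[OF j] by simp
    have "filterlim (\<lambda>t. (- ln (r j)) * t) at_top at_top"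
      by (rule filterlim_tendsto_pos_mult_at_top[OF tendsto_const])
         (use ln_neg[OF j] in \<open>auto simp: filterlim_ident\<close>)
    then show "filterlim (\<lambda>t. exp (- t * ln (r j))) at_top at_top"
      by (intro filterlim_compose[OF exp_at_top]) (simp add: mult.commute)
  qed
  then have "\<forall>\<^sub>F t in at_top. p j powr q * exp (- t * ln (r j)) > 1"
    by (simp add: filterlim_at_top_dense)
  then obtain b' where b': "\<And>t. t \<ge> b' \<Longrightarrow> p j powr q * exp (- t * ln (r j)) > 1"
    by (auto simp: eventually_at_top_linorder)
  define b where "b = max a b'"
  have "1 < p j powr q * exp (- b * ln (r j))" using b'[of b] by (simp add: b_def)
  also have "\<dots> \<le> ?F b"
    using member_le_sum[of j "{1..l}" "\<lambda>i. p i powr q * exp (- b * ln (r i))"] j by auto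
  finally have b: "1 < ?F b" .
  have "continuous_on {a..b} ?F" by (intro continuous_intros)
  then have "\<exists>t\<ge>a. t \<le> b \<and> ?F t = 1"
    by (intro IVT') (use a b in \<open>simp_all add: b_def less_imp_le del: minus_max_eq_min\<close>)
  then show ?thesis using eq by auto
qed

lemma T_unique:
  assumes "(\<Sum>i=1..l. p i powr q * r i powr (- t)) = 1"
  shows "T q = t"
  unfolding T_fun_def
proof (rule the_equality, fact assms)
  fix s assume "(\<Sum>i=1..l. p i powr q * r i powr (- s)) = 1"
  then show "s = t"
    using pressure_strict_mono[of s t q] pressure_strict_mono[of t s q] assms
    by (cases s t rule: linorder_cases) auto
qed

lemma W_sum: "(\<Sum>i=1..l. W q i) = 1"
  using pressure_root_exists[of q] T_unique[of q] by (auto simp: W_def)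

lemma T_1: "T 1 = 0"
proof (rule T_unique)
  have "(\<Sum>i=1..l. p i powr 1 * r i powr (- 0)) = (\<Sum>i=1..l. p i)"
    by (intro sum.cong refl) (use p_pos r_pos in \<open>force simp: powr_def\<close>)
  then show "(\<Sum>i=1..l. p i powr 1 * r i powr (- 0)) = 1" by (simp add: p_sum)
qed

lemma W_pos: "i \<in> {1..l} \<Longrightarrow> 0 < W q i"
  using p_pos[of i] r_pos[of i] by (simp add: W_def)

lemma W_1: "i \<in> {1..l} \<Longrightarrow> W 1 i = p i"
  using p_pos[of i] r_pos[of i] by (simp add: W_def T_1)

lemma W_weights: "positive_prob_vector l (W q)"
  using W_pos W_sum by (simp add: positive_prob_vector_def)

lemma W_ln_r_neg: "(\<Sum>i=1..l. W q i * ln (r i)) < 0"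
proof -
  have "0 < (\<Sum>i=1..l. W q i * - ln (r i))"
    by (intro sum_pos) (use l_pos W_pos r_pos r_less_1 in \<open>auto simp: mult_pos_neg\<close>)
  then show ?thesis by (simp add: sum_negf)
qed

text \<open>Concavity of \<open>T\<close> without calculus: both weight vectors sum to 1, each ratio
  \<open>W q' i / W q i\<close> is an exponential, and \<open>1 + x \<le> exp x\<close> makes the
  exponents linear in \<open>q' - q\<close> and \<open>T q' - T q\<close>.\<close>

lemma T_le_tangent: "T q' \<le> T q + dT q * (q' - q)"
proof -
  define h k where "h = q' - q" and "k = T q' - T q"
  have "0 = (\<Sum>i=1..l. W q' i - W q i)" by (simp add: sum_subtractf W_sum)
  also have "\<dots> \<ge> (\<Sum>i=1..l. W q i * (h * ln (p i) - k * ln (r i)))"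
  proof (rule sum_mono)
    fix i assume i: "i \<in> {1..l}"
    have "W q' i = W q i * exp (h * ln (p i) - k * ln (r i))"
      using p_pos[OF i] r_pos[OF i]
      by (simp add: W_def powr_def h_def k_def exp_add[symmetric] exp_diff[symmetric] algebra_simps)
    moreover have "1 + (h * ln (p i) - k * ln (r i)) \<le> exp (h * ln (p i) - k * ln (r i))"
      by (rule exp_ge_add_one_self)
    ultimately show "W q i * (h * ln (p i) - k * ln (r i)) \<le> W q' i - W q i"
      using W_pos[OF i, of q] mult_left_mono[of _ _ "W q i"] by (fastforce simp: algebra_simps)
  qed
  finally have "h * (\<Sum>i=1..l. W q i * ln (p i)) - k * (\<Sum>i=1..l. W q i * ln (r i)) \<le> 0"
    by (simp add: sum_distrib_left sum_subtractf algebra_simps)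
  then have "k \<le> h * dT q"
    using W_ln_r_neg[of q] by (simp add: dT_def field_simps)
  then show ?thesis by (simp add: h_def k_def algebra_simps)
qed

lemma dT_antimono: "q \<le> q' \<Longrightarrow> dT q' \<le> dT q"
proof -
  assume "q \<le> q'"
  have "dT q' * (q' - q) \<le> dT q * (q' - q)"
    using T_le_tangent[of q q'] T_le_tangent[of q' q] by (simp add: algebra_simps)
  then show ?thesis using \<open>q \<le> q'\<close> by (cases "q = q'") auto
qed

text \<open>Numerator and denominator are averages, with weights \<open>W q\<close>, of numbers
  independent of \<open>q\<close>. The bound starts a chain: \<open>T\<close> is Lipschitz, hence
  \<open>W\<close> and \<open>dT\<close> are continuous, hence \<open>T\<close> is
  differentiable.\<close>

lemma dT_bounded: "\<exists>B\<ge>0. \<forall>q. \<bar>dT q\<bar> \<le> B"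
proof -
  define a where "a = (\<Sum>i=1..l. \<bar>ln (p i)\<bar>)"
  define b where "b = Min ((\<lambda>i. - ln (r i)) ` {1..l})"
  have b: "b > 0" unfolding b_def
    using l_pos r_pos r_less_1 by (subst Min_gr_iff) auto
  have a: "a \<ge> 0" unfolding a_def by (intro sum_nonneg) auto
  have "\<bar>dT q\<bar> \<le> a / b" for q
  proof -
    have "\<bar>\<Sum>i=1..l. W q i * ln (p i)\<bar> \<le> (\<Sum>i=1..l. W q i * a)"
    proof (rule order_trans[OF sum_abs], rule sum_mono)
      fix i assume i: "i \<in> {1..l}"
      have "\<bar>ln (p i)\<bar> \<le> a" unfolding a_def using i by (intro member_le_sum) auto
      then show "\<bar>W q i * ln (p i)\<bar> \<le> W q i * a"
        using W_pos[OF i, of q] by (simp add: abs_mult)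
    qed
    also have "\<dots> = a" by (simp add: sum_distrib_right[symmetric] W_sum)
    finally have 1: "\<bar>\<Sum>i=1..l. W q i * ln (p i)\<bar> \<le> a" .
    have "(\<Sum>i=1..l. W q i * b) \<le> (\<Sum>i=1..l. W q i * - ln (r i))"
      by (intro sum_mono mult_left_mono) (use W_pos in \<open>auto simp: b_def less_imp_le\<close>)
    then have 2: "b \<le> \<bar>\<Sum>i=1..l. W q i * ln (r i)\<bar>"
      by (simp add: sum_distrib_right[symmetric] W_sum sum_negf)
    show ?thesis unfolding dT_def abs_divide using 1 2 a b by (intro frac_le) auto
  qed
  then show ?thesis using a b by (intro exI[of _ "a / b"]) auto
qed

lemma T_Lipschitz: "\<exists>B\<ge>0. \<forall>q q'. \<bar>T q' - T q\<bar> \<le> B * \<bar>q' - q\<bar>"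
proof -
  obtain B where B: "B \<ge> 0" "\<And>q. \<bar>dT q\<bar> \<le> B" using dT_bounded by auto
  have "T q' - T q \<le> B * \<bar>q' - q\<bar>" for q q'
  proof -
    have "T q' - T q \<le> dT q * (q' - q)" using T_le_tangent[of q' q] by simp
    also have "\<dots> \<le> \<bar>dT q\<bar> * \<bar>q' - q\<bar>" by (metis abs_ge_self abs_mult)
    also have "\<dots> \<le> B * \<bar>q' - q\<bar>" by (intro mult_right_mono B) auto
    finally show ?thesis .
  qed
  from this this[of _ _] have "\<bar>T q' - T q\<bar> \<le> B * \<bar>q' - q\<bar>" for q q'
    by (smt (verit) abs_minus_commute)
  then show ?thesis using B(1) by auto
qed

lemma continuous_T: "continuous_on UNIV T"
proof -
  obtain B where B: "B \<ge> 0" "\<And>q q'. \<bar>T q' - T q\<bar> \<le> B * \<bar>q' - q\<bar>" using T_Lipschitz by auto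
  have "B-lipschitz_on UNIV T"
    by (rule lipschitz_onI) (use B in \<open>auto simp: dist_real_def\<close>)
  then show ?thesis by (rule lipschitz_on_continuous_on)
qed

lemma continuous_dT: "continuous_on UNIV dT"
proof -
  have "continuous_on UNIV (\<lambda>q. W q i)" if "i \<in> {1..l}" for i
    unfolding W_def using p_pos[OF that] r_pos[OF that]
    by (intro continuous_intros continuous_T) auto
  then show ?thesis unfolding dT_def
    using W_ln_r_neg by (intro continuous_intros) (auto simp: less_imp_neq)
qed

lemma dT_near:
  assumes "0 < \<epsilon>"
  obtains \<delta> where "0 < \<delta>" "\<And>q'. \<bar>q' - q\<bar> < \<delta> \<Longrightarrow> \<bar>dT q' - dT q\<bar> < \<epsilon>"
  using continuous_dT assms unfolding continuous_on_iff by (metis UNIV_I dist_real_def)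

lemma has_derivative_T: "(T has_real_derivative dT q) (at q)"
proof -
  have "((\<lambda>q'. (T q' - T q) / (q' - q)) \<longlongrightarrow> dT q) (at q)"
  proof (rule tendsto_sandwich)
    have c: "(dT \<longlongrightarrow> dT q) (at q)"
      using continuous_dT by (simp add: continuous_on_def)
    show "((\<lambda>q'. min (dT q) (dT q')) \<longlongrightarrow> dT q) (at q)"
      using tendsto_min[OF tendsto_const c, of "dT q"] by simp
    show "((\<lambda>q'. max (dT q) (dT q')) \<longlongrightarrow> dT q) (at q)"
      using tendsto_max[OF tendsto_const c, of "dT q"] by simp
    \<comment> \<open>The tangents at \<open>q\<close> and at \<open>q'\<close> enclose the
      difference quotient; which of the two is the upper bound depends on the side.\<close>
    have *: "min (dT q) (dT q') \<le> (T q' - T q) / (q' - q) \<and> (T q' - T q) / (q' - q) \<le> max (dT q) (dT q')"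
      if "q' \<noteq> q" for q'
    proof (cases "q' < q")
      case True
      then have "dT q \<le> dT q'" by (intro dT_antimono) auto
      then show ?thesis
        using True T_le_tangent[of q' q] T_le_tangent[of q q'] by (auto simp: field_simps)
    next
      case False
      then have "q < q'" using that by auto
      then have "dT q' \<le> dT q" by (intro dT_antimono) auto
      then show ?thesis
        using \<open>q < q'\<close> T_le_tangent[of q' q] T_le_tangent[of q q'] by (auto simp: field_simps)
    qed
    then show "\<forall>\<^sub>F q' in at q. min (dT q) (dT q') \<le> (T q' - T q) / (q' - q)"
      "\<forall>\<^sub>F q' in at q. (T q' - T q) / (q' - q) \<le> max (dT q) (dT q')"
      by (auto simp: eventually_at_filter)
  qed
  then show ?thesis by (simp add: has_field_derivative_iff)
qed

lemma deriv_T: "deriv T q = dT q"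
  by (rule DERIV_imp_deriv[OF has_derivative_T])

lemma dT_1: "dT 1 = similarity_dimension l r p"
  unfolding dT_def similarity_dimension_def
  by (intro arg_cong2[where f = "(/)"] sum.cong) (simp_all only: W_1)

text \<open>\<open>ln (W q i)\<close> is linear in \<open>ln (p i)\<close> and
  \<open>ln (r i)\<close>, so the entropy quotient becomes the Legendre transform of
  \<open>T\<close> at the slope \<open>dT q\<close>.\<close>

lemma similarity_dimension_W: "similarity_dimension l r (W q) = q * dT q - T q"
proof -
  have "(\<Sum>i=1..l. W q i * ln (W q i)) =
        (\<Sum>i=1..l. q * (W q i * ln (p i)) - T q * (W q i * ln (r i)))"
  proof (rule sum.cong)
    fix i assume i: "i \<in> {1..l}"
    have "ln (W q i) = q * ln (p i) - T q * ln (r i)"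
      using p_pos[OF i] r_pos[OF i] by (simp add: W_def ln_mult ln_powr)
    then show "W q i * ln (W q i) = q * (W q i * ln (p i)) - T q * (W q i * ln (r i))"
      by (simp only:) (simp add: algebra_simps)
  qed simp
  also have "\<dots> = q * (\<Sum>i=1..l. W q i * ln (p i)) - T q * (\<Sum>i=1..l. W q i * ln (r i))"
    by (simp add: sum_subtractf sum_distrib_left)
  finally show ?thesis using W_ln_r_neg[of q]
    by (simp add: similarity_dimension_def dT_def diff_divide_distrib)
qed

lemma W_dim_nonneg: "0 \<le> q * dT q - T q"
proof -
  have "W q i \<le> 1" if "i \<in> {1..l}" for i
    using member_le_sum[of i "{1..l}" "W q"] W_pos W_sum that by (force intro: less_imp_le)
  then have "similarity_dimension l r (W q) \<ge> 0"
    unfolding similarity_dimension_def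
    by (intro divide_nonpos_neg[OF sum_nonpos W_ln_r_neg])
       (use W_pos in \<open>auto intro!: mult_nonneg_nonpos simp: less_imp_le\<close>)
  then show ?thesis by (simp add: similarity_dimension_W)
qed

text \<open>Because of this monotonicity, checking that the dimension is at most d at one parameter
  settles all larger ones (\<open>tilted_from\<close>).\<close>

lemma W_dim_antimono:
  assumes "0 \<le> q" "q \<le> q'"
  shows "q' * dT q' - T q' \<le> q * dT q - T q"
proof -
  have "T q \<le> T q' + dT q' * (q - q')" by (rule T_le_tangent)
  moreover have "q * dT q' \<le> q * dT q" using assms dT_antimono by (intro mult_left_mono) auto
  ultimately show ?thesis by (simp add: algebra_simps)
qed

end

section \<open>Packings by balls\<close>

abbreviation packing :: "real \<Rightarrow> 'a::metric_space set \<Rightarrow> bool" where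
  "packing \<rho> C \<equiv> finite C \<and> disjoint_family_on (\<lambda>x. cball x \<rho>) C"

text \<open>Volume comparison: a ball of radius \<rho> meeting \<open>cball 0 M\<close> lies in
  \<open>cball 0 (M + 2 * \<rho>)\<close>.\<close>

lemma packing_card_le:
  fixes C :: "'a::euclidean_space set"
  assumes C: "packing \<rho> C" and "\<rho> > 0" "M \<ge> 0"
    and meet: "\<And>x. x \<in> C \<Longrightarrow> cball x \<rho> \<inter> cball 0 M \<noteq> {}"
  shows "real (card C) \<le> ((M + 2 * \<rho>) / \<rho>) ^ DIM('a)"
proof -
  let ?v = "unit_ball_vol (real DIM('a))"
  have sub: "cball x \<rho> \<subseteq> cball 0 (M + 2 * \<rho>)" if x: "x \<in> C" for x
  proof
    fix y assume y: "y \<in> cball x \<rho>"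
    obtain z where z: "dist x z \<le> \<rho>" "norm z \<le> M" using meet[OF x] by auto
    have "norm y \<le> dist y x + dist x z + norm z"
      using norm_triangle_sub[of y z] dist_triangle[of y z x] by (simp add: dist_norm)
    then show "y \<in> cball 0 (M + 2 * \<rho>)" using y z by (auto simp: dist_commute)
  qed
  have "real (card C) * (?v * \<rho> ^ DIM('a)) = (\<Sum>x\<in>C. measure lborel (cball x \<rho>))"
    using \<open>\<rho> > 0\<close> by (simp add: content_cball)
  also have "\<dots> = measure lborel (\<Union>x\<in>C. cball x \<rho>)"
    using C by (intro measure_finite_Union[symmetric])
      (use emeasure_lborel_cball_finite in \<open>auto simp: disjoint_family_on_def less_top\<close>)
  also have "\<dots> \<le> measure lborel (cball 0 (M + 2 * \<rho>) :: 'a set)"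
    using sub C emeasure_lborel_cball_finite
    by (intro measure_mono_fmeasurable) (auto intro!: fmeasurableI simp: less_top)
  also have "\<dots> = ?v * (M + 2 * \<rho>) ^ DIM('a)"
    using assms by (simp add: content_cball)
  finally have "real (card C) * \<rho> ^ DIM('a) * ?v \<le> (M + 2 * \<rho>) ^ DIM('a) * ?v"
    by (simp add: algebra_simps)
  then have "real (card C) * \<rho> ^ DIM('a) \<le> (M + 2 * \<rho>) ^ DIM('a)"
    by (rule mult_right_le_imp_le) (auto intro: unit_ball_vol_pos)
  then show ?thesis using \<open>\<rho> > 0\<close> by (simp add: power_divide pos_le_divide_eq)
qed

lemma packing_card_le_powr:
  fixes C :: "'a::euclidean_space set"
  assumes "packing \<rho> C" "0 < \<rho>" "\<rho> \<le> 1" "M \<ge> 0"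
    and "\<And>x. x \<in> C \<Longrightarrow> cball x \<rho> \<inter> cball 0 M \<noteq> {}"
  shows "real (card C) \<le> (M + 2) ^ DIM('a) * \<rho> powr (- real DIM('a))"
proof -
  have "real (card C) \<le> ((M + 2 * \<rho>) / \<rho>) ^ DIM('a)"
    by (rule packing_card_le) fact+
  also have "\<dots> \<le> ((M + 2) / \<rho>) ^ DIM('a)"
    using assms by (intro power_mono divide_right_mono) auto
  also have "\<dots> = (M + 2) ^ DIM('a) * \<rho> powr (- real DIM('a))"
    using assms by (simp add: power_divide powr_minus powr_realpow divide_inverse power_mult_distrib power_inverse)
  finally show ?thesis .
qed

text \<open>Cardinalities of packings are bounded by volume, so a largest packing exists; a point
  outside all doubled balls could be added to it. This turns counts of disjoint balls into covers
  with centres in \<open>A\<close>.\<close>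

lemma maximal_packing:
  fixes A :: "'a::euclidean_space set"
  assumes A: "A \<subseteq> cball 0 M" and "\<rho> > 0" "M \<ge> 0"
  obtains C where "C \<subseteq> A" "packing \<rho> C" "A \<subseteq> (\<Union>c\<in>C. cball c (2 * \<rho>))"
proof -
  let ?P = "\<lambda>C. C \<subseteq> A \<and> packing \<rho> C"
  have "card C \<le> nat \<lceil>((M + 2 * \<rho>) / \<rho>) ^ DIM('a)\<rceil>" if "?P C" for C
  proof -
    have "real (card C) \<le> ((M + 2 * \<rho>) / \<rho>) ^ DIM('a)"
      using that A \<open>\<rho> > 0\<close> \<open>M \<ge> 0\<close> by (intro packing_card_le) force+
    then show ?thesis by linarith
  qed
  then have "\<exists>C. ?P C \<and> (\<forall>C'. ?P C' \<longrightarrow> card C' \<le> card C)"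
    by (intro ex_has_greatest_nat[of ?P "{}" card])
       (auto simp: disjoint_family_on_def intro: le_less_trans[OF _ lessI])
  then obtain C where C: "?P C" and max: "\<And>C'. ?P C' \<Longrightarrow> card C' \<le> card C" by blast
  have "x \<in> (\<Union>c\<in>C. cball c (2 * \<rho>))" if x: "x \<in> A" for x
  proof (rule ccontr)
    assume no: "x \<notin> (\<Union>c\<in>C. cball c (2 * \<rho>))"
    have far: "cball x \<rho> \<inter> cball c \<rho> = {}" if c: "c \<in> C" for c
    proof (rule ccontr)
      assume "cball x \<rho> \<inter> cball c \<rho> \<noteq> {}"
      then obtain y where "dist x y \<le> \<rho>" "dist c y \<le> \<rho>" by auto
      then have "dist c x \<le> 2 * \<rho>" using dist_triangle2[of c x y] by simp
      then show False using no c by auto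
    qed
    have "x \<notin> C" using no \<open>\<rho> > 0\<close> by force
    moreover have "?P (insert x C)"
      using C x far by (auto simp: disjoint_family_on_def)
    ultimately show False using max[of "insert x C"] C by auto
  qed
  then show ?thesis using C that by blast
qed

section \<open>Self-similar measures\<close>

lemma similarity_dist: "similarity s f \<Longrightarrow> dist (f x) (f y) = s * dist x y"
proof -
  assume "similarity s f"
  then obtain U a where s: "s > 0" and U: "orthogonal_matrix U" and f: "\<And>x. f x = s *\<^sub>R (U *v x) + a"
    by (auto simp: similarity_def)
  have "orthogonal_transformation ((*v) U)"
    using U by (simp add: orthogonal_transformation_matrix)
  then have "norm (U *v (x - y)) = norm (x - y)"
    by (rule orthogonal_transformation_norm)
  moreover have "f x - f y = s *\<^sub>R (U *v (x - y))"
    by (simp add: f matrix_vector_mult_diff_distrib scaleR_diff_right)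
  ultimately show ?thesis using s by (simp add: dist_norm)
qed

lemma similarity_surj: "similarity s f \<Longrightarrow> surj f"
proof -
  assume "similarity s f"
  then obtain U a where s: "s > 0" and U: "orthogonal_matrix U" and f: "\<And>x. f x = s *\<^sub>R (U *v x) + a"
    by (auto simp: similarity_def)
  have "f (transpose U *v ((1 / s) *\<^sub>R (y - a))) = y" for y
    using s U
    by (simp add: f orthogonal_matrix_def matrix_vector_mul_assoc del: transpose_matrix_vector)
  then show ?thesis by (rule surjI)
qed

lemma similarity_pos: "similarity s f \<Longrightarrow> 0 < s"
  by (simp add: similarity_def)

lemma similarity_inj: "similarity s f \<Longrightarrow> inj f"
  by (rule injI) (metis dist_eq_0_iff mult_eq_0_iff less_irrefl similarity_dist similarity_pos)

lemma similarity_continuous: "similarity s f \<Longrightarrow> continuous_on UNIV f"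
proof -
  assume *: "similarity s f"
  have "s-lipschitz_on UNIV f"
    by (rule lipschitz_onI) (use * similarity_dist[OF *] similarity_pos[OF *] in auto)
  then show ?thesis by (rule lipschitz_on_continuous_on)
qed

lemma similarity_vimage_cball:
  assumes "similarity s f"
  shows "f -` cball x \<rho> = cball (inv f x) (\<rho> / s)"
proof -
  have "dist x (f y) = s * dist (inv f x) y" for y
    using similarity_dist[OF assms, of "inv f x" y] surj_f_inv_f[OF similarity_surj[OF assms]] by simp
  then show ?thesis using similarity_pos[OF assms] by (auto simp: field_simps)
qed

lemma similarity_vimage_cball': 
  assumes "similarity s f"
  shows "f -` cball (f x) \<rho> = cball x (\<rho> / s)"
  using similarity_vimage_cball[OF assms, of "f x"] similarity_inj[OF assms] by simp

section \<open>Contracting systems and a ball carrying every self-similar measure\<close>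

locale contracting_system =
  fixes l :: nat and \<phi> :: "nat \<Rightarrow> real ^ 'n \<Rightarrow> real ^ 'n" and r :: "nat \<Rightarrow> real"
  assumes ifs: "similarity_ifs l \<phi> r" and nonempty: "{1..l} \<noteq> {}"
begin

lemma sim: "i \<in> {1..l} \<Longrightarrow> similarity (r i) (\<phi> i)"
  and ratio_less_1: "i \<in> {1..l} \<Longrightarrow> r i < 1"
  using ifs by (auto simp: similarity_ifs_def)

lemma ratio_pos: "i \<in> {1..l} \<Longrightarrow> 0 < r i"
  using sim similarity_pos by blast

lemma measurable_\<phi>: "i \<in> {1..l} \<Longrightarrow> \<phi> i \<in> borel_measurable borel"
  using sim similarity_continuous borel_measurable_continuous_onI by blast

definition rmax :: real where "rmax = Max (r ` {1..l})"
definition rmin :: real where "rmin = Min (r ` {1..l})"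
definition shift_bound :: real where "shift_bound = (\<Sum>i=1..l. norm (\<phi> i 0))"
text \<open>The first summand is the fixed point of the map
  \<open>R \<mapsto> shift_bound + rmax * R\<close> that controls norms in
  \<open>norm_\<phi>_le\<close>. The slack 1 lets iteration from any radius get below
  \<open>rad\<close> after finitely many steps.\<close>

definition rad :: real where "rad = shift_bound / (1 - rmax) + 1"

lemma r_le_rmax: "i \<in> {1..l} \<Longrightarrow> r i \<le> rmax"
  and rmin_le_r: "i \<in> {1..l} \<Longrightarrow> rmin \<le> r i"
  by (auto simp: rmax_def rmin_def)

lemma rmax_less_1: "rmax < 1"
  using nonempty ratio_less_1 by (simp add: rmax_def)

lemma rmin_pos: "0 < rmin"
  using nonempty ratio_pos by (simp add: rmin_def)

lemma rmin_le_rmax: "rmin \<le> rmax"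
  using nonempty r_le_rmax rmin_le_r by fastforce

lemma rmax_pos: "0 < rmax"
  using rmin_pos rmin_le_rmax by simp

lemma shift_bound_nonneg: "0 \<le> shift_bound"
  by (auto simp: shift_bound_def intro: sum_nonneg)

lemma rad_ge_1: "1 \<le> rad"
  using shift_bound_nonneg rmax_less_1 by (simp add: rad_def)

lemma norm_\<phi>_le: "i \<in> {1..l} \<Longrightarrow> norm (\<phi> i x) \<le> shift_bound + rmax * norm x"
proof -
  assume i: "i \<in> {1..l}"
  have "norm (\<phi> i x) \<le> norm (\<phi> i 0) + dist (\<phi> i x) (\<phi> i 0)"
    by (simp add: dist_norm norm_triangle_sub)
  also have "dist (\<phi> i x) (\<phi> i 0) = r i * norm x"
    by (simp add: similarity_dist[OF sim[OF i]])
  also have "norm (\<phi> i 0) \<le> shift_bound"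
    unfolding shift_bound_def using i by (intro member_le_sum) auto
  also have "r i * norm x \<le> rmax * norm x"
    using r_le_rmax[OF i] by (intro mult_right_mono) auto
  finally show ?thesis by simp
qed

context
  fixes p :: "nat \<Rightarrow> real" and \<mu> :: "(real ^ 'n) measure"
  assumes weights: "positive_prob_vector l p" and ssm: "self_similar_measure l \<phi> p \<mu>"
begin

lemma ssm_prob_space: "prob_space \<mu>"
  and ssm_sets: "sets \<mu> = sets borel"
  and ssm_measure: "A \<in> sets borel \<Longrightarrow> measure \<mu> A = (\<Sum>i=1..l. p i * measure \<mu> (\<phi> i -` A))"
  using ssm by (auto simp: self_similar_measure_def)

lemma ssm_space: "space \<mu> = UNIV"
  using sets_eq_imp_space_eq[OF ssm_sets] by simp

lemma ssm_measurable: "f \<in> borel_measurable borel \<Longrightarrow> f \<in> borel_measurable \<mu>"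
  using measurable_cong_sets[OF ssm_sets refl] by blast

lemma ssm_nn_integral:
  fixes f :: "real ^ 'n \<Rightarrow> ennreal"
  assumes "f \<in> borel_measurable borel"
  shows "(\<integral>\<^sup>+x. f x \<partial>\<mu>) = (\<Sum>i=1..l. ennreal (p i) * (\<integral>\<^sup>+x. f (\<phi> i x) \<partial>\<mu>))"
  using assms
proof (induct rule: borel_measurable_induct)
  case (cong f g)
  then show ?case by simp
next
  case (set A)
  interpret prob_space \<mu> by (rule ssm_prob_space)
  have meas: "\<phi> i -` A \<in> sets \<mu>" if "i \<in> {1..l}" for i
    using measurable_sets[OF measurable_\<phi>[OF that] set] by (simp add: ssm_sets)
  have "(\<integral>\<^sup>+x. indicator A x \<partial>\<mu>) = ennreal (measure \<mu> A)"
    using set by (simp add: ssm_sets emeasure_eq_measure)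
  also have "\<dots> = (\<Sum>i=1..l. ennreal (p i * measure \<mu> (\<phi> i -` A)))"
    using set weights
    by (subst ssm_measure, simp, subst sum_ennreal) (auto simp: positive_prob_vector_def less_imp_le)
  also have "\<dots> = (\<Sum>i=1..l. ennreal (p i) * (\<integral>\<^sup>+x. indicator A (\<phi> i x) \<partial>\<mu>))"
  proof (intro sum.cong refl)
    fix i assume i: "i \<in> {1..l}"
    have "(\<integral>\<^sup>+x. indicator A (\<phi> i x) \<partial>\<mu>) = (\<integral>\<^sup>+x. indicator (\<phi> i -` A) x \<partial>\<mu>)"
      by (intro nn_integral_cong) (simp add: indicator_def)
    then show "ennreal (p i * measure \<mu> (\<phi> i -` A)) = ennreal (p i) * (\<integral>\<^sup>+x. indicator A (\<phi> i x) \<partial>\<mu>)"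
      using meas[OF i] weights i
      by (simp add: emeasure_eq_measure ennreal_mult' positive_prob_vector_def less_imp_le)
  qed
  finally show ?case .
next
  case (mult u c)
  have m: "(\<lambda>x. u (\<phi> i x)) \<in> borel_measurable \<mu>" if "i \<in> {1..l}" for i
    by (rule ssm_measurable[OF measurable_compose[OF measurable_\<phi>[OF that] \<open>u \<in> borel_measurable borel\<close>]])
  have "(\<integral>\<^sup>+x. c * u x \<partial>\<mu>) = c * (\<integral>\<^sup>+x. u x \<partial>\<mu>)"
    using mult by (intro nn_integral_cmult ssm_measurable)
  also have "\<dots> = (\<Sum>i=1..l. ennreal (p i) * (c * (\<integral>\<^sup>+x. u (\<phi> i x) \<partial>\<mu>)))"
    by (simp only: mult sum_distrib_left) (intro sum.cong refl, simp add: mult_ac)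
  also have "\<dots> = (\<Sum>i=1..l. ennreal (p i) * (\<integral>\<^sup>+x. c * u (\<phi> i x) \<partial>\<mu>))"
    by (intro sum.cong refl) (subst nn_integral_cmult, use m in auto)
  finally show ?case .
next
  case (add u v)
  have m: "(\<lambda>x. u (\<phi> i x)) \<in> borel_measurable \<mu>" "(\<lambda>x. v (\<phi> i x)) \<in> borel_measurable \<mu>"
    if "i \<in> {1..l}" for i
    by (rule ssm_measurable[OF measurable_compose[OF measurable_\<phi>[OF that]]], fact)+
  have "(\<integral>\<^sup>+x. v x + u x \<partial>\<mu>) = (\<integral>\<^sup>+x. v x \<partial>\<mu>) + (\<integral>\<^sup>+x. u x \<partial>\<mu>)"
    using add by (intro nn_integral_add ssm_measurable)
  also have "\<dots> = (\<Sum>i=1..l. ennreal (p i) * ((\<integral>\<^sup>+x. v (\<phi> i x) \<partial>\<mu>) + (\<integral>\<^sup>+x. u (\<phi> i x) \<partial>\<mu>)))"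
    by (simp only: add sum.distrib distrib_left)
  also have "\<dots> = (\<Sum>i=1..l. ennreal (p i) * (\<integral>\<^sup>+x. v (\<phi> i x) + u (\<phi> i x) \<partial>\<mu>))"
    by (intro sum.cong refl) (subst nn_integral_add, use m in auto)
  finally show ?case .
next
  case (seq U)
  have m: "(\<lambda>x. U j (\<phi> i x)) \<in> borel_measurable \<mu>" if "i \<in> {1..l}" for i j
    by (rule ssm_measurable[OF measurable_compose[OF measurable_\<phi>[OF that]]], fact)
  have inc: "incseq (\<lambda>j x. U j (\<phi> i x))" for i
    using \<open>incseq U\<close> by (auto simp: incseq_def le_fun_def)
  have "(\<integral>\<^sup>+x. (SUP j. U j) x \<partial>\<mu>) = (SUP j. \<integral>\<^sup>+x. U j x \<partial>\<mu>)"
    unfolding SUP_apply using seq by (intro nn_integral_monotone_convergence_SUP ssm_measurable) auto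
  also have "\<dots> = (SUP j. \<Sum>i=1..l. ennreal (p i) * (\<integral>\<^sup>+x. U j (\<phi> i x) \<partial>\<mu>))"
    by (simp only: seq)
  also have "\<dots> = (\<Sum>i=1..l. SUP j. ennreal (p i) * (\<integral>\<^sup>+x. U j (\<phi> i x) \<partial>\<mu>))"
    by (rule ennreal_SUP_sum)
       (use inc in \<open>auto simp: incseq_def le_fun_def intro!: mult_left_mono nn_integral_mono\<close>)
  also have "\<dots> = (\<Sum>i=1..l. ennreal (p i) * (\<integral>\<^sup>+x. (SUP j. U j) (\<phi> i x) \<partial>\<mu>))"
    unfolding SUP_apply
    by (intro sum.cong refl) (subst nn_integral_monotone_convergence_SUP, use m inc in \<open>auto simp: SUP_mult_left_ennreal\<close>)
  finally show ?case .
qed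

text \<open>Compactness of the support has to be derived. By self-similarity the mass of
  \<open>cball 0 R\<close> is at most that of \<open>cball 0 (shift_bound + rmax * R)\<close>;
  iterating shrinks the excess over the fixed point \<open>b\<close> by \<open>rmax\<close> each
  time. So no ball about 0 has more mass than \<open>cball 0 rad\<close>, and large balls have mass
  close to 1.\<close>

lemma ssm_cball_rad: "measure \<mu> (cball 0 rad) = 1"
proof -
  interpret prob_space \<mu> by (rule ssm_prob_space)
  have sets: "cball x R \<in> sets \<mu>" for x :: "real ^ 'n" and R by (simp add: ssm_sets)
  let ?f = "\<lambda>R. measure \<mu> (cball 0 R)"
  have mono: "?f R \<le> ?f R'" if "R \<le> R'" for R R'
    using that sets by (intro finite_measure_mono) auto
  have step: "?f R \<le> ?f (shift_bound + rmax * R)" for R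
  proof -
    have "?f R = (\<Sum>i=1..l. p i * ?f R)"
      using weights by (simp add: sum_distrib_right[symmetric] positive_prob_vector_def)
    also have "\<dots> \<le> (\<Sum>i=1..l. p i * measure \<mu> (\<phi> i -` cball 0 (shift_bound + rmax * R)))"
    proof (intro sum_mono mult_left_mono finite_measure_mono)
      fix i assume i: "i \<in> {1..l}"
      show "cball 0 R \<subseteq> \<phi> i -` cball 0 (shift_bound + rmax * R)"
      proof
        fix x :: "real ^ 'n" assume "x \<in> cball 0 R"
        then have "rmax * norm x \<le> rmax * R" using rmax_pos by (intro mult_left_mono) auto
        then show "x \<in> \<phi> i -` cball 0 (shift_bound + rmax * R)"
          using norm_\<phi>_le[OF i, of x] by simp
      qed
      show "\<phi> i -` cball 0 (shift_bound + rmax * R) \<in> sets \<mu>"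
        by (simp add: similarity_vimage_cball[OF sim[OF i]] ssm_sets)
      show "0 \<le> p i" using weights i by (simp add: positive_prob_vector_def less_imp_le)
    qed
    also have "\<dots> = ?f (shift_bound + rmax * R)"
      by (rule ssm_measure[symmetric]) simp
    finally show ?thesis .
  qed
  define b where "b = shift_bound / (1 - rmax)"
  have b: "shift_bound + rmax * (b + rmax ^ n * c) = b + rmax ^ Suc n * c" for n c
    using rmax_less_1 by (simp add: b_def field_simps)
  have iter: "?f (b + c) \<le> ?f (b + rmax ^ n * c)" for n c
  proof (induct n)
    case (Suc n)
    then show ?case using step[of "b + rmax ^ n * c"] by (simp only: b)
  qed simp
  have le: "?f R \<le> ?f rad" for R
  proof -
    have "(\<lambda>n. rmax ^ n * (R - b)) \<longlonglongrightarrow> 0 * (R - b)"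
      using rmax_pos rmax_less_1 by (intro tendsto_intros LIMSEQ_power_zero) auto
    then have "\<forall>\<^sub>F n in sequentially. rmax ^ n * (R - b) < 1"
      by (intro order_tendstoD) auto
    then obtain n where n: "rmax ^ n * (R - b) < 1" by (auto simp: eventually_sequentially)
    have "?f R \<le> ?f (b + rmax ^ n * (R - b))" using iter[of "R - b" n] by simp
    also have "\<dots> \<le> ?f rad" using n by (intro mono) (simp add: rad_def b_def)
    finally show ?thesis .
  qed
  have "(\<lambda>n. ?f (real n)) \<longlonglongrightarrow> measure \<mu> (\<Union>n. cball 0 (real n))"
    by (rule finite_Lim_measure_incseq) (use sets in \<open>auto simp: incseq_def\<close>)
  also have "(\<Union>n. cball (0 :: real ^ 'n) (real n)) = space \<mu>"
    using real_arch_simple by (auto simp: ssm_space)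
  finally have "(\<lambda>n. ?f (real n)) \<longlonglongrightarrow> 1" by (simp add: prob_space)
  then have "1 \<le> ?f rad" by (rule LIMSEQ_le_const2) (use le in auto)
  then show ?thesis using prob_le_1[of "cball 0 rad"] by simp
qed

lemma ssm_AE_rad: "AE x in \<mu>. x \<in> cball 0 rad"
proof -
  interpret prob_space \<mu> by (rule ssm_prob_space)
  show ?thesis using ssm_cball_rad prob_eq_1[of "cball 0 rad"] by (simp add: ssm_sets)
qed

end

end

section \<open>The coding map and existence of self-similar measures\<close>

context contracting_system
begin

text \<open>The point reached from 0 by the first \<open>n\<close> maps of a symbol sequence.
  Letters outside \<open>{1..l}\<close> give 0, which keeps the map total on all streams and
  measurable; the random streams used below avoid such letters almost surely.\<close>

primrec approx_code :: "nat \<Rightarrow> nat stream \<Rightarrow> real ^ 'n" where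
  "approx_code 0 \<omega> = 0"
| "approx_code (Suc n) \<omega> =
     (if shd \<omega> \<in> {1..l} then \<phi> (shd \<omega>) (approx_code n (stl \<omega>)) else 0)"

definition code :: "nat stream \<Rightarrow> real ^ 'n" where
  "code \<omega> = lim (\<lambda>n. approx_code n \<omega>)"

lemma measurable_approx_code [measurable]:
  "approx_code n \<in> borel_measurable (stream_space (count_space UNIV))"
proof (induct n)
  case 0
  have "approx_code 0 = (\<lambda>\<omega>. 0)" by (rule ext) simp
  then show ?case by simp
next
  case (Suc n)
  note [measurable] = Suc
  let ?f = "\<lambda>i \<omega>. if i \<in> {1..l} then \<phi> i (approx_code n (stl \<omega>)) else 0"
  have "(\<lambda>\<omega>. ?f (shd \<omega>) \<omega>) \<in> borel_measurable (stream_space (count_space UNIV))"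
  proof (rule measurable_compose_countable[where f = ?f and g = shd])
    fix i
    show "(\<lambda>\<omega>. if i \<in> {1..l} then \<phi> i (approx_code n (stl \<omega>)) else 0)
        \<in> borel_measurable (stream_space (count_space UNIV))"
    proof (cases "i \<in> {1..l}")
      case True
      note [measurable] = measurable_\<phi>[OF True]
      show ?thesis using True by simp
    next
      case False
      then show ?thesis by (simp only: if_False) simp
    qed
  qed measurable
  then show ?case by simp
qed

text \<open>Each further letter in front contracts by at most \<open>rmax\<close>, and at depth 0
  the distance is the norm of some \<open>\<phi> i 0\<close>. This is summable, hence the coding map
  converges.\<close>

lemma dist_approx_code: "dist (approx_code n \<omega>) (approx_code (Suc n) \<omega>) \<le> rmax ^ n * shift_bound"
proof (induct n arbitrary: \<omega>)
  case 0
  show ?case using norm_\<phi>_le[of "shd \<omega>" 0] shift_bound_nonneg by simp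
next
  case (Suc n)
  show ?case
  proof (cases "shd \<omega> \<in> {1..l}")
    case True
    have "dist (approx_code (Suc n) \<omega>) (approx_code (Suc (Suc n)) \<omega>) =
        r (shd \<omega>) * dist (approx_code n (stl \<omega>)) (approx_code (Suc n) (stl \<omega>))"
      using True similarity_dist[OF sim[OF True]] by simp
    also have "\<dots> \<le> rmax * (rmax ^ n * shift_bound)"
      using True r_le_rmax ratio_pos rmax_pos
      by (intro mult_mono Suc) auto
    finally show ?thesis by (simp add: mult_ac)
  next
    case False
    then show ?thesis using rmax_pos shift_bound_nonneg by auto
  qed
qed

lemma approx_code_LIMSEQ: "(\<lambda>n. approx_code n \<omega>) \<longlonglongrightarrow> code \<omega>"
proof -
  have "summable (\<lambda>n. approx_code (Suc n) \<omega> - approx_code n \<omega>)"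
  proof (rule summable_comparison_test')
    show "summable (\<lambda>n. rmax ^ n * shift_bound)"
      using rmax_pos rmax_less_1 by (intro summable_mult2 summable_geometric) auto
    show "norm (approx_code (Suc n) \<omega> - approx_code n \<omega>) \<le> rmax ^ n * shift_bound" if "n \<ge> 0" for n
      using dist_approx_code[of n \<omega>] by (simp only: dist_norm norm_minus_commute)
  qed
  then have "convergent (\<lambda>n. \<Sum>i<n. approx_code (Suc i) \<omega> - approx_code i \<omega>)"
    by (simp add: summable_iff_convergent)
  moreover have "(\<Sum>i<n. approx_code (Suc i) \<omega> - approx_code i \<omega>) = approx_code n \<omega>" for n
    using sum_lessThan_telescope[of "\<lambda>n. approx_code n \<omega>" n] by (simp del: approx_code.simps(2))
  ultimately have "convergent (\<lambda>n. approx_code n \<omega>)" by (simp del: approx_code.simps(2))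
  then show ?thesis by (simp add: code_def convergent_LIMSEQ_iff)
qed

lemma measurable_code [measurable]: "code \<in> borel_measurable (stream_space (count_space UNIV))"
  by (rule borel_measurable_LIMSEQ_metric[OF measurable_approx_code approx_code_LIMSEQ])

lemma code_Stream:
  assumes "i \<in> {1..l}"
  shows "code (i ## \<omega>) = \<phi> i (code \<omega>)"
proof (rule LIMSEQ_unique)
  show "(\<lambda>n. approx_code (Suc n) (i ## \<omega>)) \<longlonglongrightarrow> code (i ## \<omega>)"
    using approx_code_LIMSEQ by (rule LIMSEQ_Suc)
  have "isCont (\<phi> i) (code \<omega>)"
    using similarity_continuous[OF sim[OF assms]] by (simp add: continuous_on_eq_continuous_at)
  then have "(\<lambda>n. \<phi> i (approx_code n \<omega>)) \<longlonglongrightarrow> \<phi> i (code \<omega>)"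
    using approx_code_LIMSEQ by (rule isCont_tendsto_compose)
  then show "(\<lambda>n. approx_code (Suc n) (i ## \<omega>)) \<longlonglongrightarrow> \<phi> i (code \<omega>)"
    using assms by simp
qed

text \<open>The measure is the image under \<open>code\<close> of the product measure on symbol
  sequences; splitting off the first letter is self-similarity. Existence is needed for the tilted
  weights, since regularity speaks only about measures that are given.\<close>

lemma self_similar_measure_exists:
  assumes p: "positive_prob_vector l p"
  shows "\<exists>\<nu>. self_similar_measure l \<phi> p \<nu>"
proof -
  define f where "f i = (if i \<in> {1..l} then p i else 0)" for i
  have f_nonneg: "0 \<le> f i" for i using p by (simp add: f_def positive_prob_vector_def less_imp_le)
  have "(\<integral>\<^sup>+i. ennreal (f i) \<partial>count_space UNIV) = (\<Sum>i=1..l. ennreal (f i))"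
    by (rule nn_integral_count_space') (auto simp: f_def)
  also have "\<dots> = ennreal (\<Sum>i=1..l. p i)"
    using p by (subst sum_ennreal) (auto simp: f_def positive_prob_vector_def less_imp_le
        intro!: arg_cong[where f = ennreal] sum.cong)
  finally have "(\<integral>\<^sup>+i. ennreal (f i) \<partial>count_space UNIV) = 1"
    using p by (simp add: positive_prob_vector_def)
  note pmf = pmf_embed_pmf[of f, OF f_nonneg this] set_embed_pmf[of f, OF f_nonneg this]
  define Q where "Q = embed_pmf f"
  define S where "S = stream_space (measure_pmf Q)"
  have S_sets: "sets S = sets (stream_space (count_space UNIV))"
    unfolding S_def by (rule sets_stream_space_cong) simp
  have meas_S: "g \<in> borel_measurable S" if "g \<in> borel_measurable (stream_space (count_space UNIV))"
    for g :: "nat stream \<Rightarrow> 'z::topological_space"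
    using that measurable_cong_sets[OF S_sets refl] by blast
  note [measurable] = meas_S[OF measurable_code]
  define \<nu> where "\<nu> = distr S borel code"
  interpret S: prob_space S unfolding S_def by (rule prob_space.prob_space_stream_space[OF measure_pmf.prob_space_axioms])
  interpret prob_space \<nu> unfolding \<nu>_def by (rule S.prob_space_distr) measurable
  have "measure \<nu> A = (\<Sum>i=1..l. p i * measure \<nu> (\<phi> i -` A))" if A[measurable]: "A \<in> sets borel" for A
  proof -
    have pre: "\<phi> i -` A \<in> sets borel" if "i \<in> {1..l}" for i
      using measurable_sets[OF measurable_\<phi>[OF that] A] by simp
    have "emeasure \<nu> A = (\<integral>\<^sup>+x. indicator A x \<partial>\<nu>)"
      by (simp add: \<nu>_def)
    also have "\<dots> = (\<integral>\<^sup>+\<omega>. indicator A (code \<omega>) \<partial>S)"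
      unfolding \<nu>_def by (rule nn_integral_distr) measurable
    also have "\<dots> = (\<integral>\<^sup>+i. (\<integral>\<^sup>+\<omega>. indicator A (code (i ## \<omega>)) \<partial>S) \<partial>measure_pmf Q)"
      unfolding S_def by (rule prob_space.nn_integral_stream_space[OF measure_pmf.prob_space_axioms]) (fold S_def, measurable)
    also have "\<dots> = (\<Sum>i=1..l. (\<integral>\<^sup>+\<omega>. indicator A (code (i ## \<omega>)) \<partial>S) * pmf Q i)"
      by (rule nn_integral_measure_pmf_support) (auto simp: Q_def pmf f_def split: if_splits)
    also have "\<dots> = (\<Sum>i=1..l. ennreal (p i * measure \<nu> (\<phi> i -` A)))"
    proof (intro sum.cong refl)
      fix i assume i: "i \<in> {1..l}"
      note [measurable] = pre[OF i]
      have "(\<integral>\<^sup>+\<omega>. indicator A (code (i ## \<omega>)) \<partial>S) = (\<integral>\<^sup>+\<omega>. indicator (\<phi> i -` A) (code \<omega>) \<partial>S)"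
        by (intro nn_integral_cong) (simp add: code_Stream[OF i] indicator_def)
      also have "\<dots> = (\<integral>\<^sup>+x. indicator (\<phi> i -` A) x \<partial>\<nu>)"
        unfolding \<nu>_def by (rule nn_integral_distr[symmetric]) measurable
      also have "\<dots> = emeasure \<nu> (\<phi> i -` A)"
        using pre[OF i] by (intro nn_integral_indicator) (simp add: \<nu>_def)
      also have "\<dots> = ennreal (measure \<nu> (\<phi> i -` A))" by (rule emeasure_eq_measure)
      finally show "(\<integral>\<^sup>+\<omega>. indicator A (code (i ## \<omega>)) \<partial>S) * pmf Q i =
          ennreal (p i * measure \<nu> (\<phi> i -` A))"
        using i f_nonneg[of i]
        by (simp add: Q_def pmf f_def ennreal_mult' mult.commute)
    qed
    also have "\<dots> = ennreal (\<Sum>i=1..l. p i * measure \<nu> (\<phi> i -` A))"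
      using p by (subst sum_ennreal) (auto simp: positive_prob_vector_def less_imp_le)
    finally show ?thesis
      unfolding emeasure_eq_measure
      by (rule ennreal_inj[THEN iffD1, rotated 2])
         (use p in \<open>auto intro!: sum_nonneg mult_nonneg_nonneg simp: positive_prob_vector_def less_imp_le\<close>)
  qed
  then have "self_similar_measure l \<phi> p \<nu>"
    unfolding self_similar_measure_def using prob_space_axioms by (simp add: \<nu>_def)
  then show ?thesis by blast
qed

end

section \<open>Scaling recursions\<close>

text \<open>By \<open>sum_le\<close>, the function \<open>\<rho> powr t\<close> satisfies the
  recursion in the opposite direction, so the constant \<open>C\<close> survives every step. The
  induction extends the range of scales downwards: for \<open>\<rho> < a\<close> all radii
  \<open>\<rho> / s i\<close> lie in the range already treated.\<close>

lemma scaling_recursion: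
  fixes f :: "real \<Rightarrow> ennreal" and c s :: "'i \<Rightarrow> real"
  assumes I: "finite I" "\<And>i. i \<in> I \<Longrightarrow> smin \<le> s i \<and> s i \<le> smax \<and> 0 \<le> c i"
    and smin: "0 < smin" "smin \<le> smax" and smax: "smax < 1" and "0 < a"
    and sum_le: "(\<Sum>i\<in>I. c i * s i powr (- t)) \<le> 1"
    and rec: "\<And>\<rho>. 0 < \<rho> \<Longrightarrow> \<rho> < a \<Longrightarrow> f \<rho> \<le> (\<Sum>i\<in>I. ennreal (c i) * f (\<rho> / s i))"
    and base: "\<And>\<rho>. a \<le> \<rho> \<Longrightarrow> f \<rho> \<le> ennreal K" and "0 < K"
  obtains C where "0 < C" "\<And>\<rho>. 0 < \<rho> \<Longrightarrow> \<rho> \<le> a \<Longrightarrow> f \<rho> \<le> ennreal (C * \<rho> powr t)"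
proof -
  \<comment> \<open>The two powers serve the two signs of \<open>t\<close>: on
    \<open>{a..a / smin}\<close> the function \<open>\<rho> powr t\<close> is smallest at the left
    end if \<open>t \<ge> 0\<close>, and at the right end otherwise.\<close>
  define C where "C = K * (a powr (- t) + (a / smin) powr (- t))"
  have "0 < C" unfolding C_def
    using \<open>0 < K\<close> \<open>0 < a\<close> smin by (intro mult_pos_pos add_pos_pos) auto
  \<comment> \<open>The range reaches up to \<open>a / smin\<close>, since one step from below
    \<open>a\<close> can land that high.\<close>
  have main: "\<forall>\<rho>. a * smax ^ n \<le> \<rho> \<and> \<rho> \<le> a / smin \<longrightarrow> f \<rho> \<le> ennreal (C * \<rho> powr t)" for n
  proof (induct n)
    case 0
    have "f \<rho> \<le> ennreal (C * \<rho> powr t)" if \<rho>: "a \<le> \<rho>" "\<rho> \<le> a / smin" for \<rho>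
    proof -
      have "1 \<le> (a powr (- t) + (a / smin) powr (- t)) * \<rho> powr t"
      proof (cases "t \<ge> 0")
        case True
        have "1 = a powr (- t) * a powr t" using \<open>0 < a\<close> by (simp add: powr_minus)
        also have "\<dots> \<le> (a powr (- t) + (a / smin) powr (- t)) * \<rho> powr t"
          using \<rho> \<open>0 < a\<close> True by (intro mult_mono powr_mono2) auto
        finally show ?thesis .
      next
        case False
        have "1 = (a / smin) powr (- t) * (a / smin) powr t" using \<open>0 < a\<close> smin by (simp add: powr_minus)
        also have "\<dots> \<le> (a powr (- t) + (a / smin) powr (- t)) * \<rho> powr t"
          using \<rho> \<open>0 < a\<close> False smin by (intro mult_mono powr_mono2') auto
        finally show ?thesis .
      qed
      then have "K \<le> C * \<rho> powr t"
        unfolding C_def using \<open>0 < K\<close> mult_left_mono[of 1 _ K] by (simp add: mult.assoc)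
      then show ?thesis using base[OF \<rho>(1)] by (meson ennreal_leI order_trans)
    qed
    then show ?case by simp
  next
    case (Suc n)
    show ?case
    proof (intro allI impI, elim conjE)
      fix \<rho> assume \<rho>: "a * smax ^ Suc n \<le> \<rho>" "\<rho> \<le> a / smin"
      have "0 < a * smax ^ Suc n" using smin \<open>0 < a\<close> by simp
      then have "0 < \<rho>" using \<rho> by linarith
      show "f \<rho> \<le> ennreal (C * \<rho> powr t)"
      proof (cases "a * smax ^ n \<le> \<rho>")
        case True
        then show ?thesis using Suc \<rho> by blast
      next
        case False
        have "a * smax ^ n \<le> a" using smin smax \<open>0 < a\<close> by (simp add: mult_le_cancel_left2 power_le_one)
        then have "\<rho> < a" using False by linarith
        have step: "f (\<rho> / s i) \<le> ennreal (C * (\<rho> / s i) powr t)" if i: "i \<in> I" for i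
        proof -
          have s: "0 < s i" "smin \<le> s i" "s i \<le> smax" using I(2)[OF i] smin by auto
          have "a * smax ^ n * s i \<le> a * smax ^ n * smax"
            using s smin \<open>0 < a\<close> by (intro mult_left_mono) auto
          then have "a * smax ^ n \<le> \<rho> / s i"
            using \<rho>(1) s by (simp add: pos_le_divide_eq mult_ac)
          moreover have "\<rho> / s i \<le> a / smin"
            using \<open>\<rho> < a\<close> s smin \<open>0 < \<rho>\<close> by (intro frac_le) auto
          ultimately show ?thesis using Suc by blast
        qed
        have "f \<rho> \<le> (\<Sum>i\<in>I. ennreal (c i) * f (\<rho> / s i))" by (rule rec) fact+
        also have "\<dots> \<le> (\<Sum>i\<in>I. ennreal (c i) * ennreal (C * (\<rho> / s i) powr t))"
          by (intro sum_mono mult_left_mono step) auto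
        also have "\<dots> = (\<Sum>i\<in>I. ennreal (C * \<rho> powr t * (c i * s i powr (- t))))"
        proof (intro sum.cong refl)
          fix i assume i: "i \<in> I"
          have s: "0 < s i" "0 \<le> c i" using I(2)[OF i] smin by auto
          have eq: "c i * (C * (\<rho> / s i) powr t) = C * \<rho> powr t * (c i * s i powr (- t))"
            using s \<open>0 < \<rho>\<close> by (simp add: powr_divide powr_minus_divide)
          then show "ennreal (c i) * ennreal (C * (\<rho> / s i) powr t) =
              ennreal (C * \<rho> powr t * (c i * s i powr (- t)))"
            unfolding eq[symmetric] using s by (simp add: ennreal_mult')
        qed
        also have "\<dots> = ennreal (C * \<rho> powr t * (\<Sum>i\<in>I. c i * s i powr (- t)))"
          using I \<open>0 < C\<close> by (subst sum_ennreal) (auto simp: sum_distrib_left)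
        also have "\<dots> \<le> ennreal (C * \<rho> powr t)"
          using sum_le \<open>0 < C\<close> by (intro ennreal_leI mult_left_le) auto
        finally show ?thesis .
      qed
    qed
  qed
  have "f \<rho> \<le> ennreal (C * \<rho> powr t)" if "0 < \<rho>" "\<rho> \<le> a" for \<rho>
  proof -
    have "(\<lambda>n. a * smax ^ n) \<longlonglongrightarrow> a * 0"
      using smin smax by (intro tendsto_intros LIMSEQ_power_zero) auto
    then have "\<forall>\<^sub>F n in sequentially. a * smax ^ n < \<rho>"
      using that by (intro order_tendstoD) auto
    then obtain n where "a * smax ^ n < \<rho>" by (auto simp: eventually_sequentially)
    moreover have "a \<le> a / smin" using smin smax \<open>0 < a\<close> by (simp add: pos_le_divide_eq)
    ultimately show ?thesis using main[of n] that by auto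
  qed
  then show ?thesis using \<open>0 < C\<close> that by blast
qed

lemma measurable_measure_cball:
  fixes \<mu> :: "'a::euclidean_space measure"
  assumes "finite_measure \<mu>" and sets: "sets \<mu> = sets borel"
  shows "(\<lambda>x. measure \<mu> (cball x \<rho>)) \<in> borel_measurable borel"
proof -
  interpret finite_measure \<mu> by fact
  have "closed {z :: 'a \<times> 'a. dist (fst z) (snd z) \<le> \<rho>}"
    by (intro closed_Collect_le continuous_intros)
  then have "{z :: 'a \<times> 'a. dist (fst z) (snd z) \<le> \<rho>} \<in> sets (borel \<Otimes>\<^sub>M borel)"
    by (simp only: borel_prod) simp
  also have "sets (borel \<Otimes>\<^sub>M borel) = sets (borel \<Otimes>\<^sub>M \<mu>)"
    by (rule sets_pair_measure_cong) (auto simp: sets)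
  finally have "(\<lambda>x. emeasure \<mu> (Pair x -` {z. dist (fst z) (snd z) \<le> \<rho>})) \<in> borel_measurable borel"
    by (rule measurable_emeasure_Pair)
  then show ?thesis by (simp add: measure_def cball_def vimage_def)
qed

section \<open>Packing sums\<close>

text \<open>Unlike in \<open>Theta\<close>, the centres are arbitrary: the recursions below move them off the support.
  For \<open>q = 0\<close> balls of measure zero do not contribute, since \<open>0 powr 0 = 0\<close>.\<close>

definition packing_sum :: "'a::metric_space measure \<Rightarrow> real \<Rightarrow> real \<Rightarrow> ennreal" where
  "packing_sum \<mu> q \<rho> = (SUP C \<in> {C. packing \<rho> C}. ennreal (\<Sum>x\<in>C. measure \<mu> (cball x \<rho>) powr q))"

lemma packing_sum_upper:
  "packing \<rho> C \<Longrightarrow> ennreal (\<Sum>x\<in>C. measure \<mu> (cball x \<rho>) powr q) \<le> packing_sum \<mu> q \<rho>"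
  unfolding packing_sum_def by (rule SUP_upper) simp

lemma packing_sum_leD:
  assumes "packing_sum \<mu> q \<rho> \<le> ennreal K" "0 \<le> K" "packing \<rho> C"
  shows "(\<Sum>x\<in>C. measure \<mu> (cball x \<rho>) powr q) \<le> K"
  using order_trans[OF packing_sum_upper[OF assms(3)] assms(1)] assms(2) by simp

lemma packing_vimage:
  fixes f :: "real ^ 'n \<Rightarrow> real ^ 'n"
  assumes f: "similarity s f" and C: "packing \<rho> C"
  shows "packing (\<rho> / s) (inv f ` C)"
  unfolding disjoint_family_on_def
proof (intro conjI ballI impI)
  fix x y assume "x \<in> inv f ` C" "y \<in> inv f ` C" "x \<noteq> y"
  then obtain u v where "x = inv f u" "y = inv f v" "u \<in> C" "v \<in> C" "u \<noteq> v" by auto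
  then have "f -` cball u \<rho> \<inter> f -` cball v \<rho> = {}"
    using C by (auto simp: disjoint_family_on_def)
  then show "cball x (\<rho> / s) \<inter> cball y (\<rho> / s) = {}"
    using f \<open>x = inv f u\<close> \<open>y = inv f v\<close> by (simp add: similarity_vimage_cball)
qed (use C in auto)

lemma packing_sum_vimage:
  fixes f :: "real ^ 'n \<Rightarrow> real ^ 'n"
  assumes f: "similarity s f" and C: "packing \<rho> C"
  shows "ennreal (\<Sum>x\<in>C. measure \<mu> (f -` cball x \<rho>) powr q) \<le> packing_sum \<mu> q (\<rho> / s)"
proof -
  have "inj (inv f)" using surj_imp_inj_inv[OF similarity_surj[OF f]] .
  then have "(\<Sum>x\<in>C. measure \<mu> (f -` cball x \<rho>) powr q) =
      (\<Sum>x\<in>inv f ` C. measure \<mu> (cball x (\<rho> / s)) powr q)"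
    by (subst sum.reindex) (auto simp: similarity_vimage_cball[OF f] intro: inj_on_subset)
  then show ?thesis using packing_sum_upper[OF packing_vimage[OF f C]] by metis
qed

text \<open>After division by the total all terms lie in \<open>{0..1}\<close>, where
  \<open>x \<le> x powr q\<close>.\<close>

lemma powr_sum_le_sum_powr:
  fixes a :: "'i \<Rightarrow> real"
  assumes "finite I" "\<And>i. i \<in> I \<Longrightarrow> 0 \<le> a i" "0 \<le> q" "q \<le> 1"
  shows "(\<Sum>i\<in>I. a i) powr q \<le> (\<Sum>i\<in>I. a i powr q)"
proof (cases "(\<Sum>i\<in>I. a i) = 0")
  case False
  define S where "S = (\<Sum>i\<in>I. a i)"
  have "S > 0" using False sum_nonneg[of I a] assms by (force simp: S_def)
  have le: "a i / S * S powr q \<le> a i powr q" if i: "i \<in> I" for i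
  proof (cases "a i = 0")
    case False
    then have "0 < a i" using assms(2)[OF i] by simp
    moreover have "a i \<le> S" unfolding S_def using assms i by (intro member_le_sum) auto
    ultimately have "(a i / S) powr 1 \<le> (a i / S) powr q"
      using assms \<open>S > 0\<close> by (intro powr_mono') auto
    then show ?thesis
      using \<open>0 < a i\<close> \<open>S > 0\<close> by (simp add: powr_divide field_simps)
  qed auto
  have "S powr q = (\<Sum>i\<in>I. a i / S * S powr q)"
    using \<open>S > 0\<close> by (simp add: sum_distrib_right[symmetric] sum_divide_distrib[symmetric] S_def)
  also have "\<dots> \<le> (\<Sum>i\<in>I. a i powr q)" by (intro sum_mono le)
  finally show ?thesis by (simp add: S_def)
qed (auto intro: sum_nonneg)

text \<open>Jensen's inequality for the power \<open>q\<close> with normalised weights. The cost is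
  the total weight to the power \<open>q - 1\<close>, with no factor counting the summands.\<close>

lemma powr_weighted_sum_le:
  fixes w m :: "'i \<Rightarrow> real"
  assumes I: "finite I" "\<And>i. i \<in> I \<Longrightarrow> 0 \<le> w i" "\<And>i. i \<in> I \<Longrightarrow> 0 \<le> m i" and q: "1 \<le> q"
  shows "(\<Sum>i\<in>I. w i * m i) powr q \<le> (\<Sum>i\<in>I. w i) powr (q - 1) * (\<Sum>i\<in>I. w i * m i powr q)"
proof -
  \<comment> \<open>Terms with vanishing weight or value contribute to neither weighted sum;
    dropping them allows convexity on the open half-line to be applied.\<close>
  define J where "J = {i \<in> I. 0 < w i \<and> 0 < m i}"
  define V where "V = (\<Sum>i\<in>J. w i)"
  have J: "finite J" "J \<subseteq> I" using I by (auto simp: J_def)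
  have restrict: "(\<Sum>i\<in>I. w i * g i) = (\<Sum>i\<in>J. w i * g i)" if "\<And>i. m i = 0 \<Longrightarrow> g i = 0" for g
  proof (rule sum.mono_neutral_right)
    show "\<forall>i\<in>I - J. w i * g i = 0"
    proof
      fix i assume "i \<in> I - J"
      then have "w i = 0 \<or> m i = 0" using I(2,3)[of i] by (auto simp: J_def)
      then show "w i * g i = 0" using that by auto
    qed
  qed (use I J in auto)
  show ?thesis
  proof (cases "J = {}")
    case True
    then show ?thesis using restrict[of m] I by (auto intro!: mult_nonneg_nonneg sum_nonneg)
  next
    case False
    have "V > 0" unfolding V_def using J False by (intro sum_pos) (auto simp: J_def)
    have "(\<Sum>i\<in>J. (w i / V) *\<^sub>R m i) powr q \<le> (\<Sum>i\<in>J. (w i / V) * m i powr q)"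
    proof (rule convex_on_sum[where C = "{0<..}" and f = "\<lambda>x. x powr q"])
      show "(\<Sum>i\<in>J. w i / V) = 1"
        using \<open>V > 0\<close> by (simp add: sum_divide_distrib[symmetric] V_def)
    qed (use J False q \<open>V > 0\<close> powr_convex[of q] in \<open>auto simp: J_def\<close>)
    then have "((\<Sum>i\<in>J. w i * m i) / V) powr q \<le> (\<Sum>i\<in>J. w i * m i powr q) / V"
      by (simp add: sum_divide_distrib)
    moreover have "0 \<le> (\<Sum>i\<in>J. w i * m i)" by (intro sum_nonneg) (auto simp: J_def)
    ultimately have "(\<Sum>i\<in>J. w i * m i) powr q \<le> V powr q * ((\<Sum>i\<in>J. w i * m i powr q) / V)"
      using \<open>V > 0\<close> by (simp add: powr_divide pos_divide_le_eq mult_ac)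
    also have "\<dots> = V powr (q - 1) * (\<Sum>i\<in>J. w i * m i powr q)"
      using \<open>V > 0\<close> by (simp add: powr_diff)
    also have "\<dots> \<le> (\<Sum>i\<in>I. w i) powr (q - 1) * (\<Sum>i\<in>J. w i * m i powr q)"
    proof (intro mult_right_mono powr_mono2)
      show "V \<le> (\<Sum>i\<in>I. w i)" unfolding V_def using I J by (intro sum_mono2) auto
    qed (use \<open>V > 0\<close> q in \<open>auto simp: J_def intro!: sum_nonneg\<close>)
    finally show ?thesis by (simp add: restrict)
  qed
qed

text \<open>Hoelder's inequality, as the case of unit weights and exponent \<open>q1 / q\<close> of
  \<open>powr_weighted_sum_le\<close>, followed by taking the root.\<close>

lemma sum_powr_le_card_powr:
  fixes m :: "'i \<Rightarrow> real"
  assumes "finite I" "\<And>i. i \<in> I \<Longrightarrow> 0 \<le> m i" "0 < q" "q \<le> q1"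
  shows "(\<Sum>i\<in>I. m i powr q) \<le> real (card I) powr (1 - q / q1) * (\<Sum>i\<in>I. m i powr q1) powr (q / q1)"
proof -
  define t where "t = q1 / q"
  have t: "1 \<le> t" "0 < t" "(t - 1) / t = 1 - q / q1" "1 / t = q / q1"
    using assms by (auto simp: t_def field_simps)
  have "(\<Sum>i\<in>I. 1 * m i powr q) powr t \<le> (\<Sum>i\<in>I. 1) powr (t - 1) * (\<Sum>i\<in>I. 1 * (m i powr q) powr t)"
    using assms t by (intro powr_weighted_sum_le) auto
  then have "(\<Sum>i\<in>I. m i powr q) powr t \<le> real (card I) powr (t - 1) * (\<Sum>i\<in>I. m i powr q1)"
    using assms by (simp add: powr_powr t_def)
  then have "((\<Sum>i\<in>I. m i powr q) powr t) powr (1 / t) \<le>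
      (real (card I) powr (t - 1) * (\<Sum>i\<in>I. m i powr q1)) powr (1 / t)"
    by (intro powr_mono2) (use t(2) in auto)
  moreover have "((\<Sum>i\<in>I. m i powr q) powr t) powr (1 / t) = (\<Sum>i\<in>I. m i powr q)"
    using t(2) by (simp add: powr_powr sum_nonneg)
  moreover have "(real (card I) powr (t - 1) * (\<Sum>i\<in>I. m i powr q1)) powr (1 / t) =
      real (card I) powr ((t - 1) / t) * (\<Sum>i\<in>I. m i powr q1) powr (1 / t)"
    by (simp add: powr_powr powr_mult sum_nonneg)
  ultimately show ?thesis by (simp only: t(3,4))
qed

section \<open>Packing sums of a self-similar measure for exponents in the unit interval\<close>

locale self_similar = contracting_system l \<phi> r
  for l :: nat and \<phi> :: "nat \<Rightarrow> real ^ 'n \<Rightarrow> real ^ 'n" and r :: "nat \<Rightarrow> real" +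
  fixes p :: "nat \<Rightarrow> real" and \<mu> :: "(real ^ 'n) measure"
  assumes prob: "positive_prob_vector l p" and ssm: "self_similar_measure l \<phi> p \<mu>"
begin

sublocale weight_system l r p
  by unfold_locales (use ratio_pos ratio_less_1 prob in auto)

sublocale prob_space \<mu>
  by (rule ssm_prob_space[OF prob ssm])

lemmas sets_\<mu> = ssm_sets[OF prob ssm]
  and \<mu>_eq = ssm_measure[OF prob ssm]
  and nn_integral_\<mu> = ssm_nn_integral[OF prob ssm]
  and \<mu>_cball_rad = ssm_cball_rad[OF prob ssm]
  and AE_rad = ssm_AE_rad[OF prob ssm]
  and meas_\<mu> = ssm_measurable[OF prob ssm]

abbreviation mass :: "real ^ 'n \<Rightarrow> real \<Rightarrow> real" where
  "mass x \<rho> \<equiv> measure \<mu> (cball x \<rho>)"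

lemma measure_mono: "A \<subseteq> B \<Longrightarrow> B \<in> sets borel \<Longrightarrow> measure \<mu> A \<le> measure \<mu> B"
  by (rule finite_measure_mono) (auto simp: sets_\<mu>)

lemma meets_rad: "0 < measure \<mu> A \<Longrightarrow> A \<in> sets borel \<Longrightarrow> A \<inter> cball 0 rad \<noteq> {}"
proof
  assume A: "0 < measure \<mu> A" "A \<in> sets borel" "A \<inter> cball 0 rad = {}"
  then have "measure \<mu> (A \<union> cball 0 rad) = measure \<mu> A + 1"
    by (subst finite_measure_Union) (auto simp: sets_\<mu> \<mu>_cball_rad)
  then show False using A(1) prob_le_1[of "A \<union> cball 0 rad"] by linarith
qed

lemma contains_rad: "cball 0 rad \<subseteq> A \<Longrightarrow> A \<in> sets borel \<Longrightarrow> measure \<mu> A = 1"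
  using measure_mono[of "cball 0 rad" A] \<mu>_cball_rad prob_le_1[of A] by simp

lemma packing_sum_le_card:
  assumes "0 \<le> q" "packing \<rho> C"
  shows "(\<Sum>x\<in>C. mass x \<rho> powr q) \<le> real (card {x\<in>C. 0 < mass x \<rho>})"
proof -
  have "(\<Sum>x\<in>C. mass x \<rho> powr q) \<le> (\<Sum>x\<in>C. if 0 < mass x \<rho> then 1 else 0)"
  proof (rule sum_mono)
    fix x
    show "mass x \<rho> powr q \<le> (if 0 < mass x \<rho> then 1 else 0)"
      using assms powr_le1[of q "mass x \<rho>"] zero_less_measure_iff[of \<mu> "cball x \<rho>"] by auto
  qed
  also have "\<dots> = real (card {x\<in>C. 0 < mass x \<rho>})"
    using assms by (simp add: sum.If_cases Int_def)
  finally show ?thesis .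
qed

lemma charged_packing_card:
  assumes "packing \<rho> C" "0 < \<rho>"
  shows "real (card {x\<in>C. 0 < mass x \<rho>}) \<le> ((rad + 2 * \<rho>) / \<rho>) ^ CARD('n)"
proof -
  have "real (card {x\<in>C. 0 < mass x \<rho>}) \<le> ((rad + 2 * \<rho>) / \<rho>) ^ DIM(real ^ 'n)"
    using assms rad_ge_1 meets_rad
    by (intro packing_card_le) (auto simp: disjoint_family_on_def)
  then show ?thesis by simp
qed

text \<open>Since \<open>q \<le> 1\<close>, the power of a sum of overlapping contributions splits
  at no cost; the \<open>i\<close>-th part is a packing sum for the pulled back packing at scale
  \<open>\<rho> / r i\<close>.\<close>

lemma packing_sum_step:
  assumes q: "0 \<le> q" "q \<le> 1"
  shows "packing_sum \<mu> q \<rho> \<le> (\<Sum>i=1..l. ennreal (p i powr q) * packing_sum \<mu> q (\<rho> / r i))"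
  unfolding packing_sum_def[of \<mu> q \<rho>]
proof (rule SUP_least, clarify)
  fix C :: "(real ^ 'n) set" assume C: "finite C" "disjoint_family_on (\<lambda>x. cball x \<rho>) C"
  have "(\<Sum>x\<in>C. mass x \<rho> powr q) \<le>
      (\<Sum>x\<in>C. \<Sum>i=1..l. p i powr q * measure \<mu> (\<phi> i -` cball x \<rho>) powr q)"
  proof (rule sum_mono)
    fix x :: "real ^ 'n"
    have "mass x \<rho> powr q = (\<Sum>i=1..l. p i * measure \<mu> (\<phi> i -` cball x \<rho>)) powr q"
      by (subst \<mu>_eq) auto
    also have "\<dots> \<le> (\<Sum>i=1..l. (p i * measure \<mu> (\<phi> i -` cball x \<rho>)) powr q)"
      using p_pos q by (intro powr_sum_le_sum_powr) (auto simp: less_imp_le)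
    also have "\<dots> = (\<Sum>i=1..l. p i powr q * measure \<mu> (\<phi> i -` cball x \<rho>) powr q)"
      using p_pos by (intro sum.cong refl powr_mult)
    finally show "mass x \<rho> powr q \<le>
        (\<Sum>i=1..l. p i powr q * measure \<mu> (\<phi> i -` cball x \<rho>) powr q)" .
  qed
  also have "\<dots> = (\<Sum>i=1..l. p i powr q * (\<Sum>x\<in>C. measure \<mu> (\<phi> i -` cball x \<rho>) powr q))"
    by (subst sum.swap) (simp add: sum_distrib_left)
  finally have "ennreal (\<Sum>x\<in>C. mass x \<rho> powr q) \<le>
      ennreal (\<Sum>i=1..l. p i powr q * (\<Sum>x\<in>C. measure \<mu> (\<phi> i -` cball x \<rho>) powr q))"
    by (rule ennreal_leI)
  also have "\<dots> = (\<Sum>i=1..l. ennreal (p i powr q) * ennreal (\<Sum>x\<in>C. measure \<mu> (\<phi> i -` cball x \<rho>) powr q))"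
    by (subst sum_ennreal[symmetric]) (auto simp: sum_nonneg ennreal_mult')
  also have "\<dots> \<le> (\<Sum>i=1..l. ennreal (p i powr q) * packing_sum \<mu> q (\<rho> / r i))"
    using C by (intro sum_mono mult_left_mono packing_sum_vimage[OF sim]) auto
  finally show "ennreal (\<Sum>x\<in>C. mass x \<rho> powr q) \<le>
      (\<Sum>i=1..l. ennreal (p i powr q) * packing_sum \<mu> q (\<rho> / r i))" .
qed

lemma packing_sum_bounded:
  assumes q: "0 \<le> q" and "1 \<le> \<rho>"
  shows "packing_sum \<mu> q \<rho> \<le> ennreal ((rad + 2) ^ CARD('n))"
  unfolding packing_sum_def
proof (rule SUP_least, rule ennreal_leI, clarify)
  fix C :: "(real ^ 'n) set" assume C: "finite C" "disjoint_family_on (\<lambda>x. cball x \<rho>) C"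
  have "(\<Sum>x\<in>C. mass x \<rho> powr q) \<le> ((rad + 2 * \<rho>) / \<rho>) ^ CARD('n)"
    using packing_sum_le_card[of q C \<rho>] charged_packing_card[of C \<rho>] C assms by force
  also have "\<dots> \<le> (rad + 2) ^ CARD('n)"
  proof (rule power_mono)
    have "rad * 1 \<le> rad * \<rho>" using rad_ge_1 assms by (intro mult_left_mono) auto
    then show "(rad + 2 * \<rho>) / \<rho> \<le> rad + 2"
      using assms by (simp add: field_simps)
  qed (use rad_ge_1 assms in auto)
  finally show "(\<Sum>x\<in>C. mass x \<rho> powr q) \<le> (rad + 2) ^ CARD('n)" .
qed

lemma packing_sum_le_T:
  assumes q: "0 \<le> q" "q \<le> 1"
  obtains C where "0 < C"
    "\<And>\<rho>. 0 < \<rho> \<Longrightarrow> \<rho> \<le> 1 \<Longrightarrow> packing_sum \<mu> q \<rho> \<le> ennreal (C * \<rho> powr T q)"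
proof (rule scaling_recursion[of "{1..l}" rmin r rmax "\<lambda>i. p i powr q" 1 "T q" "packing_sum \<mu> q"])
  show "(\<Sum>i=1..l. p i powr q * r i powr - T q) \<le> 1"
    using W_sum[of q] by (simp add: W_def)
  show "packing_sum \<mu> q \<rho> \<le> ennreal ((rad + 2) ^ CARD('n))" if "1 \<le> \<rho>" for \<rho>
    using packing_sum_bounded that q by blast
  show "packing_sum \<mu> q \<rho> \<le> (\<Sum>i=1..l. ennreal (p i powr q) * packing_sum \<mu> q (\<rho> / r i))" for \<rho>
    by (rule packing_sum_step[OF q])
qed (use rmin_pos rmin_le_rmax rmax_less_1 rmin_le_r r_le_rmax rad_ge_1 that in auto)

end

section \<open>Local dimensions\<close>

lemma half_powr: "((1/2) ^ n) powr x = ((1/2) powr x) ^ n" for x :: real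
  by (simp add: powr_realpow[symmetric] powr_powr mult.commute)

lemma half_powr_less_1: "0 < x \<Longrightarrow> (1/2) powr x < 1" for x :: real
  by (simp add: powr_def mult_pos_neg)

lemma supp_iff_cball:
  fixes \<eta> :: "'a::metric_space measure"
  assumes "finite_measure \<eta>" "sets \<eta> = sets borel"
  shows "x \<in> supp \<eta> \<longleftrightarrow> (\<forall>\<rho>>0. 0 < measure \<eta> (cball x \<rho>))"
proof -
  interpret finite_measure \<eta> by fact
  show ?thesis
  proof
    assume x: "x \<in> supp \<eta>"
    show "\<forall>\<rho>>0. 0 < measure \<eta> (cball x \<rho>)"
    proof (intro allI impI)
      fix \<rho> :: real assume "\<rho> > 0"
      then have "0 < emeasure \<eta> (ball x \<rho>)" using x by (auto simp: supp_def)
      also have "\<dots> \<le> emeasure \<eta> (cball x \<rho>)"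
        using assms by (intro emeasure_mono) auto
      finally show "0 < measure \<eta> (cball x \<rho>)"
        by (simp add: emeasure_eq_measure)
    qed
  next
    assume pos: "\<forall>\<rho>>0. 0 < measure \<eta> (cball x \<rho>)"
    show "x \<in> supp \<eta>" unfolding supp_def
    proof (clarify)
      fix U assume U: "open U" "x \<in> U"
      then obtain e where e: "e > 0" "cball x e \<subseteq> U" by (meson open_contains_cball)
      have "0 < emeasure \<eta> (cball x e)" using pos e by (simp add: emeasure_eq_measure)
      also have "\<dots> \<le> emeasure \<eta> U"
        using e U assms by (intro emeasure_mono) auto
      finally show "0 < emeasure \<eta> U" .
    qed
  qed
qed

lemma supp_half_powerI:
  fixes \<eta> :: "'a::metric_space measure"
  assumes \<eta>: "finite_measure \<eta>" "sets \<eta> = sets borel"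
    and pos: "\<forall>\<^sub>F n in sequentially. 0 < measure \<eta> (cball x ((1/2) ^ n))"
  shows "x \<in> supp \<eta>"
  unfolding supp_iff_cball[OF \<eta>]
proof (intro allI impI)
  interpret finite_measure \<eta> by fact
  fix \<rho> :: real assume "0 < \<rho>"
  have "(\<lambda>n. (1/2::real) ^ n) \<longlonglongrightarrow> 0" by (rule LIMSEQ_power_zero) simp
  then have "\<forall>\<^sub>F n in sequentially. (1/2::real) ^ n < \<rho>" using \<open>0 < \<rho>\<close> by (rule order_tendstoD)
  with pos have "\<forall>\<^sub>F n in sequentially. 0 < measure \<eta> (cball x \<rho>)"
  proof eventually_elim
    case (elim n)
    then have "measure \<eta> (cball x ((1/2) ^ n)) \<le> measure \<eta> (cball x \<rho>)"
      using \<eta> by (intro finite_measure_mono) auto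
    then show ?case using elim by linarith
  qed
  then show "0 < measure \<eta> (cball x \<rho>)" by auto
qed

lemma (in prob_space) AE_ex_positive:
  assumes A: "\<And>k::nat. A k \<in> sets M" and ex: "AE x in M. \<exists>k. x \<in> A k"
  obtains k where "0 < prob (A k)"
proof (rule ccontr)
  assume "\<not> thesis"
  then have "prob (A k) = 0" for k
    using that[of k] zero_less_measure_iff[of M "A k"] by blast
  then have "A k \<in> null_sets M" for k
    using A by (intro null_setsI) (simp_all add: emeasure_eq_measure)
  then have "AE x in M. \<forall>k. x \<notin> A k" by (simp add: AE_all_countable AE_not_in)
  with ex have "AE x in M. False" by eventually_elim auto
  then show False by (simp add: AE_False)
qed

lemma measure_le_cover:
  fixes M :: "'a::metric_space measure"
  assumes fin: "finite_measure M" and M: "sets M = sets borel" and P: "finite P" "A \<subseteq> (\<Union>c\<in>P. cball c \<rho>)"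
    and le: "\<And>c. c \<in> P \<Longrightarrow> measure M (cball c \<rho>) \<le> b"
  shows "measure M A \<le> real (card P) * b"
proof -
  interpret finite_measure M by (rule fin)
  have "measure M A \<le> measure M (\<Union>c\<in>P. cball c \<rho>)"
    using P M by (intro finite_measure_mono sets.finite_UN) auto
  also have "\<dots> \<le> (\<Sum>c\<in>P. measure M (cball c \<rho>))"
    using P M by (intro finite_measure_subadditive_finite) auto
  also have "\<dots> \<le> real (card P) * b" by (rule sum_bounded_above) (rule le)
  finally show ?thesis .
qed

lemma has_local_dim_bounds:
  fixes \<eta> :: "'a::metric_space measure"
  assumes \<eta>: "finite_measure \<eta>" "sets \<eta> = sets borel"
    and dim: "has_local_dim \<eta> x a" and "0 < \<epsilon>"
  shows "\<forall>\<^sub>F \<rho> in at_right 0. \<rho> powr (a + \<epsilon>) \<le> measure \<eta> (cball x \<rho>) \<and>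
           measure \<eta> (cball x \<rho>) \<le> \<rho> powr (a - \<epsilon>)"
proof -
  have pos: "0 < measure \<eta> (cball x \<rho>)" if "0 < \<rho>" for \<rho>
    using dim that supp_iff_cball[OF \<eta>] by (auto simp: has_local_dim_def)
  have lim: "((\<lambda>\<rho>. ln (measure \<eta> (cball x \<rho>)) / ln \<rho>) \<longlongrightarrow> a) (at_right 0)"
    using dim by (simp add: has_local_dim_def)
  have "\<forall>\<^sub>F \<rho> in at_right 0. ln (measure \<eta> (cball x \<rho>)) / ln \<rho> < a + \<epsilon>"
    "\<forall>\<^sub>F \<rho> in at_right 0. a - \<epsilon> < ln (measure \<eta> (cball x \<rho>)) / ln \<rho>"
    using order_tendstoD[OF lim] \<open>0 < \<epsilon>\<close> by auto
  moreover have "\<forall>\<^sub>F \<rho> in at_right (0::real). 0 < \<rho> \<and> \<rho> < 1"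
    by (auto simp: eventually_at_right_field intro!: exI[of _ 1])
  ultimately show ?thesis
  proof eventually_elim
    case (elim \<rho>)
    let ?m = "measure \<eta> (cball x \<rho>)"
    have neg: "ln \<rho> < 0" using elim by simp
    have "(a + \<epsilon>) * ln \<rho> \<le> ln ?m" "ln ?m \<le> (a - \<epsilon>) * ln \<rho>"
      using elim neg by (auto simp: field_simps)
    then have "exp ((a + \<epsilon>) * ln \<rho>) \<le> exp (ln ?m)" "exp (ln ?m) \<le> exp ((a - \<epsilon>) * ln \<rho>)"
      by simp_all
    then show ?case using elim pos[of \<rho>] by (simp add: powr_def)
  qed
qed

text \<open>Any small radius lies between consecutive powers of 1/2. Passing to them changes the
  logarithm of the mass bounds by at most \<open>L * (\<bar>a\<bar> + \<epsilon>)\<close>, which is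
  negligible against \<open>- ln \<rho>\<close>.\<close>

lemma has_local_dimI:
  fixes \<eta> :: "'a::metric_space measure"
  assumes \<eta>: "finite_measure \<eta>" "sets \<eta> = sets borel"
    and bounds: "\<And>\<epsilon>. 0 < \<epsilon> \<Longrightarrow> \<forall>\<^sub>F n in sequentially.
        ((1/2) ^ n) powr (a + \<epsilon>) \<le> measure \<eta> (cball x ((1/2) ^ n)) \<and>
        measure \<eta> (cball x ((1/2) ^ n)) \<le> ((1/2) ^ n) powr (a - \<epsilon>)"
  shows "has_local_dim \<eta> x a"
proof -
  interpret finite_measure \<eta> by fact
  let ?m = "\<lambda>\<rho>. measure \<eta> (cball x \<rho>)"
  have mono: "?m \<rho> \<le> ?m \<rho>'" if "\<rho> \<le> \<rho>'" for \<rho> \<rho>'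
    using that \<eta> by (intro finite_measure_mono) auto
  have "\<forall>\<^sub>F n in sequentially. 0 < ?m ((1/2) ^ n)"
    using bounds[OF zero_less_one]
  proof eventually_elim
    case (elim n)
    have "0 < ((1/2::real) ^ n) powr (a + 1)" by simp
    then show ?case using elim by linarith
  qed
  then have pos: "0 < ?m \<rho>" if "0 < \<rho>" for \<rho>
    using that supp_half_powerI[OF \<eta>] supp_iff_cball[OF \<eta>] by blast
  have "((\<lambda>\<rho>. ln (?m \<rho>) / ln \<rho>) \<longlongrightarrow> a) (at_right 0)"
  proof (rule tendstoI)
    fix e :: real assume "0 < e"
    \<comment> \<open>One \<epsilon> is lost to the bounds at dyadic radii and one to rounding the
      radius; the third is slack.\<close>
    define \<epsilon> where "\<epsilon> = e / 3"
    have "\<epsilon> > 0" using \<open>0 < e\<close> by (simp add: \<epsilon>_def)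
    obtain N where N: "\<And>n. n \<ge> N \<Longrightarrow> ((1/2) ^ n) powr (a + \<epsilon>) \<le> ?m ((1/2) ^ n) \<and>
        ?m ((1/2) ^ n) \<le> ((1/2) ^ n) powr (a - \<epsilon>)"
      using bounds[OF \<open>\<epsilon> > 0\<close>] by (auto simp: eventually_sequentially)
    define L where "L = ln (2::real)"
    have "L > 0" by (simp add: L_def)
    \<comment> \<open>The entries ensure, for \<open>y > b\<close>, in this order: that the dyadic
      index is at least \<open>N\<close>, that the rounding error is below
      \<open>y * \<epsilon>\<close>, and that \<open>y\<close> is positive.\<close>
    define b where "b = Max {real N * L, L * (\<bar>a\<bar> + \<epsilon>) / \<epsilon>, 1}"
    have b: "real N * L \<le> b" "L * (\<bar>a\<bar> + \<epsilon>) / \<epsilon> \<le> b" "1 \<le> b" by (auto simp: b_def)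
    have "dist (ln (?m \<rho>) / ln \<rho>) a < e" if \<rho>: "0 < \<rho>" "\<rho> < exp (- b)" for \<rho>
    proof -
      define y where "y = - ln \<rho>"
      have y: "b < y" using \<rho> ln_less_cancel_iff[of \<rho> "exp (- b)"] by (simp add: y_def)
      have "y > 0" using y b by linarith
      define n where "n = nat \<lfloor>y / L\<rfloor>"
      have "0 \<le> y / L" using \<open>y > 0\<close> \<open>L > 0\<close> by simp
      then have "real n \<le> y / L" "y / L < real n + 1" by (auto simp: n_def)
      then have n: "real n * L \<le> y" "y < (real n + 1) * L"
        using \<open>L > 0\<close> by (auto simp: field_simps)
      have "real N * L < (real n + 1) * L" using b y n by linarith
      then have "n \<ge> N" using \<open>L > 0\<close> by simp
      have half: "(1/2) ^ k = exp (- (real k * L))" for k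
        by (simp add: L_def exp_minus exp_of_nat_mult power_inverse inverse_eq_divide power_one_over)
      have "\<rho> = exp (- y)" using \<rho> by (simp add: y_def)
      then have "\<rho> \<le> (1/2) ^ n" "(1/2) ^ Suc n \<le> \<rho>"
        unfolding half using n by (auto simp: algebra_simps)
      then have m: "?m \<rho> \<le> ?m ((1/2) ^ n)" "?m ((1/2) ^ Suc n) \<le> ?m \<rho>" by (auto intro: mono)
      have "?m \<rho> \<le> exp (- (real n * L) * (a - \<epsilon>))"
        using m(1) N[OF \<open>n \<ge> N\<close>] by (simp add: half powr_def mult.commute)
      then have up: "real n * L * (a - \<epsilon>) \<le> - ln (?m \<rho>)"
        using pos[OF \<rho>(1)] ln_le_cancel_iff[of "?m \<rho>" "exp (- (real n * L) * (a - \<epsilon>))"] by simp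
      have "exp (- (real (Suc n) * L) * (a + \<epsilon>)) \<le> ?m \<rho>"
        using m(2) N[of "Suc n"] \<open>n \<ge> N\<close> by (simp add: half powr_def mult.commute del: power_Suc of_nat_Suc)
      then have lo: "- ln (?m \<rho>) \<le> (real n + 1) * L * (a + \<epsilon>)"
        using pos[OF \<rho>(1)] ln_le_cancel_iff[of "exp (- (real (Suc n) * L) * (a + \<epsilon>))" "?m \<rho>"]
        by (simp add: algebra_simps)
      have diff: "\<bar>y * c - k * c\<bar> \<le> L * \<bar>c\<bar>" if "\<bar>y - k\<bar> \<le> L" for c k
        using that by (metis abs_ge_zero abs_mult left_diff_distrib mult_right_mono)
      have "\<bar>y * (a - \<epsilon>) - real n * L * (a - \<epsilon>)\<bar> \<le> L * \<bar>a - \<epsilon>\<bar>"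
        "\<bar>y * (a + \<epsilon>) - (real n + 1) * L * (a + \<epsilon>)\<bar> \<le> L * \<bar>a + \<epsilon>\<bar>"
        using n by (intro diff; simp add: algebra_simps)+
      moreover have "L * \<bar>a - \<epsilon>\<bar> \<le> L * (\<bar>a\<bar> + \<epsilon>)" "L * \<bar>a + \<epsilon>\<bar> \<le> L * (\<bar>a\<bar> + \<epsilon>)"
        using \<open>L > 0\<close> \<open>\<epsilon> > 0\<close> by auto
      moreover have "L * (\<bar>a\<bar> + \<epsilon>) < y * \<epsilon>"
        using b(2) y \<open>\<epsilon> > 0\<close> by (simp add: pos_divide_le_eq) (smt (verit) mult_less_cancel_right)
      ultimately have "\<bar>- ln (?m \<rho>) - y * a\<bar> < y * e"
        using up lo by (simp add: \<epsilon>_def algebra_simps abs_less_iff) linarith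
      then have "\<bar>(- ln (?m \<rho>) - y * a) / y\<bar> < e"
        using \<open>y > 0\<close> by (simp add: abs_divide pos_divide_less_eq mult.commute)
      moreover have "ln (?m \<rho>) / ln \<rho> - a = (- ln (?m \<rho>) - y * a) / y"
        using \<open>y > 0\<close> by (simp add: y_def field_simps)
      ultimately show ?thesis by (simp add: dist_real_def)
    qed
    then show "\<forall>\<^sub>F \<rho> in at_right 0. dist (ln (?m \<rho>) / ln \<rho>) a < e"
      unfolding eventually_at_right_field by (intro exI[of _ "exp (- b)"]) auto
  qed
  then show ?thesis using pos supp_iff_cball[OF \<eta>] by (simp add: has_local_dim_def)
qed

lemma eventually_half_power:
  assumes "\<forall>\<^sub>F \<rho> in at_right (0::real). P \<rho>" and "0 < c"
  shows "\<forall>\<^sub>F n in sequentially. P (c * (1/2) ^ n)"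
proof -
  have "filterlim (\<lambda>n. c * (1/2) ^ n) (at_right 0) sequentially"
    unfolding filterlim_at
  proof (intro conjI)
    have "(\<lambda>n. c * (1/2::real) ^ n) \<longlonglongrightarrow> c * 0"
      by (intro tendsto_intros LIMSEQ_power_zero) simp
    then show "(\<lambda>n. c * (1/2::real) ^ n) \<longlonglongrightarrow> 0" by simp
  qed (use \<open>0 < c\<close> in auto)
  then show ?thesis using assms(1) by (auto simp: filterlim_iff)
qed

lemma AE_all_positive:
  assumes "\<And>\<epsilon>::real. 0 < \<epsilon> \<Longrightarrow> AE x in M. P \<epsilon> x"
    and mono: "\<And>\<epsilon> \<epsilon>' x. P \<epsilon> x \<Longrightarrow> \<epsilon> \<le> \<epsilon>' \<Longrightarrow> P \<epsilon>' x"
  shows "AE x in M. \<forall>\<epsilon>>0. P \<epsilon> x"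
proof -
  have "AE x in M. \<forall>n. P (1 / real (Suc n)) x"
    using assms(1) by (simp add: AE_all_countable)
  then show ?thesis
  proof (rule AE_mp, intro AE_I2 impI allI)
    fix x and \<epsilon> :: real assume P: "\<forall>n. P (1 / real (Suc n)) x" and "0 < \<epsilon>"
    obtain n where "1 / real (Suc n) < \<epsilon>" using \<open>0 < \<epsilon>\<close> nat_approx_posE by metis
    then show "P \<epsilon> x" using P mono by (meson less_imp_le)
  qed
qed

lemma AE_eventually_of_geometric:
  assumes "finite_measure M" and "\<And>n. A n \<in> sets M" and "0 \<le> x" "x < 1"
    and bound: "\<And>n. n \<ge> (N::nat) \<Longrightarrow> measure M (A n) \<le> C * x ^ n"
  shows "AE z in M. \<forall>\<^sub>F n in sequentially. z \<notin> A n"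
proof -
  interpret finite_measure M by fact
  have "AE z in M. \<forall>\<^sub>F n in sequentially. z \<in> space M - A n"
  proof (rule borel_cantelli_AE1)
    show "summable (\<lambda>n. measure M (A n))"
    proof (rule summable_comparison_test')
      show "summable (\<lambda>n. C * x ^ n)" using assms by (intro summable_mult summable_geometric) auto
      show "norm (measure M (A n)) \<le> C * x ^ n" if "n \<ge> N" for n using bound[OF that] by simp
    qed
  qed (use assms in \<open>auto simp: emeasure_eq_measure\<close>)
  then show ?thesis by (rule AE_mp) (auto intro!: AE_I2 elim: eventually_mono)
qed

section \<open>Typical points of the tilted measures\<close>

text \<open>The value at mass zero is infinite, unlike \<open>0 powr (- \<theta>) = 0\<close>. This
  makes the function antitone and lets balls of mass zero count as bad in Markov's
  inequality.\<close>

definition neg_powr :: "real \<Rightarrow> real \<Rightarrow> ennreal" where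
  "neg_powr \<theta> m = (if m \<le> 0 then \<infinity> else ennreal (m powr (- \<theta>)))"

lemma neg_powr_antimono: "0 \<le> \<theta> \<Longrightarrow> m \<le> m' \<Longrightarrow> neg_powr \<theta> m' \<le> neg_powr \<theta> m"
  by (auto simp: neg_powr_def intro!: ennreal_leI powr_mono2')

lemma neg_powr_mult: "0 < c \<Longrightarrow> 0 \<le> m \<Longrightarrow> neg_powr \<theta> (c * m) = ennreal (c powr (- \<theta>)) * neg_powr \<theta> m"
  by (auto simp: neg_powr_def powr_mult ennreal_mult' mult_le_0_iff ennreal_mult_eq_top_iff)

lemma measurable_neg_powr [measurable]: "neg_powr \<theta> \<in> borel_measurable borel"
  unfolding neg_powr_def by measurable

context self_similar
begin

lemma measurable_\<mu>_cball [measurable]: "(\<lambda>x. mass x \<rho>) \<in> borel_measurable borel"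
  by (rule measurable_measure_cball[OF finite_measure_axioms sets_\<mu>])

context
  fixes q :: real and \<nu> :: "(real ^ 'n) measure"
  assumes \<nu>: "self_similar_measure l \<phi> (W q) \<nu>"
begin

interpretation N: self_similar l \<phi> r "W q" \<nu>
  by unfold_locales (use W_weights \<nu> in auto)

text \<open>Keeping only the \<open>i\<close>-th term of the self-similarity identity at the point
  \<open>\<phi> i x\<close> gives
  \<open>p i * mass x (\<rho> / r i) \<le> mass (\<phi> i x) \<rho>\<close>; a negative power
  reverses this. The factors \<open>W q i * p i powr (- \<theta>)\<close>, scaled with exponent
  \<open>T (q - \<theta>) - T q\<close>, are the weights \<open>W (q - \<theta>)\<close>, which sum
  to 1. From scale \<open>2 * rad\<close> on, a ball about a typical point contains
  \<open>cball 0 rad\<close> and has mass 1.\<close>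

lemma neg_moment_bound:
  assumes "0 \<le> \<theta>"
  obtains C where "0 < C" "\<And>\<rho>. 0 < \<rho> \<Longrightarrow> \<rho> \<le> 2 * rad \<Longrightarrow>
    (\<integral>\<^sup>+x. neg_powr \<theta> (mass x \<rho>) \<partial>\<nu>) \<le> ennreal (C * \<rho> powr (T (q - \<theta>) - T q))"
proof (rule scaling_recursion[of "{1..l}" rmin r rmax "\<lambda>i. W q i * p i powr (- \<theta>)" "2 * rad"
      "T (q - \<theta>) - T q" "\<lambda>\<rho>. \<integral>\<^sup>+x. neg_powr \<theta> (mass x \<rho>) \<partial>\<nu>" 1])
  have "(\<Sum>i=1..l. W q i * p i powr - \<theta> * r i powr - (T (q - \<theta>) - T q)) = (\<Sum>i=1..l. W (q - \<theta>) i)"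
    using r_pos p_pos
    by (intro sum.cong refl) (auto simp: W_def powr_diff powr_minus field_simps)
  then show "(\<Sum>i=1..l. W q i * p i powr - \<theta> * r i powr - (T (q - \<theta>) - T q)) \<le> 1"
    by (simp add: W_sum)
  fix \<rho> :: real
  show "(\<integral>\<^sup>+x. neg_powr \<theta> (mass x \<rho>) \<partial>\<nu>) \<le> ennreal 1" if "2 * rad \<le> \<rho>"
  proof -
    have "(\<integral>\<^sup>+x. neg_powr \<theta> (mass x \<rho>) \<partial>\<nu>) = (\<integral>\<^sup>+x. 1 \<partial>\<nu>)"
    proof (rule nn_integral_cong_AE, rule AE_mp[OF N.AE_rad], intro AE_I2 impI)
      fix x :: "real ^ 'n" assume x: "x \<in> cball 0 rad"
      have "cball 0 rad \<subseteq> cball x \<rho>"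
      proof
        fix y :: "real ^ 'n" assume "y \<in> cball 0 rad"
        then have "dist x y \<le> rad + rad"
          using x dist_triangle2[of x y 0] by (auto simp: dist_commute)
        then show "y \<in> cball x \<rho>" using that by simp
      qed
      then have "mass x \<rho> = 1" by (rule contains_rad) simp
      then show "neg_powr \<theta> (mass x \<rho>) = 1" by (simp add: neg_powr_def)
    qed
    also have "\<dots> = 1" by (simp add: N.emeasure_space_1)
    finally show ?thesis by simp
  qed
  show "(\<integral>\<^sup>+x. neg_powr \<theta> (mass x \<rho>) \<partial>\<nu>) \<le>
      (\<Sum>i=1..l. ennreal (W q i * p i powr - \<theta>) * (\<integral>\<^sup>+x. neg_powr \<theta> (mass x (\<rho> / r i)) \<partial>\<nu>))"
  proof -
    have "(\<integral>\<^sup>+x. neg_powr \<theta> (mass x \<rho>) \<partial>\<nu>) =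
        (\<Sum>i=1..l. ennreal (W q i) * (\<integral>\<^sup>+x. neg_powr \<theta> (mass (\<phi> i x) \<rho>) \<partial>\<nu>))"
      by (rule N.nn_integral_\<mu>) measurable
    also have "\<dots> \<le> (\<Sum>i=1..l. ennreal (W q i) *
        (\<integral>\<^sup>+x. ennreal (p i powr - \<theta>) * neg_powr \<theta> (mass x (\<rho> / r i)) \<partial>\<nu>))"
    proof (intro sum_mono mult_left_mono nn_integral_mono)
      fix i and x :: "real ^ 'n" assume i: "i \<in> {1..l}"
      have "p i * mass x (\<rho> / r i) = p i * measure \<mu> (\<phi> i -` cball (\<phi> i x) \<rho>)"
        by (simp add: similarity_vimage_cball'[OF sim[OF i]])
      also have "\<dots> \<le> (\<Sum>j=1..l. p j * measure \<mu> (\<phi> j -` cball (\<phi> i x) \<rho>))"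
        using i p_pos by (intro member_le_sum) (auto simp: less_imp_le)
      also have "\<dots> = mass (\<phi> i x) \<rho>" by (rule \<mu>_eq[symmetric]) simp
      finally have "neg_powr \<theta> (mass (\<phi> i x) \<rho>) \<le>
          neg_powr \<theta> (p i * mass x (\<rho> / r i))"
        by (rule neg_powr_antimono[OF assms])
      then show "neg_powr \<theta> (mass (\<phi> i x) \<rho>) \<le>
          ennreal (p i powr - \<theta>) * neg_powr \<theta> (mass x (\<rho> / r i))"
        using p_pos[OF i] by (simp add: neg_powr_mult)
    qed auto
    also have "\<dots> = (\<Sum>i=1..l. ennreal (W q i * p i powr - \<theta>) *
        (\<integral>\<^sup>+x. neg_powr \<theta> (mass x (\<rho> / r i)) \<partial>\<nu>))"
    proof (intro sum.cong refl)
      fix i assume i: "i \<in> {1..l}"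
      have "(\<integral>\<^sup>+x. ennreal (p i powr - \<theta>) * neg_powr \<theta> (mass x (\<rho> / r i)) \<partial>\<nu>) =
          ennreal (p i powr - \<theta>) * (\<integral>\<^sup>+x. neg_powr \<theta> (mass x (\<rho> / r i)) \<partial>\<nu>)"
        by (intro nn_integral_cmult N.meas_\<mu>) measurable
      then show "ennreal (W q i) *
          (\<integral>\<^sup>+x. ennreal (p i powr - \<theta>) * neg_powr \<theta> (mass x (\<rho> / r i)) \<partial>\<nu>) =
          ennreal (W q i * p i powr - \<theta>) * (\<integral>\<^sup>+x. neg_powr \<theta> (mass x (\<rho> / r i)) \<partial>\<nu>)"
        using W_pos[OF i, of q] by (simp add: ennreal_mult' mult.assoc)
    qed
    finally show ?thesis .
  qed
qed (use rmin_pos rmin_le_rmax rmax_less_1 rmin_le_r r_le_rmax rad_ge_1 W_pos that in \<open>auto simp: less_imp_le\<close>)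

text \<open>Markov's inequality for the negative moment, then Borel-Cantelli along powers of 1/2.
  The exponent \<kappa> is positive because the tangent at \<open>q - \<theta>\<close> lies above
  \<open>T q\<close> and \<open>dT\<close> is continuous.\<close>

lemma AE_lower_mass_bound:
  assumes "0 < \<epsilon>"
  shows "AE x in \<nu>. \<forall>\<^sub>F n in sequentially. ((1/2) ^ n) powr (dT q + \<epsilon>) \<le> mass x ((1/2) ^ n)"
proof -
  obtain \<delta> where \<delta>: "0 < \<delta>" "\<And>q'. \<bar>q' - q\<bar> < \<delta> \<Longrightarrow> \<bar>dT q' - dT q\<bar> < \<epsilon>"
    using dT_near[OF assms] by metis
  define \<theta> where "\<theta> = \<delta> / 2"
  have "0 < \<theta>" using \<delta> by (simp add: \<theta>_def)
  define \<kappa> where "\<kappa> = T (q - \<theta>) - T q + \<theta> * (dT q + \<epsilon>)"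
  have "dT (q - \<theta>) < dT q + \<epsilon>" using \<delta>(1) \<delta>(2)[of "q - \<theta>"] by (simp add: \<theta>_def)
  then have "\<theta> * dT (q - \<theta>) < \<theta> * (dT q + \<epsilon>)" using \<open>0 < \<theta>\<close> by simp
  then have "0 < \<kappa>" using T_le_tangent[of q "q - \<theta>"] by (simp add: \<kappa>_def algebra_simps)
  obtain C where C: "0 < C" "\<And>\<rho>. 0 < \<rho> \<Longrightarrow> \<rho> \<le> 2 * rad \<Longrightarrow>
    (\<integral>\<^sup>+x. neg_powr \<theta> (mass x \<rho>) \<partial>\<nu>) \<le> ennreal (C * \<rho> powr (T (q - \<theta>) - T q))"
    using neg_moment_bound[of \<theta>] \<open>0 < \<theta>\<close> by (metis less_imp_le)
  define B where "B n = {x. mass x ((1/2) ^ n) < ((1/2) ^ n) powr (dT q + \<epsilon>)}" for n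
  have B_sets: "B n \<in> sets \<nu>" for n
    unfolding N.sets_\<mu> B_def by measurable
  have "AE x in \<nu>. \<forall>\<^sub>F n in sequentially. x \<notin> B n"
  proof (rule AE_eventually_of_geometric[where N = 0 and C = C and x = "(1/2) powr \<kappa>"])
    fix n :: nat
    define \<rho> where "\<rho> = (1/2 :: real) ^ n"
    have \<rho>: "0 < \<rho>" "\<rho> \<le> 1" by (auto simp: \<rho>_def power_le_one)
    define K where "K = \<rho> powr (- \<theta> * (dT q + \<epsilon>))"
    have "0 < K" using \<rho> by (simp add: K_def)
    have "ennreal K * emeasure \<nu> (B n) = (\<integral>\<^sup>+x. ennreal K * indicator (B n) x \<partial>\<nu>)"
      using B_sets by (simp add: nn_integral_cmult_indicator)
    also have "\<dots> \<le> (\<integral>\<^sup>+x. neg_powr \<theta> (mass x \<rho>) \<partial>\<nu>)"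
    proof (rule nn_integral_mono)
      fix x :: "real ^ 'n"
      have "ennreal K \<le> neg_powr \<theta> (mass x \<rho>)" if "x \<in> B n"
      proof -
        have "neg_powr \<theta> (\<rho> powr (dT q + \<epsilon>)) \<le> neg_powr \<theta> (mass x \<rho>)"
          using that \<open>0 < \<theta>\<close> by (intro neg_powr_antimono) (auto simp: B_def \<rho>_def)
        moreover have "neg_powr \<theta> (\<rho> powr (dT q + \<epsilon>)) = ennreal K"
          using \<rho> by (simp add: neg_powr_def K_def powr_powr mult.commute)
        ultimately show ?thesis by simp
      qed
      then show "ennreal K * indicator (B n) x \<le> neg_powr \<theta> (mass x \<rho>)"
        by (auto simp: indicator_def)
    qed
    also have "\<dots> \<le> ennreal (C * \<rho> powr (T (q - \<theta>) - T q))"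
      using C(2)[of \<rho>] \<rho> rad_ge_1 by auto
    finally have "K * measure \<nu> (B n) \<le> C * \<rho> powr (T (q - \<theta>) - T q)"
      using \<open>0 < K\<close> \<open>0 < C\<close> \<rho> by (simp add: N.emeasure_eq_measure ennreal_mult'[symmetric])
    then have "measure \<nu> (B n) \<le> C * \<rho> powr (T (q - \<theta>) - T q) / K"
      using \<open>0 < K\<close> by (simp add: field_simps)
    also have "\<dots> = C * \<rho> powr \<kappa>"
      using \<rho> by (simp add: K_def \<kappa>_def powr_add powr_minus divide_inverse)
    finally show "measure \<nu> (B n) \<le> C * ((1/2) powr \<kappa>) ^ n"
      by (simp add: \<rho>_def half_powr)
  qed (use B_sets \<open>0 < \<kappa>\<close> N.finite_measure_axioms in \<open>auto simp: half_powr_less_1\<close>)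
  then show ?thesis by (simp add: B_def not_less)
qed

text \<open>A packing by bad balls, whose \<mu>-mass is too large, has few elements by the bound on
  packing sums, and the doubled balls have small \<nu>-mass by the dimension of \<nu>. The product
  decays geometrically, so Borel-Cantelli applies on each set \<open>G k\<close> where the
  \<nu>-bound is uniform.\<close>

lemma AE_upper_mass_bound:
  assumes q: "0 \<le> q" "q \<le> 1" and dim: "has_measure_dim \<nu> (q * dT q - T q)" and "0 < \<epsilon>"
  shows "AE x in \<nu>. \<forall>\<^sub>F n in sequentially. mass x ((1/2) ^ n) \<le> ((1/2) ^ n) powr (dT q - \<epsilon>)"
proof -
  define s where "s = q * dT q - T q"
  \<comment> \<open>For \<open>q > 0\<close> the choice \<open>q' = q\<close> works; only \<open>q = 0\<close> needs to move to the right.\<close>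
  obtain q' where q': "0 \<le> q'" "q' \<le> 1" "0 < T q' - T q - dT q * (q' - q) + \<epsilon> * q'"
  proof (cases "q = 0")
    case False
    then show ?thesis using that[of q] q \<open>0 < \<epsilon>\<close> by simp
  next
    case True
    obtain \<delta> where \<delta>: "0 < \<delta>" "\<And>q'. \<bar>q' - q\<bar> < \<delta> \<Longrightarrow> \<bar>dT q' - dT q\<bar> < \<epsilon>"
      using dT_near[OF \<open>0 < \<epsilon>\<close>] by metis
    define q' where "q' = min 1 (\<delta> / 2)"
    have q': "0 < q'" "q' \<le> 1" "q' < \<delta>" using \<delta> by (auto simp: q'_def)
    have "dT q - \<epsilon> < dT q'" using \<delta>(2)[of q'] q' True by simp
    then have "q' * (dT q - \<epsilon>) < q' * dT q'" using q' by simp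
    then show ?thesis using that[of q'] q' T_le_tangent[of q q'] True by (simp add: algebra_simps)
  qed
  \<comment> \<open>Half of the available gap: the other half pays for replacing the dimension
    \<open>s\<close> of \<nu> by \<open>s - \<kappa>\<close>.\<close>
  define \<kappa> where "\<kappa> = (T q' - T q - dT q * (q' - q) + \<epsilon> * q') / 2"
  have "0 < \<kappa>" using q' by (simp add: \<kappa>_def)
  obtain C where C: "0 < C" "\<And>\<rho>. 0 < \<rho> \<Longrightarrow> \<rho> \<le> 1 \<Longrightarrow> packing_sum \<mu> q' \<rho> \<le> ennreal (C * \<rho> powr T q')"
    using packing_sum_le_T[OF q'(1,2)] by metis
  define G where "G k = {x \<in> cball 0 rad. \<forall>n\<ge>k. measure \<nu> (cball x (2 * (1/2) ^ n)) \<le> (2 * (1/2) ^ n) powr (s - \<kappa>)}" for k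
  define B where "B n = {x. ((1/2) ^ n) powr (dT q - \<epsilon>) < mass x ((1/2) ^ n)}" for n
  note [measurable] = measurable_measure_cball[OF N.finite_measure_axioms N.sets_\<mu>]
  have B_sets: "B n \<in> sets \<nu>" for n
    unfolding N.sets_\<mu> B_def by measurable
  have G_sets: "G k \<in> sets \<nu>" for k
    unfolding N.sets_\<mu> G_def by measurable
  have bad: "AE x in \<nu>. \<forall>\<^sub>F n in sequentially. x \<notin> B n \<inter> G k" for k
  proof (rule AE_eventually_of_geometric[where N = k and C = "C * 2 powr (s - \<kappa>)" and x = "(1/2) powr \<kappa>"])
    fix n :: nat assume "k \<le> n"
    define \<rho> where "\<rho> = (1/2 :: real) ^ n"
    have \<rho>: "0 < \<rho>" "\<rho> \<le> 1" by (auto simp: \<rho>_def power_le_one)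
    obtain P where P: "P \<subseteq> B n \<inter> G k" "packing \<rho> P" "B n \<inter> G k \<subseteq> (\<Union>c\<in>P. cball c (2 * \<rho>))"
      by (rule maximal_packing[OF _ \<rho>(1), of "B n \<inter> G k" rad]) (use rad_ge_1 in \<open>auto simp: G_def\<close>)
    have 1: "measure \<nu> (B n \<inter> G k) \<le> real (card P) * (2 * \<rho>) powr (s - \<kappa>)"
      using P \<open>k \<le> n\<close> by (intro measure_le_cover[OF N.finite_measure_axioms N.sets_\<mu> _ P(3)]) (auto simp: G_def \<rho>_def)
    have "real (card P) * (\<rho> powr (dT q - \<epsilon>)) powr q' = (\<Sum>c\<in>P. (\<rho> powr (dT q - \<epsilon>)) powr q')"
      by simp
    also have "\<dots> \<le> (\<Sum>c\<in>P. mass c \<rho> powr q')"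
      using P q' by (intro sum_mono powr_mono2) (auto simp: B_def \<rho>_def)
    also have "\<dots> \<le> C * \<rho> powr T q'"
      using C \<rho> P(2) by (intro packing_sum_leD) auto
    finally have "real (card P) \<le> C * \<rho> powr T q' / (\<rho> powr (dT q - \<epsilon>)) powr q'"
      using \<rho> by (simp add: pos_le_divide_eq)
    also have "\<dots> = C * \<rho> powr (T q' - (dT q - \<epsilon>) * q')"
      by (simp only: powr_powr powr_diff[of _ "T q'"] times_divide_eq_right)
    finally have "measure \<nu> (B n \<inter> G k) \<le>
        C * \<rho> powr (T q' - (dT q - \<epsilon>) * q') * (2 * \<rho>) powr (s - \<kappa>)"
      using 1 by (meson mult_right_mono order_trans powr_ge_zero)
    also have "\<dots> = C * 2 powr (s - \<kappa>) * \<rho> powr (T q' - (dT q - \<epsilon>) * q' + (s - \<kappa>))"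
      using \<rho> by (simp add: powr_mult powr_add)
    also have "T q' - (dT q - \<epsilon>) * q' + (s - \<kappa>) = \<kappa>"
      by (simp add: \<kappa>_def s_def field_simps)
    finally show "measure \<nu> (B n \<inter> G k) \<le> C * 2 powr (s - \<kappa>) * ((1/2) powr \<kappa>) ^ n"
      by (simp add: \<rho>_def half_powr)
  qed (use B_sets G_sets \<open>0 < \<kappa>\<close> N.finite_measure_axioms in \<open>auto simp: half_powr_less_1\<close>)
  have "AE x in \<nu>. \<exists>k. x \<in> G k"
  proof -
    have "AE x in \<nu>. has_local_dim \<nu> x s" using dim by (simp add: has_measure_dim_def s_def)
    then show ?thesis using N.AE_rad
    proof eventually_elim
      case (elim x)
      have "\<forall>\<^sub>F \<rho> in at_right 0. measure \<nu> (cball x \<rho>) \<le> \<rho> powr (s - \<kappa>)"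
        using has_local_dim_bounds[OF N.finite_measure_axioms N.sets_\<mu> elim(1) \<open>0 < \<kappa>\<close>]
        by (rule eventually_mono) auto
      from eventually_half_power[OF this, of 2] elim(2) show ?case
        by (auto simp: G_def eventually_sequentially)
    qed
  qed
  moreover have "AE x in \<nu>. \<forall>k. \<forall>\<^sub>F n in sequentially. x \<notin> B n \<inter> G k"
    using bad unfolding AE_all_countable by blast
  ultimately show ?thesis
  proof eventually_elim
    case (elim x)
    then obtain k where "x \<in> G k" by auto
    have "\<forall>\<^sub>F n in sequentially. x \<notin> B n \<inter> G k" using elim(2) by (rule spec)
    then have "\<forall>\<^sub>F n in sequentially. x \<notin> B n"
      by (rule eventually_mono) (use \<open>x \<in> G k\<close> in blast)
    then show ?case by (simp add: B_def not_less)
  qed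
qed

lemma AE_tilted_local_dim:
  assumes "0 \<le> q" "q \<le> 1" and "has_measure_dim \<nu> (q * dT q - T q)"
  shows "AE x in \<nu>. has_local_dim \<mu> x (dT q)"
proof -
  let ?P = "\<lambda>\<epsilon> x. \<forall>\<^sub>F n in sequentially. ((1/2) ^ n) powr (dT q + \<epsilon>) \<le> mass x ((1/2) ^ n) \<and>
        mass x ((1/2) ^ n) \<le> ((1/2) ^ n) powr (dT q - \<epsilon>)"
  have "AE x in \<nu>. \<forall>\<epsilon>>0. ?P \<epsilon> x"
  proof (rule AE_all_positive)
    show "AE x in \<nu>. ?P \<epsilon> x" if "0 < \<epsilon>" for \<epsilon>
      using AE_lower_mass_bound[OF that] AE_upper_mass_bound[OF assms that]
      by eventually_elim (rule eventually_conj)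
    show "?P \<epsilon>' x" if "?P \<epsilon> x" "\<epsilon> \<le> \<epsilon>'" for \<epsilon> \<epsilon>' x
      using that(1)
    proof eventually_elim
      case (elim n)
      have "((1/2::real) ^ n) powr (dT q + \<epsilon>') \<le> ((1/2) ^ n) powr (dT q + \<epsilon>)"
        "((1/2::real) ^ n) powr (dT q - \<epsilon>) \<le> ((1/2) ^ n) powr (dT q - \<epsilon>')"
        using that(2) by (intro powr_mono'; simp add: power_le_one)+
      then show ?case using elim by linarith
    qed
  qed
  then show ?thesis
    by eventually_elim (rule has_local_dimI[OF finite_measure_axioms sets_\<mu>], blast)
qed

end

end

section \<open>Hausdorff dimension\<close>

lemma hausdorff_pre_UN_null:
  fixes E :: "nat \<Rightarrow> 'a::metric_space set"
  assumes null: "\<And>k. hausdorff_pre s \<delta> (E k) = 0"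
  shows "hausdorff_pre s \<delta> (\<Union>k. E k) = 0"
proof -
  have "hausdorff_pre s \<delta> (\<Union>k. E k) \<le> 0 + ennreal e" if "0 < e" for e
  proof -
    have "\<exists>U. (E k \<subseteq> (\<Union>n. U n) \<and> (\<forall>n. bounded (U n) \<and> diameter (U n) \<le> \<delta>)) \<and>
        (\<Sum>n. diam_pow s (U n)) < ennreal (e * (1/2) ^ Suc k)" for k
    proof -
      have "hausdorff_pre s \<delta> (E k) < ennreal (e * (1/2) ^ Suc k)"
        using that by (simp add: null)
      then show ?thesis unfolding hausdorff_pre_def Inf_less_iff by auto
    qed
    then obtain U where U: "\<And>k. E k \<subseteq> (\<Union>n. U k n)" "\<And>k n. bounded (U k n)"
        "\<And>k n. diameter (U k n) \<le> \<delta>" "\<And>k. (\<Sum>n. diam_pow s (U k n)) < ennreal (e * (1/2) ^ Suc k)"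
      by metis
    define V where "V j = U (fst (prod_decode j)) (snd (prod_decode j))" for j
    have V: "U k n = V (prod_encode (k, n))" for k n by (simp add: V_def)
    have "hausdorff_pre s \<delta> (\<Union>k. E k) \<le> (\<Sum>j. diam_pow s (V j))"
      unfolding hausdorff_pre_def
    proof (rule INF_lower, simp, intro conjI allI)
      show "(\<Union>k. E k) \<subseteq> (\<Union>n. V n)" using U(1) V by fastforce
    qed (auto simp: V_def U)
    also have "\<dots> = (\<Sum>k. \<Sum>n. diam_pow s (U k n))"
      using suminf_ennreal_2dimen[of "\<lambda>k. \<Sum>n. diam_pow s (U k n)" "\<lambda>(k, n). diam_pow s (U k n)"]
      by (simp add: V_def case_prod_beta)
    also have "\<dots> \<le> (\<Sum>k. ennreal (e * (1/2) ^ Suc k))"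
      by (intro suminf_le less_imp_le[OF U(4)]) simp_all
    also have "\<dots> = ennreal e"
    proof -
      have "(\<lambda>k. e * (1/2) ^ Suc k) sums (e * 1)"
        by (intro sums_mult power_half_series)
      then show ?thesis using \<open>0 < e\<close> by (intro suminf_ennreal_eq) auto
    qed
    finally show ?thesis by simp
  qed
  then have "hausdorff_pre s \<delta> (\<Union>k. E k) \<le> 0" by (rule ennreal_le_epsilon)
  then show ?thesis by simp
qed

lemma hausdorff_pre_le_finite_cover:
  fixes P :: "'a::metric_space set"
  assumes "finite P" "E \<subseteq> (\<Union>c\<in>P. U c)" "\<And>c. c \<in> P \<Longrightarrow> bounded (U c) \<and> diameter (U c) \<le> \<delta>" "0 \<le> \<delta>"
  shows "hausdorff_pre s \<delta> E \<le> (\<Sum>c\<in>P. diam_pow s (U c :: 'b::metric_space set))"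
proof -
  obtain h where h: "bij_betw h {0..<card P} P"
    using ex_bij_betw_nat_finite[OF assms(1)] by blast
  define V where "V n = (if n < card P then U (h n) else {})" for n
  have hP: "h n \<in> P" if "n < card P" for n using h that by (auto simp: bij_betw_def)
  have "hausdorff_pre s \<delta> E \<le> (\<Sum>n. diam_pow s (V n))"
    unfolding hausdorff_pre_def
  proof (rule INF_lower, simp, intro conjI allI)
    have "(\<Union>c\<in>P. U c) = (\<Union>n\<in>{0..<card P}. U (h n))"
      using bij_betw_imp_surj_on[OF h] by (metis image_image)
    also have "\<dots> \<subseteq> (\<Union>n. V n)" by (auto simp: V_def)
    finally show "E \<subseteq> (\<Union>n. V n)" using assms(2) by auto
  qed (use assms hP in \<open>auto simp: V_def\<close>)
  also have "\<dots> = (\<Sum>n\<in>{0..<card P}. diam_pow s (V n))"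
    by (rule suminf_finite) (auto simp: V_def diam_pow_def)
  also have "\<dots> = (\<Sum>n\<in>{0..<card P}. diam_pow s (U (h n)))"
    by (intro sum.cong) (auto simp: V_def)
  also have "\<dots> = (\<Sum>c\<in>P. diam_pow s (U c))"
    by (rule sum.reindex_bij_betw[OF h])
  finally show ?thesis .
qed

lemma hausdorff_measure_null_iff: "hausdorff_measure s A = 0 \<longleftrightarrow> (\<forall>\<delta>>0. hausdorff_pre s \<delta> A = 0)"
proof -
  have "hausdorff_measure s A \<le> 0 \<longleftrightarrow> (\<forall>\<delta>\<in>{0<..}. hausdorff_pre s \<delta> A \<le> 0)"
    unfolding hausdorff_measure_def by (rule SUP_le_iff)
  then show ?thesis by auto
qed

text \<open>Mass distribution principle: on a set \<open>A k\<close> of positive measure the ball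
  masses are uniformly bounded, so the sum over any fine cover of \<open>E\<close> is at least a
  fixed multiple of \<open>measure \<nu> (A k)\<close>.\<close>

lemma hausdorff_dim_ge_local_dim:
  fixes \<nu> :: "'a::euclidean_space measure"
  assumes \<nu>: "prob_space \<nu>" "sets \<nu> = sets borel"
    and E: "AE x in \<nu>. x \<in> E" and dim: "has_measure_dim \<nu> s"
  shows "ereal s \<le> hausdorff_dim E"
proof -
  interpret prob_space \<nu> by fact
  have "E \<noteq> {}"
  proof
    assume "E = {}"
    then have "AE x in \<nu>. False" using E by simp
    then show False by (simp add: AE_False)
  qed
  have "s \<le> s'" if s': "0 \<le> s'" and null: "hausdorff_measure s' E = 0" for s'
  proof (rule ccontr)
    assume "\<not> s \<le> s'"
    \<comment> \<open>Besides leaving room on both sides, \<open>t\<close> is positive even if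
      \<open>s' = 0\<close>, so single points of \<open>A k\<close> have measure zero.\<close>
    define t where "t = (s + s') / 2"
    have t: "s' < t" "t < s" "0 < t" using \<open>\<not> s \<le> s'\<close> s' by (auto simp: t_def)
    define A where "A k = {x. \<forall>n\<ge>k. measure \<nu> (cball x ((1/2) ^ n)) \<le> ((1/2) ^ n) powr t}" for k
    note [measurable] = measurable_measure_cball[OF finite_measure_axioms \<nu>(2)]
    have A_sets: "A k \<in> sets \<nu>" for k
      unfolding \<nu>(2) A_def by measurable
    have "AE x in \<nu>. \<exists>k. x \<in> A k"
    proof -
      have "AE x in \<nu>. has_local_dim \<nu> x s" using dim by (simp add: has_measure_dim_def)
      then show ?thesis
      proof (rule AE_mp, intro AE_I2 impI)
        fix x assume x: "has_local_dim \<nu> x s"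
        have "0 < s - t" using t by simp
        have "\<forall>\<^sub>F \<rho> in at_right 0. measure \<nu> (cball x \<rho>) \<le> \<rho> powr t"
          using has_local_dim_bounds[OF finite_measure_axioms \<nu>(2) x \<open>0 < s - t\<close>]
          by (rule eventually_mono) auto
        from eventually_half_power[OF this, of 1] show "\<exists>k. x \<in> A k"
          by (auto simp: A_def eventually_sequentially)
      qed
    qed
    then obtain k where k: "0 < measure \<nu> (A k)" using AE_ex_positive[of A] A_sets by blast
    \<comment> \<open>\<open>E\<close> may fail to be measurable; it enters only through the null
      set \<open>N\<close> outside of which all points belong to it.\<close>
    obtain N where N: "N \<in> null_sets \<nu>" "{x \<in> space \<nu>. x \<notin> E} \<subseteq> N"
      using E by (auto simp: eventually_ae_filter)
    have space: "space \<nu> = UNIV" using sets_eq_imp_space_eq[OF \<nu>(2)] by simp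
    \<comment> \<open>With this bound on diameters, the power of 1/2 just above a positive diameter
      has index at least \<open>k\<close>, where the bound defining \<open>A k\<close>
      holds.\<close>
    define \<delta> where "\<delta> = (1/2 :: real) ^ Suc k"
    have "0 < \<delta>" by (simp add: \<delta>_def)
    have lower: "ennreal (measure \<nu> (A k) / 2 powr t) \<le> (\<Sum>n. diam_pow s' (U n))"
      if U: "E \<subseteq> (\<Union>n. U n)" "\<And>n. bounded (U n)" "\<And>n. diameter (U n) \<le> \<delta>" for U
    proof -
      \<comment> \<open>The sets of the cover need not be measurable, so each one meeting
        \<open>A k - N\<close> is replaced by a ball about one of its points, with the diameter as
        radius.\<close>
      have "\<exists>V\<in>sets borel. U n \<inter> (A k - N) \<subseteq> V \<and>
          emeasure \<nu> V \<le> ennreal (2 powr t) * diam_pow s' (U n)" for n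
      proof (cases "U n \<inter> (A k - N) = {}")
        case True
        then show ?thesis by (intro bexI[of _ "{}"]) auto
      next
        case False
        then obtain x where x: "x \<in> U n" "x \<in> A k" by auto
        let ?d = "diameter (U n)"
        have sub: "U n \<subseteq> cball x ?d"
          using diameter_bounded_bound[OF U(2)] x by auto
        have "?d \<le> \<delta>" by (rule U)
        have "0 \<le> ?d" using diameter_ge_0[OF U(2)] .
        have small: "measure \<nu> (cball x ((1/2) ^ m)) \<le> ((1/2) ^ m) powr t" if "k \<le> m" for m
          using x that by (auto simp: A_def)
        have "emeasure \<nu> (cball x ?d) \<le> ennreal (2 powr t) * diam_pow s' (U n)"
        proof (cases "?d = 0")
          case True
          have "measure \<nu> (cball x ?d) \<le> 0"
          proof (rule LIMSEQ_le_const)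
            have "(\<lambda>m. ((1/2) powr t) ^ m) \<longlonglongrightarrow> 0"
              using half_powr_less_1[OF t(3)] by (intro LIMSEQ_power_zero) auto
            then show "(\<lambda>m. ((1/2::real) ^ m) powr t) \<longlonglongrightarrow> 0" by (simp only: half_powr)
            have "measure \<nu> (cball x ?d) \<le> ((1/2) ^ m) powr t" if "k \<le> m" for m
              using small[OF that] True \<nu>
              by (intro order_trans[OF finite_measure_mono[of "cball x ?d" "cball x ((1/2) ^ m)"]]) auto
            then show "\<exists>M. \<forall>m\<ge>M. measure \<nu> (cball x ?d) \<le> ((1/2) ^ m) powr t" by auto
          qed
          then show ?thesis by (simp add: emeasure_eq_measure measure_le_0_iff)
        next
          case False
          then have "0 < ?d" using \<open>0 \<le> ?d\<close> by simp
          have "\<exists>m. (1/2::real) ^ m < ?d" using real_arch_pow_inv[OF \<open>0 < ?d\<close>, of "1/2"] by simp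
          define m where "m = (LEAST m. (1/2::real) ^ m < ?d)"
          have m: "(1/2::real) ^ m < ?d" unfolding m_def by (rule LeastI_ex) fact
          have "(1/2::real) ^ m < (1/2) ^ Suc k" using m \<open>?d \<le> \<delta>\<close> unfolding \<delta>_def by (rule less_le_trans)
          then have "\<not> m \<le> Suc k" using power_decreasing[of m "Suc k" "1/2::real"] by (auto simp del: power_Suc)
          then have "Suc k < m" by simp
          then obtain j where j: "m = Suc j" "k \<le> j" by (cases m) auto
          have "\<not> (1/2::real) ^ j < ?d" using not_less_Least[of j "\<lambda>m. (1/2::real) ^ m < ?d"] j by (simp add: m_def)
          then have "?d \<le> (1/2) ^ j" by simp
          have "measure \<nu> (cball x ?d) \<le> measure \<nu> (cball x ((1/2) ^ j))"
            using \<open>?d \<le> (1/2) ^ j\<close> \<nu> by (intro finite_measure_mono) auto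
          also have "\<dots> \<le> ((1/2) ^ j) powr t" by (rule small[OF j(2)])
          also have "\<dots> \<le> (2 * ?d) powr t"
            using m j t by (intro powr_mono2) auto
          also have "\<dots> = 2 powr t * ?d powr t" using \<open>0 < ?d\<close> by (simp add: powr_mult)
          also have "?d powr t \<le> ?d powr s'"
            using \<open>0 < ?d\<close> \<open>?d \<le> \<delta>\<close> t power_le_one[of "1/2::real" "Suc k"] unfolding \<delta>_def
            by (intro powr_mono') auto
          finally have "measure \<nu> (cball x ?d) \<le> 2 powr t * ?d powr s'" by simp
          then have "emeasure \<nu> (cball x ?d) \<le> ennreal (2 powr t * ?d powr s')"
            by (simp add: emeasure_eq_measure ennreal_leI)
          then show ?thesis
            using x \<open>0 < ?d\<close> by (cases "s' = 0") (auto simp: diam_pow_def ennreal_mult')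
        qed
        then show ?thesis using sub by (intro bexI[of _ "cball x ?d"]) auto
      qed
      then obtain V where V: "\<And>n. V n \<in> sets borel" "\<And>n. U n \<inter> (A k - N) \<subseteq> V n"
          "\<And>n. emeasure \<nu> (V n) \<le> ennreal (2 powr t) * diam_pow s' (U n)" by metis
      have "ennreal (measure \<nu> (A k)) = emeasure \<nu> (A k - N)"
        using emeasure_Diff_null_set[OF N(1) A_sets] emeasure_eq_measure by simp
      also have "\<dots> \<le> emeasure \<nu> (\<Union>n. V n)"
      proof (rule emeasure_mono)
        show "A k - N \<subseteq> (\<Union>n. V n)"
        proof
          fix x assume x: "x \<in> A k - N"
          then have "x \<in> E" using N(2) space by blast
          then obtain n where "x \<in> U n" using U(1) by blast
          then show "x \<in> (\<Union>n. V n)" using V(2)[of n] x by blast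
        qed
      qed (use V \<nu> in auto)
      also have "\<dots> \<le> (\<Sum>n. emeasure \<nu> (V n))"
        using V \<nu> by (intro emeasure_subadditive_countably) auto
      also have "\<dots> \<le> (\<Sum>n. ennreal (2 powr t) * diam_pow s' (U n))"
        by (intro suminf_le V) auto
      also have "\<dots> = ennreal (2 powr t) * (\<Sum>n. diam_pow s' (U n))"
        by (rule ennreal_suminf_cmult)
      finally have "ennreal (measure \<nu> (A k)) \<le> ennreal (2 powr t) * (\<Sum>n. diam_pow s' (U n))" .
      then have "ennreal (1 / 2 powr t) * ennreal (measure \<nu> (A k)) \<le>
          ennreal (1 / 2 powr t) * (ennreal (2 powr t) * (\<Sum>n. diam_pow s' (U n)))"
        by (rule mult_left_mono) simp
      also have "\<dots> = (\<Sum>n. diam_pow s' (U n))"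
        by (simp add: mult.assoc[symmetric] ennreal_mult'[symmetric])
      finally show ?thesis by (simp add: ennreal_mult'[symmetric])
    qed
    have "ennreal (measure \<nu> (A k) / 2 powr t) \<le> hausdorff_pre s' \<delta> E"
      unfolding hausdorff_pre_def by (rule INF_greatest) (use lower in auto)
    also have "\<dots> = 0" using null \<open>0 < \<delta>\<close> by (simp add: hausdorff_measure_null_iff)
    finally show False using k by (simp add: divide_le_0_iff)
  qed
  then show ?thesis using \<open>E \<noteq> {}\<close>
    by (auto simp: hausdorff_dim_def intro!: Inf_greatest)
qed

section \<open>Bounds for the spectrum\<close>

context self_similar
begin

lemma self_similar_W_1: "self_similar_measure l \<phi> (W 1) \<mu>"
proof -
  have "(\<Sum>i=1..l. W 1 i * f i) = (\<Sum>i=1..l. p i * f i)" for f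
    by (intro sum.cong refl) (simp only: W_1)
  then show ?thesis using ssm by (simp add: self_similar_measure_def)
qed

lemma supp_iff: "x \<in> supp \<mu> \<longleftrightarrow> (\<forall>\<rho>>0. 0 < mass x \<rho>)"
  by (rule supp_iff_cball[OF finite_measure_axioms sets_\<mu>])

text \<open>At \<open>q = 1\<close> the tilted weights are \<open>p\<close>, so \<mu> itself serves
  as \<nu> in the lower mass bound, and almost every point is in the support.\<close>

lemma supp_nonempty: "supp \<mu> \<noteq> {}"
proof -
  have "AE x in \<mu>. x \<in> supp \<mu>"
    using AE_lower_mass_bound[OF self_similar_W_1 zero_less_one]
  proof eventually_elim
    case (elim x)
    have "\<forall>\<^sub>F n in sequentially. 0 < mass x ((1/2) ^ n)"
      using elim
    proof eventually_elim
      case (elim n)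
      have "0 < ((1/2::real) ^ n) powr (dT 1 + 1)" by simp
      then show ?case using elim by linarith
    qed
    then show ?case by (rule supp_half_powerI[OF finite_measure_axioms sets_\<mu>])
  qed
  then show ?thesis using AE_False by (metis AE_cong empty_iff)
qed

lemma supp_subset: "supp \<mu> \<subseteq> cball 0 rad"
proof
  fix x assume x: "x \<in> supp \<mu>"
  show "x \<in> cball 0 rad"
  proof (rule ccontr)
    assume "x \<notin> cball 0 rad"
    moreover have "open (- cball (0 :: real ^ 'n) rad)" by (intro open_Compl closed_cball)
    ultimately obtain e where e: "0 < e" "cball x e \<subseteq> - cball 0 rad"
      by (meson ComplI open_contains_cball)
    then have "0 < mass x e" using x supp_iff by blast
    then have "cball x e \<inter> cball 0 rad \<noteq> {}" by (rule meets_rad) simp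
    then show False using e by auto
  qed
qed

text \<open>Finitely many balls of radius \<open>\<rho> / 2\<close> about points of the support
  cover it, and each ball of radius \<rho> about a support point contains one of them. This uniform
  bound keeps \<open>Theta\<close> finite for negative exponents.\<close>

lemma mass_lower_bound:
  assumes "0 < \<rho>"
  obtains m where "0 < m" "\<And>x. x \<in> supp \<mu> \<Longrightarrow> m \<le> mass x \<rho>"
proof -
  have "0 < \<rho> / 4" "0 \<le> rad" using assms rad_ge_1 by auto
  then obtain P where P: "P \<subseteq> supp \<mu>" "packing (\<rho> / 4) P" "supp \<mu> \<subseteq> (\<Union>c\<in>P. cball c (2 * (\<rho> / 4)))"
    using maximal_packing[OF supp_subset] by metis
  then have "P \<noteq> {}" using supp_nonempty by auto
  define m where "m = Min ((\<lambda>c. mass c (\<rho> / 2)) ` P)"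
  have "0 < m" unfolding m_def
    using P \<open>P \<noteq> {}\<close> assms by (subst Min_gr_iff) (auto simp: supp_iff)
  moreover have "m \<le> mass x \<rho>" if "x \<in> supp \<mu>" for x
  proof -
    have "x \<in> (\<Union>c\<in>P. cball c (2 * (\<rho> / 4)))" using P(3) that by blast
    then obtain c where c: "c \<in> P" "dist c x \<le> \<rho> / 2" by auto
    have "m \<le> mass c (\<rho> / 2)" unfolding m_def using c P by (intro Min_le) auto
    also have "\<dots> \<le> mass x \<rho>"
    proof (rule measure_mono)
      show "cball c (\<rho> / 2) \<subseteq> cball x \<rho>"
      proof
        fix y assume "y \<in> cball c (\<rho> / 2)"
        then show "y \<in> cball x \<rho>" using c(2) dist_triangle[of x y c] by (simp add: dist_commute)
      qed
    qed simp
    finally show ?thesis .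
  qed
  ultimately show ?thesis using that by blast
qed

lemma supp_packing_card:
  assumes "packing \<rho> C" "C \<subseteq> supp \<mu>" "0 < \<rho>"
  shows "real (card C) \<le> ((rad + 2 * \<rho>) / \<rho>) ^ CARD('n)"
proof -
  have "{x \<in> C. 0 < mass x \<rho>} = C"
    using assms supp_iff by blast
  then show ?thesis using charged_packing_card[of C \<rho>] assms by auto
qed

lemma Theta_bdd:
  assumes "0 < \<rho>"
  shows "bdd_above ((\<lambda>C. \<Sum>x\<in>C. mass x \<rho> powr q) `
    {C. finite C \<and> C \<subseteq> supp \<mu> \<and> disjoint_family_on (\<lambda>x. cball x \<rho>) C})"
proof -
  obtain m where m: "0 < m" "\<And>x. x \<in> supp \<mu> \<Longrightarrow> m \<le> mass x \<rho>"
    using mass_lower_bound[OF assms] by metis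
  \<comment> \<open>The summand 1 bounds the powers for \<open>q \<ge> 0\<close>, the summand
    \<open>m powr q\<close> those for negative \<open>q\<close>.\<close>
  have "(\<Sum>x\<in>C. mass x \<rho> powr q) \<le> ((rad + 2 * \<rho>) / \<rho>) ^ CARD('n) * (1 + m powr q)"
    if C: "packing \<rho> C" "C \<subseteq> supp \<mu>" for C
  proof -
    have "mass x \<rho> powr q \<le> 1 + m powr q" if "x \<in> C" for x
    proof (cases "0 \<le> q")
      case True
      then have "mass x \<rho> powr q \<le> 1" by (intro powr_le1) auto
      then show ?thesis using powr_ge_zero[of m q] by linarith
    next
      case False
      then have "mass x \<rho> powr q \<le> m powr q"
        using m that C by (intro powr_mono2') auto
      then show ?thesis by simp
    qed
    then have "(\<Sum>x\<in>C. mass x \<rho> powr q) \<le> real (card C) * (1 + m powr q)"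
      by (rule sum_bounded_above)
    also have "\<dots> \<le> ((rad + 2 * \<rho>) / \<rho>) ^ CARD('n) * (1 + m powr q)"
      using supp_packing_card[OF C assms] by (intro mult_right_mono) (auto simp: add_nonneg_nonneg)
    finally show ?thesis .
  qed
  then show ?thesis by (auto intro!: bdd_aboveI2)
qed

lemma Theta_upper:
  "0 < \<rho> \<Longrightarrow> packing \<rho> C \<Longrightarrow> C \<subseteq> supp \<mu> \<Longrightarrow> (\<Sum>x\<in>C. mass x \<rho> powr q) \<le> Theta \<mu> q \<rho>"
  unfolding Theta_def by (rule cSUP_upper[OF _ Theta_bdd]) auto

lemma Theta_least:
  assumes "\<And>C. packing \<rho> C \<Longrightarrow> C \<subseteq> supp \<mu> \<Longrightarrow> (\<Sum>x\<in>C. mass x \<rho> powr q) \<le> K"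
  shows "Theta \<mu> q \<rho> \<le> K"
  unfolding Theta_def
  by (rule cSUP_least) (use assms in \<open>auto simp: disjoint_family_on_def\<close>)

lemma Theta_pos:
  assumes "0 < \<rho>"
  shows "0 < Theta \<mu> q \<rho>"
proof -
  obtain x where x: "x \<in> supp \<mu>" using supp_nonempty by auto
  then have "0 < (\<Sum>x\<in>{x}. mass x \<rho> powr q)"
    using assms supp_iff[of x] by (auto simp: less_imp_neq[THEN not_sym])
  also have "\<dots> \<le> Theta \<mu> q \<rho>"
    using assms x by (intro Theta_upper) (auto simp: disjoint_family_on_def)
  finally show ?thesis .
qed

lemma Theta_le_packing_sum:
  assumes "packing_sum \<mu> q \<rho> \<le> ennreal K" "0 \<le> K"
  shows "Theta \<mu> q \<rho> \<le> K"
  by (rule Theta_least, rule packing_sum_leD[OF assms])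

lemma Lq_spectrum_ge:
  assumes "0 < C" "0 < a" and le: "\<And>\<rho>. 0 < \<rho> \<Longrightarrow> \<rho> \<le> a \<Longrightarrow> Theta \<mu> q \<rho> \<le> C * \<rho> powr t"
  shows "ereal t \<le> Lq_spectrum \<mu> q"
proof -
  let ?g = "\<lambda>\<rho>. t + ln C / ln \<rho>"
  have "((\<lambda>\<rho>. ln C / ln \<rho>) \<longlongrightarrow> 0) (at_right 0)"
    by (intro tendsto_divide_0[OF tendsto_const] filterlim_at_bot_imp_at_infinity ln_at_0)
  then have "(?g \<longlongrightarrow> t + 0) (at_right 0)" by (intro tendsto_intros)
  then have "((\<lambda>\<rho>. ereal (?g \<rho>)) \<longlongrightarrow> ereal t) (at_right 0)" by simp
  then have "ereal t = Liminf (at_right 0) (\<lambda>\<rho>. ereal (?g \<rho>))"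
    by (intro lim_imp_Liminf[symmetric]) auto
  also have "\<dots> \<le> Lq_spectrum \<mu> q"
    unfolding Lq_spectrum_def
  proof (rule Liminf_mono)
    have "\<forall>\<^sub>F \<rho> in at_right (0::real). 0 < \<rho> \<and> \<rho> < 1 \<and> \<rho> < a"
      using \<open>0 < a\<close> by (auto simp: eventually_at_right_field intro!: exI[of _ "min 1 a"])
    then show "\<forall>\<^sub>F \<rho> in at_right 0. ereal (?g \<rho>) \<le> ereal (ln (Theta \<mu> q \<rho>) / ln \<rho>)"
    proof eventually_elim
      case (elim \<rho>)
      have "ln (Theta \<mu> q \<rho>) \<le> ln (C * \<rho> powr t)"
        using elim le[of \<rho>] Theta_pos[of \<rho> q] \<open>0 < C\<close> by (subst ln_le_cancel_iff) auto
      also have "\<dots> = ln C + t * ln \<rho>"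
        using elim \<open>0 < C\<close> by (simp add: ln_mult ln_powr)
      finally have "ln (Theta \<mu> q \<rho>) \<le> ?g \<rho> * ln \<rho>"
        using elim by (simp add: distrib_right)
      then show ?case using elim by (simp add: neg_le_divide_eq)
    qed
  qed
  finally show ?thesis .
qed

lemma Lq_spectrum_ge_T:
  assumes "0 \<le> q" "q \<le> 1"
  shows "ereal (T q) \<le> Lq_spectrum \<mu> q"
proof -
  obtain C where C: "0 < C" "\<And>\<rho>. 0 < \<rho> \<Longrightarrow> \<rho> \<le> 1 \<Longrightarrow> packing_sum \<mu> q \<rho> \<le> ennreal (C * \<rho> powr T q)"
    using packing_sum_le_T[OF assms] by metis
  then show ?thesis
    by (intro Lq_spectrum_ge[OF C(1) zero_less_one] Theta_le_packing_sum) (auto simp: less_imp_le)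
qed

text \<open>Hoelder's inequality between \<open>q1\<close> and \<open>0\<close>, where the sum is the number of balls, which is at
  most of order \<open>\<rho> powr (- d)\<close>.\<close>

lemma Lq_spectrum_ge_chord:
  assumes q: "0 \<le> q" "q \<le> q1" "0 < q1" "q1 \<le> 1"
  shows "ereal (q * (real CARD('n) + T q1) / q1 - real CARD('n)) \<le> Lq_spectrum \<mu> q"
proof -
  let ?d = "real CARD('n)"
  let ?t = "q * (?d + T q1) / q1 - ?d"
  obtain C where C: "0 < C" "\<And>\<rho>. 0 < \<rho> \<Longrightarrow> \<rho> \<le> 1 \<Longrightarrow> packing_sum \<mu> q1 \<rho> \<le> ennreal (C * \<rho> powr T q1)"
    using packing_sum_le_T[of q1] q by (metis less_imp_le)
  define D where "D = (rad + 2) ^ CARD('n)"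
  have "0 < D" using rad_ge_1 by (simp add: D_def)
  define K where "K = D powr (1 - q / q1) * C powr (q / q1)"
  have "0 < K" using \<open>0 < D\<close> C by (simp add: K_def)
  show ?thesis
  proof (rule Lq_spectrum_ge[OF \<open>0 < K\<close> zero_less_one], rule Theta_least)
    fix \<rho> :: real and P :: "(real ^ 'n) set"
    assume \<rho>: "0 < \<rho>" "\<rho> \<le> 1" and P: "packing \<rho> P" "P \<subseteq> supp \<mu>"
    have card: "real (card P) \<le> D * \<rho> powr (- ?d)"
    proof -
      have "real (card P) \<le> (rad + 2) ^ DIM(real ^ 'n) * \<rho> powr (- real DIM(real ^ 'n))"
        using P \<rho> rad_ge_1 supp_subset by (intro packing_card_le_powr) force+
      then show ?thesis by (simp add: D_def)
    qed
    have "(\<Sum>x\<in>P. mass x \<rho> powr q) \<le>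
        real (card P) powr (1 - q / q1) * (\<Sum>x\<in>P. mass x \<rho> powr q1) powr (q / q1)"
    proof (cases "q = 0")
      case True
      have "0 < (\<Sum>x\<in>P. mass x \<rho> powr q1)" if "P \<noteq> {}"
        using that P \<rho> supp_iff by (intro sum_pos) (auto simp: subset_iff less_imp_neq[THEN not_sym])
      moreover have "(\<Sum>x\<in>P. mass x \<rho> powr 0) = (\<Sum>x\<in>P. 1)"
        using P(2) \<rho>(1) supp_iff by (intro sum.cong refl) force
      ultimately show ?thesis using True P by (cases "P = {}") (auto simp: less_imp_neq[THEN not_sym])
    next
      case False
      then show ?thesis using P q by (intro sum_powr_le_card_powr) auto
    qed
    also have "\<dots> \<le> (D * \<rho> powr (- ?d)) powr (1 - q / q1) * (C * \<rho> powr T q1) powr (q / q1)"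
    proof (intro mult_mono powr_mono2 card)
      show "(\<Sum>x\<in>P. mass x \<rho> powr q1) \<le> C * \<rho> powr T q1"
        using C \<rho> P(1) by (intro packing_sum_leD) auto
    qed (use q in \<open>auto intro!: sum_nonneg simp: pos_divide_le_eq\<close>)
    also have "\<dots> = K * (\<rho> powr (- ?d * (1 - q / q1)) * \<rho> powr (T q1 * (q / q1)))"
      using \<open>0 < D\<close> C by (simp add: K_def powr_mult powr_powr)
    also have "\<dots> = K * \<rho> powr (- ?d * (1 - q / q1) + T q1 * (q / q1))"
      by (simp only: powr_add)
    also have "- ?d * (1 - q / q1) + T q1 * (q / q1) = ?t"
      using q by (simp add: field_simps)
    finally show "(\<Sum>x\<in>P. mass x \<rho> powr q) \<le> K * \<rho> powr ?t" .
  qed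
qed

text \<open>A measure \<open>\<nu>\<close> of dimension \<open>s\<close> carried by \<open>level_set \<mu> \<alpha>\<close> forces about \<open>\<rho> powr (- s)\<close>
  disjoint balls of mass about \<open>\<rho> powr \<alpha>\<close>.\<close>

lemma Lq_spectrum_le:
  fixes \<nu> :: "(real ^ 'n) measure"
  assumes \<nu>: "prob_space \<nu>" "sets \<nu> = sets borel"
    and level: "AE x in \<nu>. has_local_dim \<mu> x \<alpha>" and dim: "has_measure_dim \<nu> s"
  shows "Lq_spectrum \<mu> q \<le> ereal (q * \<alpha> - s)"
proof (rule ccontr)
  interpret N: prob_space \<nu> by fact
  assume "\<not> Lq_spectrum \<mu> q \<le> ereal (q * \<alpha> - s)"
  then obtain t where t: "ereal (q * \<alpha> - s) < ereal t" "ereal t < Lq_spectrum \<mu> q"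
    using ereal_dense2 by (metis not_le)
  \<comment> \<open>The total error is \<open>\<bar>q\<bar> * \<epsilon>\<close> from the masses and
    \<epsilon> from the number of balls. This choice makes it half of the gap, so the exponent
    \<open>u\<close> reached stays below \<open>t\<close>.\<close>
  define \<epsilon> where "\<epsilon> = (t - (q * \<alpha> - s)) / (2 * (\<bar>q\<bar> + 1))"
  have "0 < \<epsilon>" using t by (simp add: \<epsilon>_def)
  define u where "u = q * \<alpha> - s + \<epsilon> * (\<bar>q\<bar> + 1)"
  have "2 * (\<epsilon> * (\<bar>q\<bar> + 1)) = t - (q * \<alpha> - s)" by (simp add: \<epsilon>_def field_simps)
  then have "u < t" using t by (simp add: u_def)
  define \<rho> where "\<rho> n = (1/2 :: real) ^ n" for n
  have \<rho>: "0 < \<rho> n" for n by (simp add: \<rho>_def)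
  define A where "A k = {x \<in> cball 0 rad. \<forall>n\<ge>k. \<rho> n powr (\<alpha> + \<epsilon>) \<le> mass x (\<rho> n) \<and>
      mass x (\<rho> n) \<le> \<rho> n powr (\<alpha> - \<epsilon>) \<and>
      measure \<nu> (cball x (2 * \<rho> n)) \<le> (2 * \<rho> n) powr (s - \<epsilon>)}" for k
  note [measurable] = measurable_measure_cball[OF N.finite_measure_axioms \<nu>(2)]
  have A_sets: "A k \<in> sets \<nu>" for k
    unfolding \<nu>(2) A_def by measurable
  have "AE x in \<nu>. \<exists>k. x \<in> A k"
    using level dim[unfolded has_measure_dim_def]
  proof eventually_elim
    case (elim x)
    have "x \<in> cball 0 rad" using elim supp_subset by (auto simp: has_local_dim_def)
    have "\<forall>\<^sub>F n in sequentially. \<rho> n powr (\<alpha> + \<epsilon>) \<le> mass x (\<rho> n) \<and>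
        mass x (\<rho> n) \<le> \<rho> n powr (\<alpha> - \<epsilon>)"
      using eventually_half_power[OF has_local_dim_bounds[OF finite_measure_axioms sets_\<mu> elim(1) \<open>0 < \<epsilon>\<close>], of 1]
      by (simp add: \<rho>_def)
    moreover have "\<forall>\<^sub>F n in sequentially. measure \<nu> (cball x (2 * \<rho> n)) \<le> (2 * \<rho> n) powr (s - \<epsilon>)"
      using eventually_half_power[OF has_local_dim_bounds[OF N.finite_measure_axioms \<nu>(2) elim(2) \<open>0 < \<epsilon>\<close>], of 2]
      by (auto simp: \<rho>_def elim: eventually_mono)
    ultimately have "\<forall>\<^sub>F n in sequentially. \<rho> n powr (\<alpha> + \<epsilon>) \<le> mass x (\<rho> n) \<and>
        mass x (\<rho> n) \<le> \<rho> n powr (\<alpha> - \<epsilon>) \<and>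
        measure \<nu> (cball x (2 * \<rho> n)) \<le> (2 * \<rho> n) powr (s - \<epsilon>)"
      by eventually_elim auto
    then show ?case using \<open>x \<in> cball 0 rad\<close> by (auto simp: A_def eventually_sequentially)
  qed
  then obtain k where k: "0 < measure \<nu> (A k)" using N.AE_ex_positive[of A] A_sets by blast
  define c where "c = measure \<nu> (A k) / 2 powr (s - \<epsilon>)"
  have "0 < c" using k by (simp add: c_def)
  have lower: "c * \<rho> n powr u \<le> Theta \<mu> q (\<rho> n)" if "k \<le> n" for n
  proof -
    have A_bounds: "\<rho> n powr (\<alpha> + \<epsilon>) \<le> mass x (\<rho> n)"
        "mass x (\<rho> n) \<le> \<rho> n powr (\<alpha> - \<epsilon>)"
        "measure \<nu> (cball x (2 * \<rho> n)) \<le> (2 * \<rho> n) powr (s - \<epsilon>)" if "x \<in> A k" for x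
      using that \<open>k \<le> n\<close> by (auto simp: A_def)
    have sub: "A k \<subseteq> cball 0 rad" by (auto simp: A_def)
    obtain P where P: "P \<subseteq> A k" "packing (\<rho> n) P" "A k \<subseteq> (\<Union>c\<in>P. cball c (2 * \<rho> n))"
      by (rule maximal_packing[OF sub \<rho>]) (use rad_ge_1 in auto)
    have "measure \<nu> (A k) \<le> real (card P) * (2 * \<rho> n) powr (s - \<epsilon>)"
      using P A_bounds by (intro measure_le_cover[OF N.finite_measure_axioms \<nu>(2) _ P(3)]) auto
    also have "\<dots> = real (card P) * \<rho> n powr (s - \<epsilon>) * 2 powr (s - \<epsilon>)"
      using \<rho> by (simp add: powr_mult mult_ac)
    finally have "c \<le> real (card P) * \<rho> n powr (s - \<epsilon>)"
      by (simp add: c_def pos_divide_le_eq)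
    then have "c * \<rho> n powr u \<le> real (card P) * \<rho> n powr (s - \<epsilon>) * \<rho> n powr u"
      by (rule mult_right_mono) simp
    also have "\<dots> = real (card P) * \<rho> n powr (q * \<alpha> + \<epsilon> * \<bar>q\<bar>)"
      by (simp add: u_def mult.assoc powr_add[symmetric] algebra_simps)
    also have "\<dots> = (\<Sum>x\<in>P. \<rho> n powr (q * \<alpha> + \<epsilon> * \<bar>q\<bar>))" by simp
    also have "\<dots> \<le> (\<Sum>x\<in>P. mass x (\<rho> n) powr q)"
    proof (rule sum_mono)
      fix x assume "x \<in> P"
      then have x: "x \<in> A k" using P by auto
      show "\<rho> n powr (q * \<alpha> + \<epsilon> * \<bar>q\<bar>) \<le> mass x (\<rho> n) powr q"
      \<comment> \<open>The sign of \<open>q\<close> decides which of the two mass bounds is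
        used.\<close>
      proof (cases "0 \<le> q")
        case True
        then have "(\<rho> n powr (\<alpha> + \<epsilon>)) powr q \<le> mass x (\<rho> n) powr q"
          using A_bounds[OF x] by (intro powr_mono2) auto
        then show ?thesis using True by (simp add: powr_powr algebra_simps)
      next
        case False
        have "0 < \<rho> n powr (\<alpha> + \<epsilon>)" using \<rho>[of n] by simp
        then have "0 < mass x (\<rho> n)" using A_bounds(1)[OF x] by linarith
        then have "(\<rho> n powr (\<alpha> - \<epsilon>)) powr q \<le> mass x (\<rho> n) powr q"
          using A_bounds[OF x] False by (intro powr_mono2') auto
        then show ?thesis using False by (simp add: powr_powr algebra_simps)
      qed
    qed
    also have "\<dots> \<le> Theta \<mu> q (\<rho> n)"
    proof (rule Theta_upper[OF \<rho> P(2)])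
      show "P \<subseteq> supp \<mu>"
      proof
        fix x assume "x \<in> P"
        then have x: "x \<in> A k" using P by auto
        have "0 < mass x ((1/2) ^ n)" if "k \<le> n" for n
        proof -
          have "0 < \<rho> n powr (\<alpha> + \<epsilon>)" using \<rho>[of n] by simp
          also have "\<dots> \<le> mass x (\<rho> n)" using x that by (auto simp: A_def)
          finally show ?thesis by (simp add: \<rho>_def)
        qed
        then show "x \<in> supp \<mu>"
          by (intro supp_half_powerI[OF finite_measure_axioms sets_\<mu>] eventually_sequentiallyI)
      qed
    qed
    finally show ?thesis .
  qed
  \<comment> \<open>A lower limit above \<open>t\<close> bounds \<open>Theta\<close> at all small
    scales, so the lower bound along powers of 1/2 suffices for a contradiction.\<close>
  have "\<forall>\<^sub>F e in at_right 0. ereal t < ereal (ln (Theta \<mu> q e) / ln e)"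
    using less_LiminfD[OF t(2)[unfolded Lq_spectrum_def]] .
  moreover have "\<forall>\<^sub>F e in at_right (0::real). 0 < e \<and> e < 1"
    by (auto simp: eventually_at_right_field intro!: exI[of _ 1])
  ultimately have "\<forall>\<^sub>F e in at_right 0. Theta \<mu> q e < e powr t"
  proof eventually_elim
    case (elim e)
    then have "ln (Theta \<mu> q e) < t * ln e" by (simp add: neg_less_divide_eq)
    also have "\<dots> = ln (e powr t)" using elim by (simp add: ln_powr)
    finally have "ln (Theta \<mu> q e) < ln (e powr t)" .
    then show ?case using elim Theta_pos[of e q] by (subst (asm) ln_less_cancel_iff) auto
  qed
  from eventually_half_power[OF this, of 1]
  have "\<forall>\<^sub>F n in sequentially. Theta \<mu> q (\<rho> n) < \<rho> n powr t" by (simp add: \<rho>_def)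
  moreover have "(\<lambda>n. ((1/2) powr (t - u)) ^ n) \<longlonglongrightarrow> 0"
    using \<open>u < t\<close> half_powr_less_1[of "t - u"] by (intro LIMSEQ_power_zero) auto
  then have "\<forall>\<^sub>F n in sequentially. ((1/2) powr (t - u)) ^ n < c"
    using \<open>0 < c\<close> by (rule order_tendstoD)
  moreover have "\<forall>\<^sub>F n in sequentially. k \<le> n" by (rule eventually_ge_at_top)
  ultimately have "\<forall>\<^sub>F n in sequentially. False"
  proof eventually_elim
    case (elim n)
    have "\<rho> n powr t = \<rho> n powr (t - u) * \<rho> n powr u" by (simp add: powr_add[symmetric])
    also have "\<dots> < c * \<rho> n powr u"
      using elim(2) \<rho>[of n] by (intro mult_strict_right_mono) (auto simp: \<rho>_def half_powr)
    also have "\<dots> \<le> Theta \<mu> q (\<rho> n)" by (rule lower[OF elim(3)])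
    finally show False using elim(1) by simp
  qed
  then show False by simp
qed

text \<open>On \<open>E k\<close> all masses at scales from \<open>k\<close> on are at least
  \<open>\<rho> n powr (\<alpha> + \<epsilon>)\<close>, so the packing sum bounds the number of
  balls in a maximal packing, and the doubled balls cover. Nonnegativity of
  \<open>q * \<alpha> - t\<close> matters because \<open>hausdorff_dim\<close> admits only
  nonnegative exponents.\<close>

lemma hausdorff_dim_level_set_le:
  assumes q: "0 \<le> q" and "0 < C"
    and packing: "\<And>\<rho>. 0 < \<rho> \<Longrightarrow> \<rho> \<le> 1 \<Longrightarrow> packing_sum \<mu> q \<rho> \<le> ennreal (C * \<rho> powr t)"
    and nonneg: "0 \<le> q * \<alpha> - t"
  shows "hausdorff_dim (level_set \<mu> \<alpha>) \<le> ereal (q * \<alpha> - t)"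
proof (cases "level_set \<mu> \<alpha> = {}")
  case False
  have null: "hausdorff_measure s (level_set \<mu> \<alpha>) = 0" if s: "q * \<alpha> - t < s" for s
    unfolding hausdorff_measure_null_iff
  proof (intro allI impI)
    fix \<delta> :: real assume "0 < \<delta>"
    \<comment> \<open>Chosen so that \<open>q * \<epsilon>\<close> is below the gap; the denominator
      \<open>q + 1\<close> also covers \<open>q = 0\<close>.\<close>
    define \<epsilon> where "\<epsilon> = (s - (q * \<alpha> - t)) / 2 / (q + 1)"
    have "0 < \<epsilon>" using s q by (simp add: \<epsilon>_def)
    define \<kappa> where "\<kappa> = s + t - q * (\<alpha> + \<epsilon>)"
    have "q * \<epsilon> < s - (q * \<alpha> - t)"
    proof -
      have cancel: "c * (x / 2 / c) = x / 2" if "c \<noteq> 0" for c x :: real using that by simp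
      have "(q + 1) * \<epsilon> = (s - (q * \<alpha> - t)) / 2" unfolding \<epsilon>_def by (rule cancel) (use q in simp)
      then have "q * \<epsilon> + \<epsilon> = (s - (q * \<alpha> - t)) / 2" by (simp only: distrib_right mult_1_left)
      moreover have "0 \<le> q * \<epsilon>" using q \<open>0 < \<epsilon>\<close> by simp
      moreover have "a < y" if "a + b = y / 2" "0 \<le> a" "0 < b" for a b y :: real using that by linarith
      ultimately show ?thesis using \<open>0 < \<epsilon>\<close> by blast
    qed
    then have "0 < \<kappa>" by (simp add: \<kappa>_def algebra_simps)
    define \<rho> where "\<rho> n = (1/2 :: real) ^ n" for n
    have \<rho>: "0 < \<rho> n" "\<rho> n \<le> 1" for n by (auto simp: \<rho>_def power_le_one)
    define E where "E k = {x \<in> level_set \<mu> \<alpha>. \<forall>n\<ge>k. \<rho> n powr (\<alpha> + \<epsilon>) \<le> mass x (\<rho> n)}" for k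
    have level_sub: "level_set \<mu> \<alpha> \<subseteq> cball 0 rad"
      using supp_subset by (auto simp: level_set_def has_local_dim_def)
    have "level_set \<mu> \<alpha> = (\<Union>k. E k)"
    proof
      show "level_set \<mu> \<alpha> \<subseteq> (\<Union>k. E k)"
      proof
        fix x assume x: "x \<in> level_set \<mu> \<alpha>"
        then have "has_local_dim \<mu> x \<alpha>" by (simp add: level_set_def)
        from eventually_half_power[OF has_local_dim_bounds[OF finite_measure_axioms sets_\<mu> this \<open>0 < \<epsilon>\<close>], of 1]
        have "\<forall>\<^sub>F n in sequentially. \<rho> n powr (\<alpha> + \<epsilon>) \<le> mass x (\<rho> n)"
          by (auto simp: \<rho>_def elim: eventually_mono)
        then show "x \<in> (\<Union>k. E k)" using x by (auto simp: E_def eventually_sequentially)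
      qed
    qed (auto simp: E_def)
    moreover have "hausdorff_pre s \<delta> (E k) = 0" for k
    proof -
      have le: "hausdorff_pre s \<delta> (E k) \<le> ennreal (C * 4 powr s * ((1/2) powr \<kappa>) ^ n)"
        if "k \<le> n" "4 * \<rho> n \<le> \<delta>" for n
      proof -
        have sub: "E k \<subseteq> cball 0 rad" using level_sub by (auto simp: E_def)
        obtain P where P: "P \<subseteq> E k" "packing (\<rho> n) P" "E k \<subseteq> (\<Union>c\<in>P. cball c (2 * \<rho> n))"
          by (rule maximal_packing[OF sub \<rho>(1)]) (use rad_ge_1 in auto)
        have "real (card P) * (\<rho> n powr (\<alpha> + \<epsilon>)) powr q = (\<Sum>x\<in>P. (\<rho> n powr (\<alpha> + \<epsilon>)) powr q)"
          by simp
        also have "\<dots> \<le> (\<Sum>x\<in>P. mass x (\<rho> n) powr q)"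
          using P q \<open>k \<le> n\<close> by (intro sum_mono powr_mono2) (auto simp: E_def)
        also have "\<dots> \<le> C * \<rho> n powr t"
          using packing[OF \<rho>] \<open>0 < C\<close> P(2) by (intro packing_sum_leD) auto
        finally have card: "real (card P) \<le> C * \<rho> n powr t / (\<rho> n powr (\<alpha> + \<epsilon>)) powr q"
          using \<rho>(1)[of n] by (simp add: pos_le_divide_eq)
        have "hausdorff_pre s \<delta> (E k) \<le> (\<Sum>c\<in>P. diam_pow s (cball c (2 * \<rho> n)))"
          using P \<rho>(1)[of n] that \<open>0 < \<delta>\<close> by (intro hausdorff_pre_le_finite_cover) (auto simp: diameter_cball)
        also have "\<dots> = (\<Sum>c\<in>P. ennreal ((4 * \<rho> n) powr s))"
        proof (rule sum.cong)
          fix c :: "real ^ 'n"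
          have "cball c (2 * \<rho> n) \<noteq> {}" using \<rho>(1)[of n] by (simp add: not_less less_imp_le)
          then show "diam_pow s (cball c (2 * \<rho> n)) = ennreal ((4 * \<rho> n) powr s)"
            using \<rho>(1)[of n] by (simp add: diam_pow_def diameter_cball)
        qed simp
        also have "\<dots> = ennreal (real (card P) * (4 * \<rho> n) powr s)"
          by (simp add: ennreal_mult' ennreal_of_nat_eq_real_of_nat)
        also have "\<dots> \<le> ennreal (C * \<rho> n powr t / (\<rho> n powr (\<alpha> + \<epsilon>)) powr q * (4 * \<rho> n) powr s)"
          by (intro ennreal_leI mult_right_mono card) simp
        also have "C * \<rho> n powr t / (\<rho> n powr (\<alpha> + \<epsilon>)) powr q * (4 * \<rho> n) powr s =
            C * 4 powr s * \<rho> n powr \<kappa>"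
        proof -
          have "\<rho> n powr \<kappa> = \<rho> n powr s * \<rho> n powr t / \<rho> n powr ((\<alpha> + \<epsilon>) * q)"
            by (simp only: \<kappa>_def powr_diff powr_add mult.commute)
          then show ?thesis using \<rho>(1)[of n] by (simp add: powr_powr powr_mult)
        qed
        finally show ?thesis by (simp only: \<rho>_def half_powr)
      qed
      have "(\<lambda>n. ennreal (C * 4 powr s * ((1/2) powr \<kappa>) ^ n)) \<longlonglongrightarrow> ennreal (C * 4 powr s * 0)"
        using half_powr_less_1[OF \<open>0 < \<kappa>\<close>]
        by (intro tendsto_ennrealI tendsto_intros LIMSEQ_power_zero) auto
      moreover have "\<forall>\<^sub>F n in sequentially. hausdorff_pre s \<delta> (E k) \<le> ennreal (C * 4 powr s * ((1/2) powr \<kappa>) ^ n)"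
      proof -
        have "(\<lambda>n. 4 * (1/2::real) ^ n) \<longlonglongrightarrow> 4 * 0"
          by (intro tendsto_intros LIMSEQ_power_zero) simp
        then have "\<forall>\<^sub>F n in sequentially. 4 * \<rho> n < \<delta>"
          using \<open>0 < \<delta>\<close> unfolding \<rho>_def by (intro order_tendstoD) auto
        then show ?thesis using eventually_ge_at_top[of k] by eventually_elim (rule le, auto)
      qed
      ultimately have "hausdorff_pre s \<delta> (E k) \<le> ennreal (C * 4 powr s * 0)"
        by (intro tendsto_lowerbound) auto
      then show ?thesis by simp
    qed
    ultimately show "hausdorff_pre s \<delta> (level_set \<mu> \<alpha>) = 0"
      by (simp add: hausdorff_pre_UN_null)
  qed
  have "Inf (ereal ` {s. 0 \<le> s \<and> hausdorff_measure s (level_set \<mu> \<alpha>) = 0}) \<le> ereal (q * \<alpha> - t)"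
  proof (rule ereal_le_epsilon2)
    fix e :: real assume "0 < e"
    then show "Inf (ereal ` {s. 0 \<le> s \<and> hausdorff_measure s (level_set \<mu> \<alpha>) = 0}) \<le>
        ereal (q * \<alpha> - t) + ereal e"
      using null[of "q * \<alpha> - t + e"] nonneg by (intro Inf_lower) auto
  qed
  then show ?thesis using False by (simp add: hausdorff_dim_def)
qed (simp add: hausdorff_dim_def)

end

section \<open>The right derivative at 1\<close>

lemma similarity_compose:
  assumes "similarity s f" "similarity t g"
  shows "similarity (s * t) (f \<circ> g)"
proof -
  obtain U a where U: "0 < s" "orthogonal_matrix U" "\<And>x. f x = s *\<^sub>R (U *v x) + a"
    using assms(1) by (auto simp: similarity_def)
  obtain V b where V: "0 < t" "orthogonal_matrix V" "\<And>x. g x = t *\<^sub>R (V *v x) + b"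
    using assms(2) by (auto simp: similarity_def)
  have "(f \<circ> g) x = (s * t) *\<^sub>R ((U ** V) *v x) + (s *\<^sub>R (U *v b) + a)" for x
    by (simp add: U(3) V(3) matrix_vector_right_distrib matrix_vector_mul_assoc[symmetric]
        matrix_vector_mult_scaleR scaleR_add_right)
  then show ?thesis
    using U V orthogonal_matrix_mul[OF U(2) V(2)] unfolding similarity_def
    by (intro conjI exI[of _ "U ** V"] exI[of _ "s *\<^sub>R (U *v b) + a"]) auto
qed

lemma similarity_id: "similarity 1 id"
  unfolding similarity_def
  by (intro conjI exI[of _ "mat 1"] exI[of _ 0]) (auto simp: orthogonal_matrix_id)

context self_similar
begin

section \<open>Iterating self-similarity over words of comparable ratio\<close>

primrec word_map :: "nat list \<Rightarrow> real ^ 'n \<Rightarrow> real ^ 'n" where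
  "word_map [] = id"
| "word_map (i # u) = \<phi> i \<circ> word_map u"

definition word_ratio :: "nat list \<Rightarrow> real" where "word_ratio u = prod_list (map r u)"
definition word_weight :: "nat list \<Rightarrow> real" where "word_weight u = prod_list (map p u)"

text \<open>The words stopped as soon as their ratio is at most \<open>\<delta>\<close>. The first argument only bounds the
  recursion depth; it is large enough once \<open>rmax ^ n \<le> \<delta>\<close>.\<close>

primrec cut :: "nat \<Rightarrow> real \<Rightarrow> nat list set" where
  "cut 0 \<delta> = {[]}"
| "cut (Suc n) \<delta> = (if 1 \<le> \<delta> then {[]} else (\<Union>i\<in>{1..l}. (#) i ` cut n (\<delta> / r i)))"

lemma finite_cut: "finite (cut n \<delta>)"
  by (induct n arbitrary: \<delta>) auto

lemma cut_letters: "u \<in> cut n \<delta> \<Longrightarrow> set u \<subseteq> {1..l}"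
proof (induct n arbitrary: \<delta> u)
  case (Suc n)
  then show ?case by (auto split: if_splits) (metis Suc.hyps atLeastAtMost_iff subsetD)+
qed simp

lemma word_similarity: "set u \<subseteq> {1..l} \<Longrightarrow> similarity (word_ratio u) (word_map u)"
proof (induct u)
  case (Cons i u)
  then have "similarity (r i * word_ratio u) (\<phi> i \<circ> word_map u)"
    by (intro similarity_compose sim) auto
  then show ?case by (simp add: word_ratio_def comp_def)
qed (simp add: word_ratio_def similarity_id[unfolded id_def] id_def)

lemma measurable_word_map: "set u \<subseteq> {1..l} \<Longrightarrow> word_map u \<in> borel_measurable borel"
  by (rule borel_measurable_continuous_onI[OF similarity_continuous[OF word_similarity]])

lemma word_weight_nonneg: "set u \<subseteq> {1..l} \<Longrightarrow> 0 \<le> word_weight u"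
  by (induct u) (auto simp: word_weight_def p_pos less_imp_le)

text \<open>The last letter of a stopped word takes the ratio from above \<delta> to at most
  \<delta>, and this letter contracts by no more than \<open>rmin\<close>. The case
  \<open>1 \<le> \<delta>\<close> is where the recursion ends.\<close>

lemma cut_ratio:
  "rmax ^ n \<le> \<delta> \<Longrightarrow> u \<in> cut n \<delta> \<Longrightarrow>
    (1 \<le> \<delta> \<and> u = []) \<or> (\<delta> < 1 \<and> \<delta> * rmin \<le> word_ratio u \<and> word_ratio u \<le> \<delta>)"
proof (induct n arbitrary: \<delta> u)
  case (Suc n)
  show ?case
  proof (cases "1 \<le> \<delta>")
    case False
    then obtain i v where i: "i \<in> {1..l}" and u: "u = i # v" and v: "v \<in> cut n (\<delta> / r i)"
      using Suc.prems(2) by auto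
    have "0 < \<delta>" using Suc.prems(1) rmax_pos zero_less_power[of rmax "Suc n"] by linarith
    have "rmax ^ n * r i \<le> rmax ^ n * rmax"
      using r_le_rmax[OF i] rmax_pos by (intro mult_left_mono) auto
    then have "rmax ^ n \<le> \<delta> / r i"
      using Suc.prems(1) ratio_pos[OF i] by (simp add: pos_le_divide_eq mult.commute)
    from Suc.hyps[OF this v] show ?thesis
    proof (elim disjE conjE)
      assume "1 \<le> \<delta> / r i" "v = []"
      then have "word_ratio u = r i" "r i \<le> \<delta>"
        using u ratio_pos[OF i] by (auto simp: word_ratio_def)
      moreover have "\<delta> * rmin \<le> 1 * r i"
        using False \<open>0 < \<delta>\<close> rmin_pos rmin_le_r[OF i] by (intro mult_mono) auto
      ultimately show ?thesis using False by auto
    next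
      assume "\<delta> / r i * rmin \<le> word_ratio v" "word_ratio v \<le> \<delta> / r i"
      then have "\<delta> * rmin \<le> r i * word_ratio v" "r i * word_ratio v \<le> \<delta>"
        using ratio_pos[OF i] by (auto simp: field_simps)
      then show ?thesis using False u by (simp add: word_ratio_def)
    qed
  qed (use Suc.prems in auto)
qed simp

lemma nn_integral_cut:
  assumes "f \<in> borel_measurable borel"
  shows "(\<integral>\<^sup>+x. f x \<partial>\<mu>) =
    (\<Sum>u\<in>cut n \<delta>. ennreal (word_weight u) * (\<integral>\<^sup>+x. f (word_map u x) \<partial>\<mu>))"
  using assms
proof (induct n arbitrary: \<delta> f)
  case 0
  then show ?case by (simp add: word_weight_def)
next
  case (Suc n)
  show ?case
  proof (cases "1 \<le> \<delta>")
    case True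
    then show ?thesis by (simp add: word_weight_def)
  next
    case False
    have "(\<integral>\<^sup>+x. f x \<partial>\<mu>) = (\<Sum>i=1..l. ennreal (p i) * (\<integral>\<^sup>+x. f (\<phi> i x) \<partial>\<mu>))"
      by (rule nn_integral_\<mu>[OF Suc.prems])
    also have "\<dots> = (\<Sum>i=1..l. \<Sum>v\<in>cut n (\<delta> / r i).
        ennreal (word_weight (i # v)) * (\<integral>\<^sup>+x. f (word_map (i # v) x) \<partial>\<mu>))"
    proof (intro sum.cong refl)
      fix i assume i: "i \<in> {1..l}"
      have "(\<integral>\<^sup>+x. f (\<phi> i x) \<partial>\<mu>) = (\<Sum>v\<in>cut n (\<delta> / r i).
          ennreal (word_weight v) * (\<integral>\<^sup>+x. f (\<phi> i (word_map v x)) \<partial>\<mu>))"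
        by (rule Suc.hyps[OF measurable_compose[OF measurable_\<phi>[OF i] Suc.prems]])
      then show "ennreal (p i) * (\<integral>\<^sup>+x. f (\<phi> i x) \<partial>\<mu>) = (\<Sum>v\<in>cut n (\<delta> / r i).
          ennreal (word_weight (i # v)) * (\<integral>\<^sup>+x. f (word_map (i # v) x) \<partial>\<mu>))"
        using p_pos[OF i]
        by (simp add: word_weight_def sum_distrib_left ennreal_mult' mult.assoc)
    qed
    also have "\<dots> = (\<Sum>i=1..l. \<Sum>u\<in>(#) i ` cut n (\<delta> / r i).
        ennreal (word_weight u) * (\<integral>\<^sup>+x. f (word_map u x) \<partial>\<mu>))"
      by (rule sum.cong[OF refl]) (simp add: sum.reindex)
    also have "\<dots> = (\<Sum>u\<in>cut (Suc n) \<delta>. ennreal (word_weight u) * (\<integral>\<^sup>+x. f (word_map u x) \<partial>\<mu>))"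
      using False finite_cut by (simp, subst sum.UNION_disjoint) auto
    finally show ?thesis .
  qed
qed

lemma measure_cut:
  assumes "A \<in> sets borel"
  shows "measure \<mu> A = (\<Sum>u\<in>cut n \<delta>. word_weight u * measure \<mu> (word_map u -` A))"
proof -
  have "ennreal (measure \<mu> A) = (\<integral>\<^sup>+x. indicator A x \<partial>\<mu>)"
    using assms by (simp add: sets_\<mu> emeasure_eq_measure)
  also have "\<dots> = (\<Sum>u\<in>cut n \<delta>. ennreal (word_weight u) * (\<integral>\<^sup>+x. indicator A (word_map u x) \<partial>\<mu>))"
    using assms by (intro nn_integral_cut borel_measurable_indicator)
  also have "\<dots> = (\<Sum>u\<in>cut n \<delta>. ennreal (word_weight u * measure \<mu> (word_map u -` A)))"
  proof (intro sum.cong refl)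
    fix u assume u: "u \<in> cut n \<delta>"
    have "word_map u \<in> borel_measurable borel" by (rule measurable_word_map[OF cut_letters[OF u]])
    then have "word_map u -` A \<in> sets borel" using measurable_sets[of "word_map u" borel borel A] assms by simp
    moreover have "(\<integral>\<^sup>+x. indicator A (word_map u x) \<partial>\<mu>) = (\<integral>\<^sup>+x. indicator (word_map u -` A) x \<partial>\<mu>)"
      by (intro nn_integral_cong) (simp add: indicator_def)
    ultimately show "ennreal (word_weight u) * (\<integral>\<^sup>+x. indicator A (word_map u x) \<partial>\<mu>) =
        ennreal (word_weight u * measure \<mu> (word_map u -` A))"
      using word_weight_nonneg[OF cut_letters[OF u]]
      by (simp add: sets_\<mu> emeasure_eq_measure ennreal_mult')
  qed
  also have "\<dots> = ennreal (\<Sum>u\<in>cut n \<delta>. word_weight u * measure \<mu> (word_map u -` A))"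
    using word_weight_nonneg[OF cut_letters] by (subst sum_ennreal) auto
  finally show ?thesis
    by (rule ennreal_inj[THEN iffD1, rotated 2])
       (use word_weight_nonneg[OF cut_letters] in \<open>auto intro!: sum_nonneg mult_nonneg_nonneg\<close>)
qed

text \<open>Points of two cylinders that meet the same ball of radius at most \<delta> are each
  within \<open>\<delta> + 2 * rad * \<delta>\<close> of its centre; the sum of both distances is
  \<open>nbhd * \<delta>\<close>.\<close>

definition nbhd :: real where "nbhd = 2 + 4 * rad"

text \<open>For \<open>s = q - 1\<close> this is the correlation integral of order \<open>q\<close>,
  the continuous analogue of a packing sum.\<close>

definition moment :: "real \<Rightarrow> real \<Rightarrow> real" where
  "moment s \<rho> = (\<integral>x. mass x \<rho> powr s \<partial>\<mu>)"

lemma integrable_powr_cball: "0 \<le> s \<Longrightarrow> f \<in> borel_measurable borel \<Longrightarrow>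
    integrable \<mu> (\<lambda>x. mass (f x) \<rho> powr s)"
proof -
  assume s: "0 \<le> s" and f: "f \<in> borel_measurable borel"
  have "(\<lambda>x. mass (f x) \<rho> powr s) \<in> borel_measurable borel"
    using measurable_compose[OF f measurable_\<mu>_cball[of \<rho>]] by measurable
  then show ?thesis
    using s by (intro integrable_const_bound[where B = 1] meas_\<mu>) (auto intro!: powr_le1)
qed

text \<open>The weights of the cylinders meeting a small ball add up to at most the mass of a comparable ball
  about any point of any of these cylinders. Averaging \<open>q - 1\<close> powers over that point leaves the factor
  \<open>moment\<close> and no multiplicative constant; a constant would spoil the slope at \<open>q = 1\<close>.\<close>

lemma packing_sum_cut_step:
  assumes q: "1 \<le> q" and n: "rmax ^ n \<le> \<delta>" and \<delta>: "\<delta> < 1" and \<rho>: "\<rho> \<le> \<delta>"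
  defines "v \<equiv> \<lambda>u. \<integral>y. mass (word_map u y) (nbhd * \<delta>) powr (q - 1) \<partial>\<mu>"
  shows "packing_sum \<mu> q \<rho> \<le>
    (\<Sum>u\<in>cut n \<delta>. ennreal (word_weight u * v u) * packing_sum \<mu> q (\<rho> / word_ratio u))"
  unfolding packing_sum_def[of \<mu> q \<rho>]
proof (rule SUP_least, clarify)
  fix C :: "(real ^ 'n) set" assume C: "finite C" "disjoint_family_on (\<lambda>x. cball x \<rho>) C"
  let ?I = "cut n \<delta>" and ?w = word_weight
  let ?m = "\<lambda>u x. measure \<mu> (word_map u -` cball x \<rho>)"
  have u_sim: "similarity (word_ratio u) (word_map u)" "0 \<le> ?w u" "word_ratio u \<le> \<delta>"
    if "u \<in> ?I" for u
    using word_similarity[OF cut_letters[OF that]] word_weight_nonneg[OF cut_letters[OF that]]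
      cut_ratio[OF n that] \<delta> by auto
  have "0 \<le> \<delta>" using n rmax_pos zero_le_power[of rmax n] by linarith
  have v_nonneg: "0 \<le> v u" for u unfolding v_def by (intro integral_nonneg_AE) auto
  have close: "dist (word_map u y) x \<le> \<rho> + 2 * rad * \<delta>"
    if u: "u \<in> ?I" and y: "y \<in> cball 0 rad" and meet: "word_map u -` cball x \<rho> \<inter> cball 0 rad \<noteq> {}" for u x y
  proof -
    obtain z where z: "dist x (word_map u z) \<le> \<rho>" "z \<in> cball 0 rad" using meet by auto
    have "dist y z \<le> rad + rad" using y z dist_triangle2[of y z 0] by (auto simp: dist_commute)
    then have "word_ratio u * dist y z \<le> \<delta> * (2 * rad)"
      using u_sim(1,3)[OF u] similarity_pos[OF u_sim(1)[OF u]] \<open>0 \<le> \<delta>\<close> by (intro mult_mono) auto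
    then have "dist (word_map u y) (word_map u z) \<le> 2 * rad * \<delta>"
      by (simp add: similarity_dist[OF u_sim(1)[OF u]] mult_ac)
    then show ?thesis using z dist_triangle2[of "word_map u y" x "word_map u z"] by linarith
  qed
  have point: "mass x \<rho> powr q \<le> (\<Sum>u\<in>?I. ?w u * v u * ?m u x powr q)" for x
  proof -
    \<comment> \<open>The cylinders, as images of \<open>cball 0 rad\<close>, that meet the ball;
      all other words contribute mass zero.\<close>
    define N where "N = {u \<in> ?I. word_map u -` cball x \<rho> \<inter> cball 0 rad \<noteq> {}}"
    define V where "V = (\<Sum>u\<in>N. ?w u)"
    have N: "finite N" "N \<subseteq> ?I" using finite_cut by (auto simp: N_def)
    have "0 \<le> V" unfolding V_def using N u_sim by (intro sum_nonneg) auto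
    have zero: "?m u x = 0" if "u \<in> ?I - N" for u
    proof (rule ccontr)
      assume "?m u x \<noteq> 0"
      then have "0 < ?m u x" by (simp add: zero_less_measure_iff)
      moreover have "word_map u -` cball x \<rho> \<in> sets borel"
        using that by (simp add: similarity_vimage_cball[OF u_sim(1)])
      ultimately show False using meets_rad that by (auto simp: N_def)
    qed
    have V_le: "V powr (q - 1) \<le> v u" if "u \<in> N" for u
    proof -
      have bound: "V \<le> mass (word_map u y) (nbhd * \<delta>)" if y: "y \<in> cball 0 rad" for y
      proof -
        let ?B = "cball (word_map u y) (nbhd * \<delta>)"
        \<comment> \<open>The enlarged ball about any point of one of these cylinders contains all
          of them, so each contributes its full weight.\<close>
        have one: "measure \<mu> (word_map u' -` ?B) = 1" if u': "u' \<in> N" for u'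
        proof (rule contains_rad)
          show "cball 0 rad \<subseteq> word_map u' -` ?B"
          proof
            fix z :: "real ^ 'n" assume z: "z \<in> cball 0 rad"
            have "dist (word_map u' z) x \<le> \<rho> + 2 * rad * \<delta>" "dist (word_map u y) x \<le> \<rho> + 2 * rad * \<delta>"
              using close[of u' z x] close[of u y x] y z u' \<open>u \<in> N\<close> by (auto simp: N_def)
            then have "dist (word_map u y) (word_map u' z) \<le> (\<rho> + 2 * rad * \<delta>) + (\<rho> + 2 * rad * \<delta>)"
              using dist_triangle2[of "word_map u y" "word_map u' z" x] by linarith
            also have "\<dots> \<le> nbhd * \<delta>" using \<rho> by (simp add: nbhd_def algebra_simps)
            finally show "z \<in> word_map u' -` ?B" by simp
          qed
          show "word_map u' -` ?B \<in> sets borel"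
            using u' N by (subst similarity_vimage_cball[OF u_sim(1)]) auto
        qed
        have "V = (\<Sum>u'\<in>N. ?w u' * measure \<mu> (word_map u' -` ?B))"
          unfolding V_def by (intro sum.cong refl) (simp add: one)
        also have "\<dots> \<le> (\<Sum>u'\<in>?I. ?w u' * measure \<mu> (word_map u' -` ?B))"
          using N u_sim finite_cut by (intro sum_mono2) auto
        also have "\<dots> = measure \<mu> ?B" by (rule measure_cut[symmetric]) simp
        finally show ?thesis .
      qed
      have u: "u \<in> ?I" using that N by auto
      have meas: "word_map u \<in> borel_measurable borel"
        by (rule measurable_word_map[OF cut_letters[OF u]])
      have "(\<integral>y. V powr (q - 1) \<partial>\<mu>) \<le> v u"
        unfolding v_def
      proof (rule integral_mono_AE)
        show "AE y in \<mu>. V powr (q - 1) \<le> mass (word_map u y) (nbhd * \<delta>) powr (q - 1)"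
          using AE_rad by eventually_elim (use bound q \<open>0 \<le> V\<close> in \<open>auto intro!: powr_mono2\<close>)
      qed (use integrable_powr_cball[OF _ meas] q in auto)
      then show ?thesis by (simp add: prob_space)
    qed
    have "mass x \<rho> = (\<Sum>u\<in>?I. ?w u * ?m u x)" by (rule measure_cut) simp
    also have "\<dots> = (\<Sum>u\<in>N. ?w u * ?m u x)"
      using finite_cut N zero by (intro sum.mono_neutral_right) auto
    finally have "mass x \<rho> powr q = (\<Sum>u\<in>N. ?w u * ?m u x) powr q" by simp
    also have "\<dots> \<le> V powr (q - 1) * (\<Sum>u\<in>N. ?w u * ?m u x powr q)"
      unfolding V_def using N u_sim q by (intro powr_weighted_sum_le) auto
    also have "\<dots> = (\<Sum>u\<in>N. V powr (q - 1) * (?w u * ?m u x powr q))"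
      by (rule sum_distrib_left)
    also have "\<dots> \<le> (\<Sum>u\<in>N. v u * (?w u * ?m u x powr q))"
      using N u_sim V_le by (intro sum_mono mult_right_mono) auto
    also have "\<dots> \<le> (\<Sum>u\<in>?I. v u * (?w u * ?m u x powr q))"
      using N u_sim finite_cut v_nonneg by (intro sum_mono2) auto
    finally show ?thesis by (simp add: mult_ac)
  qed
  have "(\<Sum>x\<in>C. mass x \<rho> powr q) \<le> (\<Sum>x\<in>C. \<Sum>u\<in>?I. ?w u * v u * ?m u x powr q)"
    by (intro sum_mono point)
  also have "\<dots> = (\<Sum>u\<in>?I. ?w u * v u * (\<Sum>x\<in>C. ?m u x powr q))"
    by (subst sum.swap) (simp add: sum_distrib_left)
  finally have "ennreal (\<Sum>x\<in>C. mass x \<rho> powr q) \<le>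
      ennreal (\<Sum>u\<in>?I. ?w u * v u * (\<Sum>x\<in>C. ?m u x powr q))"
    by (rule ennreal_leI)
  also have "\<dots> = (\<Sum>u\<in>?I. ennreal (?w u * v u * (\<Sum>x\<in>C. ?m u x powr q)))"
    using u_sim v_nonneg by (intro sum_ennreal[symmetric] mult_nonneg_nonneg sum_nonneg) auto
  also have "\<dots> = (\<Sum>u\<in>?I. ennreal (?w u * v u) * ennreal (\<Sum>x\<in>C. ?m u x powr q))"
    using u_sim v_nonneg by (intro sum.cong refl ennreal_mult' mult_nonneg_nonneg) auto
  also have "\<dots> \<le> (\<Sum>u\<in>?I. ennreal (?w u * v u) * packing_sum \<mu> q (\<rho> / word_ratio u))"
    using C u_sim by (intro sum_mono mult_left_mono packing_sum_vimage) auto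
  finally show "ennreal (\<Sum>x\<in>C. mass x \<rho> powr q) \<le>
      (\<Sum>u\<in>?I. ennreal (?w u * v u) * packing_sum \<mu> q (\<rho> / word_ratio u))" .
qed

text \<open>Self-similarity read backwards: the factors left by \<open>packing_sum_cut_step\<close>
  add up to exactly one moment of \<mu>.\<close>

lemma moment_cut:
  assumes "0 \<le> s"
  shows "(\<Sum>u\<in>cut n \<delta>. word_weight u * (\<integral>y. mass (word_map u y) \<rho> powr s \<partial>\<mu>)) = moment s \<rho>"
proof -
  have eq: "(\<integral>\<^sup>+y. ennreal (mass (f y) \<rho> powr s) \<partial>\<mu>) =
      ennreal (\<integral>y. mass (f y) \<rho> powr s \<partial>\<mu>)" if "f \<in> borel_measurable borel" for f
    using integrable_powr_cball[OF assms that] by (intro nn_integral_eq_integral) auto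
  have "ennreal (moment s \<rho>) = (\<integral>\<^sup>+x. ennreal (mass x \<rho> powr s) \<partial>\<mu>)"
    unfolding moment_def using eq[of "\<lambda>x. x"] by simp
  also have "\<dots> = (\<Sum>u\<in>cut n \<delta>. ennreal (word_weight u) *
      (\<integral>\<^sup>+y. ennreal (mass (word_map u y) \<rho> powr s) \<partial>\<mu>))"
    by (rule nn_integral_cut) measurable
  also have "\<dots> = (\<Sum>u\<in>cut n \<delta>. ennreal (word_weight u *
      (\<integral>y. mass (word_map u y) \<rho> powr s \<partial>\<mu>)))"
  proof (intro sum.cong refl)
    fix u assume u: "u \<in> cut n \<delta>"
    have "word_map u \<in> borel_measurable borel" by (rule measurable_word_map[OF cut_letters[OF u]])
    then show "ennreal (word_weight u) * (\<integral>\<^sup>+y. ennreal (mass (word_map u y) \<rho> powr s) \<partial>\<mu>) =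
        ennreal (word_weight u * (\<integral>y. mass (word_map u y) \<rho> powr s \<partial>\<mu>))"
      using word_weight_nonneg[OF cut_letters[OF u]] by (simp add: eq ennreal_mult')
  qed
  also have "\<dots> = ennreal (\<Sum>u\<in>cut n \<delta>. word_weight u *
      (\<integral>y. mass (word_map u y) \<rho> powr s \<partial>\<mu>))"
    using word_weight_nonneg[OF cut_letters] by (intro sum_ennreal mult_nonneg_nonneg) auto
  finally show ?thesis
    by (intro ennreal_inj[THEN iffD1, symmetric])
       (use word_weight_nonneg[OF cut_letters] in \<open>auto simp: moment_def intro!: sum_nonneg mult_nonneg_nonneg\<close>)
qed

text \<open>An inequality at one scale \<delta> governs all smaller scales. The stopped words act as
  a new system with ratios between \<open>\<delta> * rmin\<close> and \<delta>, and
  \<open>le\<close> is what \<open>scaling_recursion\<close> asks of its coefficients, since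
  \<open>t \<ge> 0\<close>. Packing sums are at most 1 at every scale because the balls are disjoint
  and \<open>q \<ge> 1\<close>.\<close>

lemma Lq_spectrum_ge_moment:
  assumes q: "1 \<le> q" and \<delta>: "0 < \<delta>" "\<delta> < 1" and t: "0 \<le> t"
    and le: "moment (q - 1) (nbhd * \<delta>) \<le> (\<delta> * rmin) powr t"
  shows "ereal t \<le> Lq_spectrum \<mu> q"
proof -
  obtain n where n: "rmax ^ n \<le> \<delta>"
    using real_arch_pow_inv[OF \<delta>(1) rmax_less_1] by (auto intro: less_imp_le)
  define v where "v u = (\<integral>y. mass (word_map u y) (nbhd * \<delta>) powr (q - 1) \<partial>\<mu>)" for u
  have v: "0 \<le> v u" for u unfolding v_def by (intro integral_nonneg_AE) auto
  have cut: "\<delta> * rmin \<le> word_ratio u \<and> word_ratio u \<le> \<delta> \<and> 0 \<le> word_weight u" if "u \<in> cut n \<delta>" for u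
    using cut_ratio[OF n that] \<delta> word_weight_nonneg[OF cut_letters[OF that]] by auto
  have pos: "0 < \<delta> * rmin" using \<delta> rmin_pos by simp
  obtain C where C: "0 < C" "\<And>\<rho>. 0 < \<rho> \<Longrightarrow> \<rho> \<le> \<delta> \<Longrightarrow> packing_sum \<mu> q \<rho> \<le> ennreal (C * \<rho> powr t)"
  proof (rule scaling_recursion[of "cut n \<delta>" "\<delta> * rmin" word_ratio \<delta> "\<lambda>u. word_weight u * v u" \<delta> t
        "packing_sum \<mu> q" 1])
    have "(\<Sum>u\<in>cut n \<delta>. word_weight u * v u * word_ratio u powr - t) \<le>
        (\<Sum>u\<in>cut n \<delta>. word_weight u * v u * (\<delta> * rmin) powr - t)"
      using cut v t pos by (intro sum_mono mult_left_mono powr_mono2') auto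
    also have "\<dots> = moment (q - 1) (nbhd * \<delta>) * (\<delta> * rmin) powr - t"
      using moment_cut[where s = "q - 1" and n = n and \<delta> = \<delta> and \<rho> = "nbhd * \<delta>"] q by (simp add: v_def flip: sum_distrib_right)
    also have "\<dots> \<le> (\<delta> * rmin) powr t * (\<delta> * rmin) powr - t"
      by (intro mult_right_mono le) simp
    also have "\<dots> = 1" using pos by (metis add.right_inverse powr_add powr_zero_eq_one less_irrefl)
    finally show "(\<Sum>u\<in>cut n \<delta>. word_weight u * v u * word_ratio u powr - t) \<le> 1" .
    show "packing_sum \<mu> q \<rho> \<le>
        (\<Sum>u\<in>cut n \<delta>. ennreal (word_weight u * v u) * packing_sum \<mu> q (\<rho> / word_ratio u))"
      if "0 < \<rho>" "\<rho> < \<delta>" for \<rho>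
      unfolding v_def using that by (intro packing_sum_cut_step[OF q n \<delta>(2)]) auto
    show "packing_sum \<mu> q \<rho> \<le> ennreal 1" for \<rho>
      unfolding packing_sum_def
    proof (rule SUP_least, rule ennreal_leI, clarify)
      fix P :: "(real ^ 'n) set" assume P: "finite P" "disjoint_family_on (\<lambda>x. cball x \<rho>) P"
      have "(\<Sum>x\<in>P. mass x \<rho> powr q) \<le> (\<Sum>x\<in>P. mass x \<rho>)"
      proof (rule sum_mono)
        fix x
        show "mass x \<rho> powr q \<le> mass x \<rho>"
          using powr_mono'[of 1 q "mass x \<rho>"] q by simp
      qed
      also have "\<dots> = measure \<mu> (\<Union>x\<in>P. cball x \<rho>)"
        using P by (intro finite_measure_finite_Union[symmetric]) (auto simp: sets_\<mu>)
      also have "\<dots> \<le> 1" by (rule prob_le_1)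
      finally show "(\<Sum>x\<in>P. mass x \<rho> powr q) \<le> 1" .
    qed
  qed (use finite_cut cut v pos \<delta> rmin_pos rmin_le_rmax rmax_less_1 that in \<open>auto simp: mult_le_cancel_left1\<close>)
  show ?thesis
    using C by (intro Lq_spectrum_ge[OF C(1) \<delta>(1)] Theta_le_packing_sum) (auto simp: less_imp_le)
qed

end

section \<open>Moments at a small fixed scale\<close>

context self_similar
begin

text \<open>The integrand is at most \<open>x powr s\<close> on the good set and at most 1
  elsewhere.\<close>

lemma moment_le:
  assumes s: "0 \<le> s" and x: "0 \<le> x" "x \<le> 1"
    and good: "1 - \<eta> \<le> measure \<mu> {z. mass z \<rho> \<le> x}"
  shows "moment s \<rho> \<le> 1 - (1 - \<eta>) * (1 - x powr s)"
proof -
  define G where "G = {z. mass z \<rho> \<le> x}"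
  have G: "G \<in> sets \<mu>" unfolding G_def sets_\<mu> by measurable
  have "moment s \<rho> \<le> (\<integral>z. 1 - (1 - x powr s) * indicator G z \<partial>\<mu>)"
    unfolding moment_def
  proof (rule integral_mono)
    show "integrable \<mu> (\<lambda>z. mass z \<rho> powr s)"
      using integrable_powr_cball[OF s, of "\<lambda>x. x"] by simp
    show "integrable \<mu> (\<lambda>z. 1 - (1 - x powr s) * indicator G z)"
      using G by (intro Bochner_Integration.integrable_diff integrable_mult_right) (auto simp: emeasure_eq_measure)
    fix z
    have "mass z \<rho> powr s \<le> 1" using s by (intro powr_le1) auto
    moreover have "mass z \<rho> powr s \<le> x powr s" if "z \<in> G"
      using that s by (intro powr_mono2) (auto simp: G_def)
    ultimately show "mass z \<rho> powr s \<le> 1 - (1 - x powr s) * indicator G z"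
      by (auto simp: indicator_def)
  qed
  also have "\<dots> = 1 - (1 - x powr s) * measure \<mu> G"
    using G by (simp add: prob_space emeasure_eq_measure)
  also have "\<dots> \<le> 1 - (1 - x powr s) * (1 - \<eta>)"
    using good s x by (intro diff_left_mono mult_left_mono) (auto simp: G_def powr_le1)
  finally show ?thesis by (simp add: mult.commute)
qed

lemma small_ball_probability:
  assumes dim: "has_measure_dim \<mu> D" and "a < D" "0 < c" "0 < \<eta>"
  shows "\<forall>\<^sub>F n in sequentially. 1 - \<eta> \<le> measure \<mu> {z. mass z (c * (1/2) ^ n) \<le> (c * (1/2) ^ n) powr a}"
proof -
  define G where "G k = {z. \<forall>n\<ge>k. mass z (c * (1/2) ^ n) \<le> (c * (1/2) ^ n) powr a}" for k
  have G: "G k \<in> sets \<mu>" for k unfolding G_def sets_\<mu> by measurable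
  have "AE z in \<mu>. z \<in> (\<Union>k. G k)"
    using dim[unfolded has_measure_dim_def]
  proof eventually_elim
    case (elim z)
    have "0 < D - a" using assms by simp
    have "\<forall>\<^sub>F \<rho> in at_right 0. mass z \<rho> \<le> \<rho> powr a"
      using has_local_dim_bounds[OF finite_measure_axioms sets_\<mu> elim \<open>0 < D - a\<close>]
      by (rule eventually_mono) auto
    from eventually_half_power[OF this \<open>0 < c\<close>] show ?case
      by (auto simp: G_def eventually_sequentially)
  qed
  then have "measure \<mu> (\<Union>k. G k) = 1" using G by (subst prob_eq_1) auto
  moreover have "(\<lambda>k. measure \<mu> (G k)) \<longlonglongrightarrow> measure \<mu> (\<Union>k. G k)"
    using G by (intro finite_Lim_measure_incseq) (auto simp: incseq_def G_def)
  ultimately have "(\<lambda>k. measure \<mu> (G k)) \<longlonglongrightarrow> 1" by simp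
  then have "\<forall>\<^sub>F k in sequentially. 1 - \<eta> < measure \<mu> (G k)"
    using \<open>0 < \<eta>\<close> by (intro order_tendstoD) auto
  then show ?thesis
  proof eventually_elim
    case (elim n)
    have "measure \<mu> (G n) \<le> measure \<mu> {z. mass z (c * (1/2) ^ n) \<le> (c * (1/2) ^ n) powr a}"
    proof (rule measure_mono)
      show "{z. mass z (c * (1/2) ^ n) \<le> (c * (1/2) ^ n) powr a} \<in> sets borel"
        by measurable
    qed (auto simp: G_def)
    then show ?case using elim by simp
  qed
qed

text \<open>At a fixed small scale \<open>\<delta>\<close> the function \<open>s \<mapsto> - ln (moment s (nbhd * \<delta>))\<close> vanishes at \<open>0\<close>
  with slope about \<open>D * ln (1 / \<delta>)\<close>, so \<open>Lq_spectrum_ge_moment\<close> applies for small \<open>s = q - 1\<close>.\<close>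

lemma Lq_spectrum_right_of_1:
  assumes dim: "has_measure_dim \<mu> D" and "b < D"
  shows "\<exists>s0>0. \<forall>q. 1 < q \<and> q < 1 + s0 \<longrightarrow> ereal ((q - 1) * b) \<le> Lq_spectrum \<mu> q"
\<comment> \<open>For \<open>b \<le> 0\<close> nonnegativity of the spectrum is enough; otherwise
  the exponent \<open>(q - 1) * b\<close> is nonnegative, as \<open>Lq_spectrum_ge_moment\<close>
  requires.\<close>
proof (cases "b \<le> 0")
  case True
  have "ereal ((q - 1) * b) \<le> Lq_spectrum \<mu> q" if "1 < q" for q
  proof -
    have "moment (q - 1) (nbhd * (1/2)) \<le> 1"
      using moment_le[of "q - 1" 1 1 "nbhd * (1/2)"] that by simp
    then have "ereal 0 \<le> Lq_spectrum \<mu> q"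
      using that rmin_pos by (intro Lq_spectrum_ge_moment[of q "1/2" 0]) (auto simp: less_imp_neq[THEN not_sym])
    moreover have "(q - 1) * b \<le> 0" using that True by (simp add: mult_nonneg_nonpos)
    ultimately show ?thesis by (meson ereal_less_eq(3) order_trans)
  qed
  then show ?thesis by (intro exI[of _ 1]) auto
next
  case False
  define a where "a = (b + D) / 2"
  have a: "b < a" "a < D" "0 < b" "0 < a" using \<open>b < D\<close> False by (auto simp: a_def)
  \<comment> \<open>Small enough that losing the fraction \<eta> of the mass still leaves the slope
    \<open>(a + b) / 2\<close>, which exceeds \<open>b\<close>.\<close>
  define \<eta> where "\<eta> = (a - b) / (2 * a)"
  have \<eta>: "0 < \<eta>" "(1 - \<eta>) * a = (a + b) / 2" using a by (auto simp: \<eta>_def field_simps)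
  have "0 < nbhd" using rad_ge_1 by (simp add: nbhd_def)
  define L where "L n = real n * ln 2" for n
  have L: "(1/2) ^ n = exp (- L n)" for n
    by (simp add: L_def exp_minus exp_of_nat_mult power_inverse inverse_eq_divide power_one_over)
  have L_lim: "filterlim L at_top sequentially"
    unfolding L_def by (intro filterlim_at_top_mult_tendsto_pos[OF tendsto_const _ filterlim_real_sequentially]) simp
  \<comment> \<open>Logarithms at \<open>\<delta> = (1/2) ^ n\<close>: \<open>lam n\<close> is that
    of \<open>1 / (nbhd * \<delta>) powr a\<close>, and \<open>\<kappa> n\<close> that of
    \<open>1 / (\<delta> * rmin) powr b\<close>. The terms free of \<open>L n\<close> are collected
    in \<open>B\<close>, which decides how large \<open>n\<close> must be.\<close>
  define lam where "lam n = a * (L n - ln nbhd)" for n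
  define \<kappa> where "\<kappa> n = b * (L n - ln rmin)" for n
  define B where "B = (a + b) / 2 * ln nbhd - b * ln rmin"
  have "\<forall>\<^sub>F n in sequentially. L n > max (ln nbhd) (2 * B / (a - b))"
    using L_lim unfolding filterlim_at_top_dense by blast
  moreover have "\<forall>\<^sub>F n in sequentially. 1 - \<eta> \<le>
      measure \<mu> {z. mass z (nbhd * (1/2) ^ n) \<le> (nbhd * (1/2) ^ n) powr a}"
    by (rule small_ball_probability) fact+
  ultimately have "\<forall>\<^sub>F n in sequentially. 0 < n \<and> L n > max (ln nbhd) (2 * B / (a - b)) \<and> 1 - \<eta> \<le>
      measure \<mu> {z. mass z (nbhd * (1/2) ^ n) \<le> (nbhd * (1/2) ^ n) powr a}"
    using eventually_gt_at_top[of 0] by eventually_elim auto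
  then obtain n where n: "0 < n" "L n > ln nbhd" "L n > 2 * B / (a - b)" and
    good: "1 - \<eta> \<le> measure \<mu> {z. mass z (nbhd * (1/2) ^ n) \<le> (nbhd * (1/2) ^ n) powr a}"
    by (auto simp: eventually_sequentially)
  define \<delta> where "\<delta> = (1/2 :: real) ^ n"
  have \<delta>: "0 < \<delta>" "\<delta> < 1" using n by (auto simp: \<delta>_def power_less_one_iff)
  have "0 < lam n" using n a by (simp add: lam_def)
  have nbhd_eq: "nbhd * \<delta> = exp (ln nbhd - L n)"
    using \<open>0 < nbhd\<close> exp_add[of "ln nbhd" "- L n"] by (simp add: \<delta>_def L)
  then have x_eq: "(nbhd * \<delta>) powr a = exp (- lam n)"
    by (simp add: powr_def lam_def algebra_simps)
  have r_eq: "(\<delta> * rmin) powr (s * b) = exp (- s * \<kappa> n)" for s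
  proof -
    have "\<delta> * rmin = exp (- L n + ln rmin)" using rmin_pos exp_add[of "- L n" "ln rmin"] by (simp add: \<delta>_def L)
    then show ?thesis by (simp add: powr_def \<kappa>_def algebra_simps)
  qed
  have "\<kappa> n < (1 - \<eta>) * lam n"
  proof -
    have "2 * B < L n * (a - b)" using n(3) a by (simp add: pos_divide_less_eq)
    moreover have "(1 - \<eta>) * lam n = (a + b) / 2 * (L n - ln nbhd)"
      using \<eta> by (simp add: lam_def mult.assoc[symmetric])
    ultimately show ?thesis by (simp add: B_def \<kappa>_def field_simps)
  qed
  \<comment> \<open>The required bound minus the bound on the moment. It vanishes at 0 with positive
    derivative, so it is positive for small \<open>s\<close>; the scale \<open>n\<close> is already
    fixed and does not depend on \<open>s\<close>.\<close>
  define F where "F s = exp (- s * \<kappa> n) - (1 - (1 - \<eta>) * (1 - exp (- s * lam n)))" for s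
  have "(F has_real_derivative ((1 - \<eta>) * lam n - \<kappa> n)) (at 0)"
    unfolding F_def by (auto intro!: derivative_eq_intros)
  from DERIV_pos_inc_right[OF this] \<open>\<kappa> n < (1 - \<eta>) * lam n\<close>
  obtain s0 where s0: "0 < s0" "\<And>h. 0 < h \<Longrightarrow> h < s0 \<Longrightarrow> F 0 < F (0 + h)" by auto
  have "ereal ((q - 1) * b) \<le> Lq_spectrum \<mu> q" if q: "1 < q" "q < 1 + s0" for q
  proof (rule Lq_spectrum_ge_moment[of q \<delta>])
    have "moment (q - 1) (nbhd * \<delta>) \<le> 1 - (1 - \<eta>) * (1 - ((nbhd * \<delta>) powr a) powr (q - 1))"
      using good q \<open>0 < lam n\<close> by (intro moment_le) (auto simp: \<delta>_def[symmetric] x_eq)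
    also have "((nbhd * \<delta>) powr a) powr (q - 1) = exp (- (q - 1) * lam n)"
      by (simp only: x_eq) (simp add: powr_def algebra_simps)
    also have "1 - (1 - \<eta>) * (1 - exp (- (q - 1) * lam n)) \<le> exp (- (q - 1) * \<kappa> n)"
      using s0(2)[of "q - 1"] q by (simp add: F_def)
    finally show "moment (q - 1) (nbhd * \<delta>) \<le> (\<delta> * rmin) powr ((q - 1) * b)"
      by (simp only: r_eq)
  qed (use q \<delta> a in auto)
  then show ?thesis using s0(1) by (intro exI[of _ s0]) auto
qed

end

section \<open>Derivatives of the spectrum\<close>

lemma has_ereal_derivative_transfer:
  assumes h: "(h has_real_derivative D) (at x within S)"
    and "f x = ereal (h x)" "\<forall>\<^sub>F y in at x within S. f y = ereal (h y)"
  shows "has_ereal_derivative f D x S"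
  unfolding has_ereal_derivative_def
proof (intro conjI)
  show "\<forall>\<^sub>F y in at x within S. \<bar>f y\<bar> \<noteq> \<infinity>"
    using assms(3) by (rule eventually_mono) auto
  have "((\<lambda>y. (h y - h x) / (y - x)) \<longlongrightarrow> D) (at x within S)"
    using h by (simp add: has_field_derivative_iff)
  moreover have "\<forall>\<^sub>F y in at x within S. (h y - h x) / (y - x) =
      (real_of_ereal (f y) - real_of_ereal (f x)) / (y - x)"
    using assms(3) by (rule eventually_mono) (simp add: assms(2))
  ultimately show "((\<lambda>y. real_of_ereal (f y)) has_real_derivative D) (at x within S)"
    unfolding has_field_derivative_iff by (rule Lim_transform_eventually)
qed (simp add: assms(2))

lemma has_ereal_derivative_split:
  assumes "has_ereal_derivative f D x {..<x}" "has_ereal_derivative f D x {x<..}"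
  shows "has_ereal_derivative f D x UNIV"
  using assms unfolding has_ereal_derivative_def has_field_derivative_iff
  by (simp add: filterlim_at_split eventually_at_split)

lemma has_ereal_derivative_right_squeeze:
  assumes f: "f x = ereal 0" and up: "\<And>y. x < y \<Longrightarrow> f y \<le> ereal ((y - x) * D)"
    and lo: "\<And>b. b < D \<Longrightarrow> \<exists>s>0. \<forall>y. x < y \<and> y < x + s \<longrightarrow> ereal ((y - x) * b) \<le> f y"
  shows "has_ereal_derivative f D x {x<..}"
  unfolding has_ereal_derivative_def
proof (intro conjI)
  have *: "\<forall>\<^sub>F y in at_right x. \<bar>f y\<bar> \<noteq> \<infinity> \<and> b \<le> real_of_ereal (f y) / (y - x) \<and> real_of_ereal (f y) / (y - x) \<le> D"
    if b: "b < D" for b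
  proof -
    obtain s where s: "s > 0" "\<And>y. x < y \<Longrightarrow> y < x + s \<Longrightarrow> ereal ((y - x) * b) \<le> f y" using lo[OF b] by auto
    have "\<bar>f y\<bar> \<noteq> \<infinity> \<and> b \<le> real_of_ereal (f y) / (y - x) \<and> real_of_ereal (f y) / (y - x) \<le> D"
      if y: "x < y" "y < x + s" for y
    proof -
      have "ereal ((y - x) * b) \<le> f y" "f y \<le> ereal ((y - x) * D)" using s(2) up y by auto
      then show ?thesis using y by (cases "f y") (auto simp: field_simps)
    qed
    then show ?thesis using s(1) unfolding eventually_at_right_field by (intro exI[of _ "x + s"]) auto
  qed
  show "\<forall>\<^sub>F y in at_right x. \<bar>f y\<bar> \<noteq> \<infinity>"
    using *[of "D - 1"] by (auto elim: eventually_mono)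
  have "((\<lambda>y. real_of_ereal (f y) / (y - x)) \<longlongrightarrow> D) (at_right x)"
  proof (rule order_tendstoI)
    fix c assume "c < D"
    then obtain b where "c < b" "b < D" using dense by blast
    from *[OF this(2)] show "\<forall>\<^sub>F y in at_right x. c < real_of_ereal (f y) / (y - x)"
      by (rule eventually_mono) (use \<open>c < b\<close> in auto)
  next
    fix c assume "D < c"
    from *[of "D - 1"] show "\<forall>\<^sub>F y in at_right x. real_of_ereal (f y) / (y - x) < c"
      by (auto elim!: eventually_mono simp: \<open>D < c\<close> intro: le_less_trans[OF _ \<open>D < c\<close>])
  qed
  then show "((\<lambda>y. real_of_ereal (f y)) has_real_derivative D) (at_right x)"
    by (simp add: has_field_derivative_iff f)
qed (simp add: f)

text \<open>The line with slope \<alpha> lies above \<open>f\<close> and touches it at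
  \<open>q\<close>, where the infimum is therefore attained.\<close>

lemma conjugate_eq:
  assumes "\<And>q'. f q' \<le> ereal (q' * \<alpha> - s)" "f q = ereal (q * \<alpha> - s)"
  shows "conjugate f \<alpha> = ereal s"
  unfolding conjugate_def
proof (rule antisym)
  have "(INF q. ereal (\<alpha> * q) - f q) \<le> ereal (\<alpha> * q) - f q" by (rule INF_lower) simp
  then show "(INF q. ereal (\<alpha> * q) - f q) \<le> ereal s" by (simp add: assms(2) mult.commute)
  show "ereal s \<le> (INF q. ereal (\<alpha> * q) - f q)"
  proof (rule INF_greatest)
    fix q'
    show "ereal s \<le> ereal (\<alpha> * q') - f q'"
      using assms(1)[of q'] by (cases "f q'") (auto simp: mult.commute)
  qed
qed

section \<open>Dimensional regular systems\<close>

locale regular_self_similar = self_similar l \<phi> r p \<mu>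
  for l :: nat and \<phi> :: "nat \<Rightarrow> real ^ 'n \<Rightarrow> real ^ 'n" and r p :: "nat \<Rightarrow> real"
    and \<mu> :: "(real ^ 'n) measure" +
  assumes regular: "dimensional_regular l \<phi> r"
begin

abbreviation \<tau> :: "real \<Rightarrow> ereal" where "\<tau> \<equiv> Lq_spectrum \<mu>"

abbreviation formalism :: bool where
  "formalism \<equiv> \<exists>D1 D0. has_ereal_derivative \<tau> D1 1 UNIV \<and> has_ereal_derivative \<tau> D0 0 {0<..} \<and>
      (\<forall>\<alpha>\<in>{D1..D0}. hausdorff_dim (level_set \<mu> \<alpha>) = conjugate \<tau> \<alpha>)"

lemma tilted_regular:
  assumes q: "0 \<le> q" "q \<le> 1" and dim: "q * dT q - T q \<le> real CARD('n)"
  shows "\<tau> q' \<le> ereal (q' * dT q - (q * dT q - T q))"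
    and "\<tau> q = ereal (T q)"
    and "hausdorff_dim (level_set \<mu> (dT q)) = conjugate \<tau> (dT q)"
proof -
  obtain \<nu> where \<nu>: "self_similar_measure l \<phi> (W q) \<nu>"
    using self_similar_measure_exists[OF W_weights] by blast
  have \<nu>_prob: "prob_space \<nu>" "sets \<nu> = sets borel"
    using \<nu> by (auto simp: self_similar_measure_def)
  have "has_measure_dim \<nu> (min (real CARD('n)) (similarity_dimension l r (W q)))"
    using regular W_weights[of q] \<nu> by (auto simp: dimensional_regular_def)
  then have \<nu>_dim: "has_measure_dim \<nu> (q * dT q - T q)"
    using dim by (simp add: similarity_dimension_W min_absorb2)
  have level: "AE x in \<nu>. has_local_dim \<mu> x (dT q)"
    by (rule AE_tilted_local_dim[OF \<nu> q \<nu>_dim])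
  show upper: "\<tau> q' \<le> ereal (q' * dT q - (q * dT q - T q))" for q'
    by (rule Lq_spectrum_le[OF \<nu>_prob level \<nu>_dim])
  show eq: "\<tau> q = ereal (T q)"
    using upper[of q] Lq_spectrum_ge_T[OF q] by (simp add: antisym)
  obtain C where C: "0 < C" "\<And>\<rho>. 0 < \<rho> \<Longrightarrow> \<rho> \<le> 1 \<Longrightarrow> packing_sum \<mu> q \<rho> \<le> ennreal (C * \<rho> powr T q)"
    using packing_sum_le_T[OF q] by metis
  have "hausdorff_dim (level_set \<mu> (dT q)) \<le> ereal (q * dT q - T q)"
    by (rule hausdorff_dim_level_set_le[OF q(1) C W_dim_nonneg])
  moreover have "ereal (q * dT q - T q) \<le> hausdorff_dim (level_set \<mu> (dT q))"
    using level by (intro hausdorff_dim_ge_local_dim[OF \<nu>_prob _ \<nu>_dim]) (simp add: level_set_def)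
  moreover have "conjugate \<tau> (dT q) = ereal (q * dT q - T q)"
    using upper by (rule conjugate_eq[where q = q]) (simp add: eq)
  ultimately show "hausdorff_dim (level_set \<mu> (dT q)) = conjugate \<tau> (dT q)" by simp
qed

lemma \<mu>_dim: "has_measure_dim \<mu> (min (real CARD('n)) (dT 1))"
  using regular prob ssm unfolding dT_1 by (auto simp: dimensional_regular_def)

lemma saturated_regular:
  assumes "real CARD('n) \<le> dT 1"
  shows "\<tau> q' \<le> ereal (real CARD('n) * (q' - 1))"
    and "q \<in> {0..1} \<Longrightarrow> \<tau> q = ereal (real CARD('n) * (q - 1))"
    and "hausdorff_dim (level_set \<mu> (real CARD('n))) = conjugate \<tau> (real CARD('n))"
proof -
  let ?d = "real CARD('n)"
  have dim: "has_measure_dim \<mu> ?d" using \<mu>_dim assms by (simp add: min_def)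
  then have level: "AE x in \<mu>. has_local_dim \<mu> x ?d" by (simp add: has_measure_dim_def)
  show upper: "\<tau> q' \<le> ereal (?d * (q' - 1))" for q'
    using Lq_spectrum_le[OF prob_space_axioms sets_\<mu> level dim, of q'] by (simp add: algebra_simps)
  show eq: "\<tau> q = ereal (?d * (q - 1))" if "q \<in> {0..1}" for q
  proof (rule antisym[OF upper])
    show "ereal (?d * (q - 1)) \<le> \<tau> q"
      \<comment> \<open>With \<open>q1 = 1\<close> and \<open>T 1 = 0\<close> the chord is the line
        from (0, -d) to (1, 0).\<close>
      using Lq_spectrum_ge_chord[of q 1] that by (simp add: T_1 algebra_simps)
  qed
  obtain C where C: "0 < C" "\<And>\<rho>. 0 < \<rho> \<Longrightarrow> \<rho> \<le> 1 \<Longrightarrow> packing_sum \<mu> 1 \<rho> \<le> ennreal (C * \<rho> powr T 1)"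
    using packing_sum_le_T[of 1] by auto
  have "hausdorff_dim (level_set \<mu> ?d) \<le> ereal (1 * ?d - T 1)"
    by (rule hausdorff_dim_level_set_le[OF _ C]) (auto simp: T_1)
  moreover have "ereal ?d \<le> hausdorff_dim (level_set \<mu> ?d)"
    using level by (intro hausdorff_dim_ge_local_dim[OF prob_space_axioms sets_\<mu> _ dim]) (simp add: level_set_def)
  moreover have "conjugate \<tau> ?d = ereal ?d"
    using upper eq[of 1] by (intro conjugate_eq[where q = 1]) (auto simp: algebra_simps)
  ultimately show "hausdorff_dim (level_set \<mu> ?d) = conjugate \<tau> ?d" by (simp add: T_1)
qed

text \<open>On the left the formula \<open>h\<close> is available. On the right the upper line comes
  from \<mu> as a measure of dimension \<open>D\<close> carried by its own level set, the lower
  lines from \<open>Lq_spectrum_right_of_1\<close>.\<close>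

lemma \<tau>_derivative_at_1:
  assumes D: "D = min (real CARD('n)) (dT 1)"
    and h: "(h has_real_derivative D) (at 1)" "h 1 = 0" and "a < 1"
    and left: "\<And>q. a \<le> q \<Longrightarrow> q \<le> 1 \<Longrightarrow> \<tau> q = ereal (h q)"
  shows "has_ereal_derivative \<tau> D 1 UNIV"
proof (rule has_ereal_derivative_split)
  show "has_ereal_derivative \<tau> D 1 {..<1}"
  proof (rule has_ereal_derivative_transfer)
    show "(h has_real_derivative D) (at_left 1)"
      using h(1) by (rule has_field_derivative_at_within)
    show "\<tau> 1 = ereal (h 1)" using left[of 1] \<open>a < 1\<close> by simp
    show "\<forall>\<^sub>F y in at_left 1. \<tau> y = ereal (h y)"
      unfolding eventually_at_left_field using \<open>a < 1\<close> left by (intro exI[of _ a]) auto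
  qed
  have dim: "has_measure_dim \<mu> D" using \<mu>_dim D by simp
  show "has_ereal_derivative \<tau> D 1 {1<..}"
  proof (rule has_ereal_derivative_right_squeeze)
    show "\<tau> 1 = ereal 0" using left[of 1] h \<open>a < 1\<close> by simp
    show "\<tau> y \<le> ereal ((y - 1) * D)" for y
      using Lq_spectrum_le[OF prob_space_axioms sets_\<mu> _ dim, of D y] dim
      by (simp add: has_measure_dim_def algebra_simps)
  qed (use Lq_spectrum_right_of_1[OF dim] in blast)
qed

lemma \<tau>_derivative_interior:
  assumes h: "(h has_real_derivative D) (at q)" and "q \<in> {a<..<b}"
    and eq: "\<And>q. q \<in> {a<..<b} \<Longrightarrow> \<tau> q = ereal (h q)"
  shows "has_ereal_derivative \<tau> D q UNIV"
proof (rule has_ereal_derivative_transfer[OF h])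
  show "\<forall>\<^sub>F y in at q. \<tau> y = ereal (h y)"
    using eventually_at_in_open'[of "{a<..<b}" q] assms(2)
    by (auto elim!: eventually_mono intro: eq)
qed (use assms in auto)

lemma \<tau>_derivative_at_0:
  assumes h: "(h has_real_derivative D) (at 0)" and "0 < a"
    and eq: "\<And>q. 0 \<le> q \<Longrightarrow> q < a \<Longrightarrow> \<tau> q = ereal (h q)"
  shows "has_ereal_derivative \<tau> D 0 {0<..}"
proof (rule has_ereal_derivative_transfer)
  show "(h has_real_derivative D) (at_right 0)" using h by (rule has_field_derivative_at_within)
  show "\<forall>\<^sub>F y in at_right 0. \<tau> y = ereal (h y)"
    unfolding eventually_at_right_field using assms by (intro exI[of _ a]) auto
qed (use assms in auto)

lemma dT_attains:
  assumes "a \<le> 1" "dT 1 \<le> \<alpha>" "\<alpha> \<le> dT a"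
  obtains q where "a \<le> q" "q \<le> 1" "dT q = \<alpha>"
proof -
  have "continuous_on {a..1} dT" using continuous_dT by (rule continuous_on_subset) simp
  then have "\<exists>q\<ge>a. q \<le> 1 \<and> dT q = \<alpha>" using assms by (intro IVT2') auto
  then show ?thesis using that by blast
qed

lemma tilted_from:
  assumes q0: "0 \<le> q0" and dim: "q0 * dT q0 - T q0 \<le> real CARD('n)" and q: "q0 \<le> q" "q \<le> 1"
  shows "\<tau> q = ereal (T q)" "hausdorff_dim (level_set \<mu> (dT q)) = conjugate \<tau> (dT q)"
  using tilted_regular[of q] W_dim_antimono[OF q0 q(1)] assms by auto

lemma T_has_derivative_1: "dT 1 < real CARD('n) \<Longrightarrow> (T has_real_derivative min (real CARD('n)) (dT 1)) (at 1)"
  using has_derivative_T[of 1] by (simp add: min_def)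

lemma saturated_case:
  assumes "real CARD('n) \<le> dT 1"
  shows "\<forall>q\<in>{0<..1}. \<exists>D. has_ereal_derivative \<tau> D q UNIV"
    and formalism
proof -
  let ?d = "real CARD('n)"
  note eq = saturated_regular(2)[OF assms]
  have h: "((\<lambda>q. ?d * (q - 1)) has_real_derivative ?d) (at q)" for q
    by (auto intro!: derivative_eq_intros)
  have at_1: "has_ereal_derivative \<tau> ?d 1 UNIV"
    using assms h eq by (intro \<tau>_derivative_at_1[where a = 0 and h = "\<lambda>q. ?d * (q - 1)"]) auto
  have interior: "has_ereal_derivative \<tau> ?d q UNIV" if "q \<in> {0<..<1}" for q
    by (rule \<tau>_derivative_interior[OF h that]) (use eq in auto)
  show "\<forall>q\<in>{0<..1}. \<exists>D. has_ereal_derivative \<tau> D q UNIV"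
    using at_1 interior by (metis greaterThanAtMost_iff greaterThanLessThan_iff less_le)
  have "has_ereal_derivative \<tau> ?d 0 {0<..}"
    by (rule \<tau>_derivative_at_0[OF h zero_less_one]) (use eq in auto)
  then show formalism
    \<comment> \<open>Both end slopes equal d, so \<alpha> = d is the only value to be
      treated.\<close>
    using at_1 saturated_regular(3)[OF assms] by (intro exI[of _ ?d]) auto
qed

lemma unsaturated_case:
  assumes "dT 1 < real CARD('n)" "- real CARD('n) \<le> T 0"
  shows "\<forall>q\<in>{0..1}. \<tau> q = ereal (T q)"
    and "\<forall>q\<in>{0<..1}. \<exists>D. has_ereal_derivative \<tau> D q UNIV"
    and formalism
proof -
  \<comment> \<open>The assumption on \<open>T 0\<close> is the dimension condition at
    \<open>q = 0\<close>; by monotonicity it extends to the whole interval.\<close>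
  have dim: "0 * dT 0 - T 0 \<le> real CARD('n)" using assms by simp
  note tilted = tilted_from[OF order_refl dim]
  show eq: "\<forall>q\<in>{0..1}. \<tau> q = ereal (T q)" using tilted(1) by auto
  have at_1: "has_ereal_derivative \<tau> (min (real CARD('n)) (dT 1)) 1 UNIV"
    using eq T_1 T_has_derivative_1 assms by (intro \<tau>_derivative_at_1[where a = 0 and h = T]) auto
  then have at_1: "has_ereal_derivative \<tau> (dT 1) 1 UNIV" using assms by (simp add: min_def)
  have interior: "has_ereal_derivative \<tau> (dT q) q UNIV" if "q \<in> {0<..<1}" for q
    by (rule \<tau>_derivative_interior[OF has_derivative_T that]) (use eq in auto)
  show "\<forall>q\<in>{0<..1}. \<exists>D. has_ereal_derivative \<tau> D q UNIV"
    using at_1 interior by (metis greaterThanAtMost_iff greaterThanLessThan_iff less_le)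
  have "has_ereal_derivative \<tau> (dT 0) 0 {0<..}"
    by (rule \<tau>_derivative_at_0[OF has_derivative_T zero_less_one]) (use eq in auto)
  moreover have "hausdorff_dim (level_set \<mu> \<alpha>) = conjugate \<tau> \<alpha>" if "\<alpha> \<in> {dT 1..dT 0}" for \<alpha>
    using dT_attains[of 0 \<alpha>] that tilted(2) by (metis atLeastAtMost_iff zero_le_one)
  ultimately show formalism
    using at_1 by blast
qed

text \<open>The dimension \<open>g\<close> of the tilted measures passes from above d at 0 to below
  d at 1, and \<open>g q' = d\<close> at the infimum. This equation says that the tangent of
  \<open>T\<close> at \<open>q'\<close> passes through (0, -d).\<close>

lemma transition_case:
  assumes "dT 1 < real CARD('n)" "T 0 < - real CARD('n)"
  defines "q' \<equiv> Inf {q \<in> {0<..<1}. dT q * q - T q \<le> real CARD('n)}"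
  shows "\<forall>q\<in>{q'..1}. \<tau> q = ereal (T q)"
    and "\<forall>q\<in>{0..<q'}. \<tau> q = ereal (q * (real CARD('n) + T q') / q' - real CARD('n))"
    and "\<forall>q\<in>{0<..1}. \<exists>D. has_ereal_derivative \<tau> D q UNIV"
    and formalism
proof -
  let ?d = "real CARD('n)"
  define g where "g q = q * dT q - T q" for q
  define S where "S = {q \<in> {0<..<1}. dT q * q - T q \<le> ?d}"
  have g: "g 0 > ?d" "g 1 < ?d" using assms T_1 by (auto simp: g_def)
  have S: "q \<in> S \<longleftrightarrow> 0 < q \<and> q < 1 \<and> g q \<le> ?d" for q by (auto simp: S_def g_def mult.commute)
  have cont: "continuous_on A g" for A
    unfolding g_def using continuous_T continuous_dT
    by (intro continuous_intros) (auto intro: continuous_on_subset)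
  have root: "\<exists>x. 0 < x \<and> x \<le> c \<and> g x = ?d" if "0 \<le> c" "g c \<le> ?d" for c
  proof -
    have "\<exists>x\<ge>0. x \<le> c \<and> g x = ?d"
      by (rule IVT2') (use g cont that in \<open>auto intro: less_imp_le\<close>)
    then obtain x where "0 \<le> x" "x \<le> c" "g x = ?d" by blast
    then show ?thesis using g by (intro exI[of _ x]) (auto simp: le_less)
  qed
  obtain x1 where x1: "0 < x1" "x1 \<le> 1" "g x1 = ?d" using root[of 1] g by auto
  then have "x1 \<noteq> 1" using g by auto
  then have "x1 \<in> S" "x1 < 1" using x1 by (auto simp: S)
  have S_bdd: "bdd_below S" by (rule bdd_belowI[of _ 0]) (auto simp: S)
  have q'_S: "q' = Inf S" by (simp add: q'_def S_def)
  have "q' \<le> x1" unfolding q'_S by (rule cInf_lower[OF \<open>x1 \<in> S\<close> S_bdd])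
  have "closed {q \<in> {0..1}. g q \<le> ?d}"
    using continuous_closed_preimage[OF cont, of "{0..1}" "{..?d}"] by (simp add: vimage_def Int_def)
  moreover have "q' \<in> closure S"
    unfolding q'_S using \<open>x1 \<in> S\<close> S_bdd by (intro closure_contains_Inf) auto
  moreover have "S \<subseteq> {q \<in> {0..1}. g q \<le> ?d}" by (auto simp: S)
  ultimately have "q' \<in> {q \<in> {0..1}. g q \<le> ?d}" by (meson closure_minimal subsetD)
  then have q': "0 \<le> q'" "g q' \<le> ?d" by auto
  have "q' < 1" using \<open>q' \<le> x1\<close> \<open>x1 < 1\<close> by simp
  \<comment> \<open>A root in \<open>{0<..q'}\<close> belongs to \<open>S\<close>, so minimality
    makes it equal to \<open>q'\<close>; this gives equality in \<open>g q' \<le> ?d\<close> and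
    positivity of \<open>q'\<close>.\<close>
  obtain x where x: "0 < x" "x \<le> q'" "g x = ?d" using root[OF q'] by auto
  then have "x \<in> S" using \<open>q' < 1\<close> by (simp add: S)
  then have "q' \<le> x" unfolding q'_S by (intro cInf_lower S_bdd)
  then have "x = q'" using x by simp
  then have "0 < q'" and g_q': "g q' = ?d" using x by auto
  then have slope: "dT q' = (?d + T q') / q'" by (simp add: g_def field_simps)
  have dim: "q' * dT q' - T q' \<le> ?d" using g_q' by (simp add: g_def)
  note tilted = tilted_from[OF q'(1) dim]
  show right: "\<forall>q\<in>{q'..1}. \<tau> q = ereal (T q)" using tilted(1) by auto
  let ?h = "\<lambda>q. q * (?d + T q') / q' - ?d"
  show left: "\<forall>q\<in>{0..<q'}. \<tau> q = ereal (?h q)"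
  proof (rule ballI, rule antisym)
    fix q assume q: "q \<in> {0..<q'}"
    show "ereal (?h q) \<le> \<tau> q"
      using Lq_spectrum_ge_chord[of q q'] q \<open>0 < q'\<close> \<open>q' < 1\<close> by simp
    \<comment> \<open>The tilted measure at \<open>q'\<close> bounds the spectrum at every
      parameter, here by the tangent, which coincides with the chord.\<close>
    show "\<tau> q \<le> ereal (?h q)"
      using tilted_regular(1)[OF q'(1) _ dim, of q] \<open>q' < 1\<close> g_q' by (simp add: g_def slope)
  qed
  have h: "(?h has_real_derivative dT q') (at q)" for q
    unfolding slope using \<open>0 < q'\<close> by (auto intro!: derivative_eq_intros)
  have h_q': "?h q' = T q'" using \<open>0 < q'\<close> by simp
  have "has_ereal_derivative \<tau> (min ?d (dT 1)) 1 UNIV"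
    using right T_1 T_has_derivative_1 assms \<open>q' < 1\<close>
    by (intro \<tau>_derivative_at_1[where a = q' and h = T]) auto
  then have at_1: "has_ereal_derivative \<tau> (dT 1) 1 UNIV" using assms by (simp add: min_def)
  have at_q': "has_ereal_derivative \<tau> (dT q') q' UNIV"
  proof (rule has_ereal_derivative_split)
    have "\<tau> q' = ereal (T q')" using right \<open>q' < 1\<close> by auto
    show "has_ereal_derivative \<tau> (dT q') q' {..<q'}"
    proof (rule has_ereal_derivative_transfer[OF has_field_derivative_at_within[OF h]])
      show "\<tau> q' = ereal (?h q')" using \<open>\<tau> q' = ereal (T q')\<close> h_q' by simp
      show "\<forall>\<^sub>F y in at_left q'. \<tau> y = ereal (?h y)"
        unfolding eventually_at_left_field using \<open>0 < q'\<close> left by (intro exI[of _ 0]) auto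
    qed
    show "has_ereal_derivative \<tau> (dT q') q' {q'<..}"
    proof (rule has_ereal_derivative_transfer[OF has_field_derivative_at_within[OF has_derivative_T]])
      show "\<forall>\<^sub>F y in at_right q'. \<tau> y = ereal (T y)"
        unfolding eventually_at_right_field using \<open>q' < 1\<close> right by (intro exI[of _ 1]) auto
    qed fact
  qed
  show "\<forall>q\<in>{0<..1}. \<exists>D. has_ereal_derivative \<tau> D q UNIV"
  proof
    fix q :: real assume q: "q \<in> {0<..1}"
    consider "q < q'" | "q = q'" | "q' < q" "q < 1" | "q = 1" using q by fastforce
    then show "\<exists>D. has_ereal_derivative \<tau> D q UNIV"
    proof cases
      case 1
      have "has_ereal_derivative \<tau> (dT q') q UNIV"
        by (rule \<tau>_derivative_interior[OF h, where a = 0 and b = q']) (use 1 q left in auto)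
      then show ?thesis ..
    next
      case 3
      have "has_ereal_derivative \<tau> (dT q) q UNIV"
        by (rule \<tau>_derivative_interior[OF has_derivative_T, where a = q' and b = 1]) (use 3 right in auto)
      then show ?thesis ..
    qed (use at_q' at_1 in auto)
  qed
  have "has_ereal_derivative \<tau> (dT q') 0 {0<..}"
    by (rule \<tau>_derivative_at_0[OF h \<open>0 < q'\<close>]) (use left in auto)
  \<comment> \<open>The linear piece adds no new slopes: every \<alpha> in the range is
    \<open>dT q\<close> for some \<open>q\<close> in \<open>{q'..1}\<close>, where the tilted
    measure has the required dimension.\<close>
  moreover have "hausdorff_dim (level_set \<mu> \<alpha>) = conjugate \<tau> \<alpha>" if "\<alpha> \<in> {dT 1..dT q'}" for \<alpha>
    using dT_attains[of q' \<alpha>] that tilted(2) \<open>q' < 1\<close> by (metis atLeastAtMost_iff less_imp_le)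
  ultimately show formalism
    using at_1 by blast
qed

end

theorem theorem1p1:
  fixes l :: nat
    and \<phi> :: "nat \<Rightarrow> real ^ 'n \<Rightarrow> real ^ 'n"
    and r p :: "nat \<Rightarrow> real"
    and \<mu> :: "(real ^ 'n) measure"
    and d :: real and T :: "real \<Rightarrow> real" and \<tau> :: "real \<Rightarrow> ereal"
  defines "d \<equiv> real CARD('n)"
    and "T \<equiv> T_fun l r p"
    and "\<tau> \<equiv> Lq_spectrum \<mu>"
  assumes ifs: "similarity_ifs l \<phi> r"
    and regular: "dimensional_regular l \<phi> r"
    and prob: "positive_prob_vector l p"
    and self_similar: "self_similar_measure l \<phi> p \<mu>"
  shows
    "(deriv T 1 \<ge> d \<longrightarrow> (\<forall>q\<in>{0..1}. \<tau> q = ereal (d * (q - 1)))) \<and>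
     (deriv T 1 < d \<and> T 0 \<ge> - d \<longrightarrow> (\<forall>q\<in>{0..1}. \<tau> q = ereal (T q))) \<and>
     (deriv T 1 < d \<and> T 0 < - d \<longrightarrow>
        (let q' = Inf {q \<in> {0<..<1}. deriv T q * q - T q \<le> d} in
           (\<forall>q\<in>{q'..1}. \<tau> q = ereal (T q)) \<and>
           (\<forall>q\<in>{0..<q'}. \<tau> q = ereal (q * (d + T q') / q' - d)))) \<and>
     (\<forall>q\<in>{0<..1}. \<exists>D. has_ereal_derivative \<tau> D q UNIV) \<and>
     (\<exists>D1 D0. has_ereal_derivative \<tau> D1 1 UNIV \<and> has_ereal_derivative \<tau> D0 0 {0<..} \<and>
        (\<forall>\<alpha>\<in>{D1..D0}. hausdorff_dim (level_set \<mu> \<alpha>) = conjugate \<tau> \<alpha>))"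
proof -
  have "{1..l} \<noteq> {}" using prob by (force simp: positive_prob_vector_def)
  interpret regular_self_similar l \<phi> r p \<mu>
    by unfold_locales fact+
  show ?thesis
    unfolding d_def T_def \<tau>_def deriv_T Let_def
    using saturated_regular(2) saturated_case unsaturated_case transition_case
    by (meson linorder_not_less)
qed

end
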